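(* Every stratum of translation surfaces contains an infinite family of origamis whose Veech groups are totally non congruence groups. That is: for all integers $n\ge 1$, $g\geq 2$ and $\alpha_1,\ldots,\alpha_n\ge 1$ with $\alpha_1+\cdots+\alpha_n=2g-2$, the stratum $\mathcal{H}_g(\alpha_1,\ldots,\alpha_n)$ contains infinitely many (pairwise inequivalent) reduced origamis $O$ such that the Veech group $\Gamma(O)\subseteq \mathrm{SL}(2,\mathbb{Z})$ is a totally non congruence group.
   Context: A (finite) translation surface $(X,\mu)$ is a connected surface $X$ with an atlas $\mu$ to $\mathbb{R}^2$ all of whose transition maps are translations, such that the metric completion $\overline{X}$ (for the metric induced by the Euclidean metric) is a compact surface and $\overline{X}\setminus X$, the set of singularities, is discrete and consists of cone points with cone angle an integer multiple of $2\pi$. Two translation surfaces are equivalent if there is a homeomorphism between them which is a translation in each chart. The stratum $\mathcal{H}_g(\alpha_1,\ldots,\alpha_n)$ is the set of equivalence classes of translation surfaces with $\overline{X}$ of genus $g$ and exactly $n$ singularities, with cone angles $(\alpha_1+1)2\pi,\ldots,(\alpha_n+1)2\pi$; equivalently, pairs of a closed Riemann surface of genus $g$ and a holomorphic differential with zeroes of orders $\alpha_1,\ldots,\alpha_n$. An origami (square-tiled surface) is a translation surface obtained by gluing finitely many copies of the Euclidean unit square along their edges by translations (left edges to right edges, lower edges to upper edges, the result being connected), where $X$ is obtained from the resulting closed surface $\overline{X}$ by removing the singularities (the vertices of cone angle greater than $2\pi$). A saddle connection is a geodesic segment between two (possibly equal) singularities containing no singularity in its interior; its development vector is the vector in $\mathbb{R}^2$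 obtained by developing it via charts. An origami is reduced if the development vectors of all its saddle connections generate $\mathbb{Z}^2$. The Veech group $\Gamma(X,\mu)$ is the group of all matrices $A\in\mathrm{SL}(2,\mathbb{R})$ for which there is a homeomorphism of $X$ which in charts of $\mu$ is of the form $z\mapsto A z+b$ with $b\in\mathbb{R}^2$ (the matrix $A$ does not depend on the charts). For a reduced origami it is a finite index subgroup of $\mathrm{SL}(2,\mathbb{Z})$. A finite index subgroup $\Gamma$ of $\mathrm{SL}(2,\mathbb{Z})$ is called a totally non congruence group if for every $n\in\mathbb{N}$, $n\ge1$, the canonical projection $\mathrm{SL}(2,\mathbb{Z})\to \mathrm{SL}(2,\mathbb{Z}/n\mathbb{Z})$ maps $\Gamma$ onto $\mathrm{SL}(2,\mathbb{Z}/n\mathbb{Z})$. *)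

theory Defs
  imports
    "HOL-Analysis.Analysis"
    "HOL-Algebra.Coset"
    "HOL-Combinatorics.Permutations"
    "HOL-Computational_Algebra.Group_Closure"
begin

section \<open>Genus of a closed surface\<close>

text \<open>The model of the closed cell of dimension \<open>k \<le> 2\<close>: a point, the segment
  \<open>[-1, 1]\<close>, or the closed unit disc.\<close>

definition closed_cell :: "nat \<Rightarrow> complex set" where
  "closed_cell k = {z \<in> cball 0 1. (k = 0 \<longrightarrow> z = 0) \<and> (k = 1 \<longrightarrow> Im z = 0)}"

text \<open>A finite CW decomposition of dimension at most two: \<open>C\<close> is the set of open cells and
  \<open>\<Phi>\<close> is the characteristic map of the cell \<open>e\<close>. On an at most two-dimensional cell
  the open cell is the intersection of \<open>closed_cell k\<close> with the open unit ball
  (for \<open>k = 0\<close> this is the point itself) and its boundary the intersection with the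
  unit circle.\<close>

definition cell_decomposition :: "'a topology \<Rightarrow> 'a set set \<Rightarrow> ('a set \<Rightarrow> nat) \<Rightarrow> bool" where
  "cell_decomposition X C dm \<longleftrightarrow>
     finite C \<and> disjoint C \<and> \<Union>C = topspace X \<and>
     (\<forall>e\<in>C. dm e \<le> 2 \<and>
        (\<exists>\<Phi>. continuous_map (top_of_set (closed_cell (dm e))) X \<Phi> \<and>
             homeomorphic_map (top_of_set (closed_cell (dm e) \<inter> ball 0 1)) (subtopology X e) \<Phi> \<and>
             \<Phi> ` (closed_cell (dm e) \<inter> sphere 0 1) \<subseteq> \<Union>{e' \<in> C. dm e' < dm e}))"

text \<open>The genus of a closed oriented surface, given by its Euler characteristic
  \<open>\<chi> = 2 - 2g\<close>, where \<open>\<chi>\<close> is computed from a cell decomposition. By the invariance of the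
  Euler characteristic the choice of the decomposition is irrelevant.\<close>

definition has_genus :: "'a topology \<Rightarrow> nat \<Rightarrow> bool" where
  "has_genus X g \<longleftrightarrow>
     (\<exists>C dm. cell_decomposition X C dm \<and> (\<Sum>e\<in>C. (- 1 :: int) ^ dm e) = 2 - 2 * int g)"


section \<open>Translation surfaces\<close>

text \<open>The Euclidean plane is the type \<^typ>\<open>complex\<close>. A translation surface \<open>X\<close> is represented
  together with its completion: \<open>completion\<close> is the closed surface, \<open>singularities\<close> its subset
  of added points, and \<open>atlas\<close> the set of pairs of a chart domain \<open>U \<subseteq> X\<close> and a chart, of which
  only the values on \<open>U\<close> are relevant. That \<open>completion\<close> is
  the metric completion of \<open>X\<close> is ensured by its compactness and by the local model at the
  singularities (\<open>cone_point\<close> below), which is a punctured Euclidean cone completed by its apex.\<close>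

record 'a flat_surface =
  completion :: "'a topology"
  singularities :: "'a set"
  atlas :: "('a set \<times> ('a \<Rightarrow> complex)) set"

definition regular_part :: "'a flat_surface \<Rightarrow> 'a topology" where
  "regular_part S = subtopology (completion S) (topspace (completion S) - singularities S)"

definition locally_planar :: "'a topology \<Rightarrow> bool" where
  "locally_planar X \<longleftrightarrow>
     (\<forall>x\<in>topspace X. \<exists>U \<phi>. openin X U \<and> x \<in> U \<and> open (\<phi> ` U) \<and>
        homeomorphic_map (subtopology X U) (top_of_set (\<phi> ` U)) (\<phi> :: 'a \<Rightarrow> complex))"

definition translation_atlas :: "'a topology \<Rightarrow> ('a set \<times> ('a \<Rightarrow> complex)) set \<Rightarrow> bool" where
  "translation_atlas X \<A> \<longleftrightarrow>
     (\<Union>(U, \<phi>)\<in>\<A>. U) = topspace X \<and>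
     (\<forall>(U, \<phi>)\<in>\<A>. openin X U \<and> open (\<phi> ` U) \<and>
        homeomorphic_map (subtopology X U) (top_of_set (\<phi> ` U)) \<phi>) \<and>
     (\<forall>(U, \<phi>)\<in>\<A>. \<forall>(V, \<psi>)\<in>\<A>. \<forall>x\<in>U \<inter> V.
        \<exists>c W. openin X W \<and> x \<in> W \<and> W \<subseteq> U \<inter> V \<and> (\<forall>y\<in>W. \<psi> y = \<phi> y + c))"

text \<open>The point \<open>p\<close> is a cone point with cone angle \<open>2\<pi>k\<close>. The punctured disc with
  the flat structure developed by \<open>z \<mapsto> z ^ k\<close> is the \<open>k\<close>-fold connected covering of a
  punctured Euclidean disc; equivalently, the holomorphic differential \<open>dz\<close> of the translation
  structure is \<open>d(\<psi> ^ k)\<close> near \<open>p\<close> and has a zero of order \<open>k - 1\<close> there.\<close>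

definition cone_point :: "'a flat_surface \<Rightarrow> 'a \<Rightarrow> nat \<Rightarrow> bool" where
  "cone_point S p k \<longleftrightarrow> k \<ge> 1 \<and>
     (\<exists>U \<psi> r. openin (completion S) U \<and> p \<in> U \<and> U \<inter> singularities S \<subseteq> {p} \<and> r > 0 \<and>
        homeomorphic_map (subtopology (completion S) U) (top_of_set (ball (0 :: complex) r)) \<psi> \<and>
        \<psi> p = 0 \<and>
        (\<forall>(V, \<phi>)\<in>atlas S. \<forall>x\<in>(U - {p}) \<inter> V.
           \<exists>c W. openin (regular_part S) W \<and> x \<in> W \<and> W \<subseteq> U \<inter> V \<and> (\<forall>y\<in>W. \<phi> y = \<psi> y ^ k + c)))"

definition translation_surface :: "'a flat_surface \<Rightarrow> bool" where
  "translation_surface S \<longleftrightarrow>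
     compact_space (completion S) \<and> Hausdorff_space (completion S) \<and>
     locally_planar (completion S) \<and>
     singularities S \<subseteq> topspace (completion S) \<and> finite (singularities S) \<and>
     topspace (regular_part S) \<noteq> {} \<and> connected_space (regular_part S) \<and>
     translation_atlas (regular_part S) (atlas S) \<and>
     (\<forall>p\<in>singularities S. \<exists>k. cone_point S p k)"

text \<open>Members of the stratum are translation surfaces, not their equivalence classes;
  equivalence is \<open>translation_equivalent\<close> below.\<close>

definition stratum :: "nat \<Rightarrow> nat \<Rightarrow> (nat \<Rightarrow> nat) \<Rightarrow> 'a flat_surface set" where
  "stratum g n \<alpha> = {S. translation_surface S \<and> has_genus (completion S) g \<and>
     (\<exists>p. bij_betw p {1..n} (singularities S) \<and> (\<forall>i\<in>{1..n}. cone_point S (p i) (\<alpha> i + 1)))}"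


section \<open>Affine homeomorphisms and the Veech group\<close>

definition plane_map :: "real ^ 2 ^ 2 \<Rightarrow> complex \<Rightarrow> complex" where
  "plane_map A z = Complex (A $ 1 $ 1 * Re z + A $ 1 $ 2 * Im z) (A $ 2 $ 1 * Re z + A $ 2 $ 2 * Im z)"

definition affine_homeo ::
  "real ^ 2 ^ 2 \<Rightarrow> 'a flat_surface \<Rightarrow> 'b flat_surface \<Rightarrow> ('a \<Rightarrow> 'b) \<Rightarrow> bool" where
  "affine_homeo A S T f \<longleftrightarrow>
     homeomorphic_map (regular_part S) (regular_part T) f \<and>
     (\<forall>(U, \<phi>)\<in>atlas S. \<forall>(V, \<psi>)\<in>atlas T. \<forall>x\<in>U. f x \<in> V \<longrightarrow>
        (\<exists>b W. openin (regular_part S) W \<and> x \<in> W \<and> W \<subseteq> U \<and> f ` W \<subseteq> V \<and>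
           (\<forall>y\<in>W. \<psi> (f y) = plane_map A (\<phi> y) + b)))"

definition translation_equivalent :: "'a flat_surface \<Rightarrow> 'b flat_surface \<Rightarrow> bool" where
  "translation_equivalent S T \<longleftrightarrow> (\<exists>f. affine_homeo (mat 1) S T f)"

definition Veech_group :: "'a flat_surface \<Rightarrow> (real ^ 2 ^ 2) set" where
  "Veech_group S = {A. det A = 1 \<and> (\<exists>f. affine_homeo A S S f)}"


section \<open>Saddle connections\<close>

text \<open>The geodesic \<open>\<gamma>\<close> is parametrised with constant velocity on \<open>[0, 1]\<close>, so that its velocity
  \<open>v\<close> in the charts is its development vector. Constant \<open>\<gamma>\<close> are excluded since the
  interior of \<open>\<gamma>\<close> contains no singularity.\<close>

definition saddle_connection :: "'a flat_surface \<Rightarrow> (real \<Rightarrow> 'a) \<Rightarrow> complex \<Rightarrow> bool" where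
  "saddle_connection S \<gamma> v \<longleftrightarrow>
     continuous_map (top_of_set {0..1}) (completion S) \<gamma> \<and>
     \<gamma> 0 \<in> singularities S \<and> \<gamma> 1 \<in> singularities S \<and>
     (\<forall>t\<in>{0<..<1}. \<gamma> t \<notin> singularities S) \<and>
     (\<forall>(U, \<phi>)\<in>atlas S. \<forall>t\<in>{0<..<1}. \<gamma> t \<in> U \<longrightarrow>
        (\<exists>c. \<exists>\<epsilon>>0. \<forall>s\<in>{0<..<1}. \<bar>s - t\<bar> < \<epsilon> \<longrightarrow> \<gamma> s \<in> U \<and> \<phi> (\<gamma> s) = c + of_real s * v))"

definition development_vectors :: "'a flat_surface \<Rightarrow> complex set" where
  "development_vectors S = {v. \<exists>\<gamma>. saddle_connection S \<gamma> v}"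

definition reduced_surface :: "'a flat_surface \<Rightarrow> bool" where
  "reduced_surface S \<longleftrightarrow> group_closure (development_vectors S) = {z. Re z \<in> \<int> \<and> Im z \<in> \<int>}"


section \<open>Origamis\<close>

definition quotient_topology :: "'a topology \<Rightarrow> ('a \<times> 'a) set \<Rightarrow> 'a set topology" where
  "quotient_topology X r = topology (\<lambda>\<U>. \<U> \<subseteq> topspace X // r \<and> openin X (\<Union>\<U>))"

lemma openin_quotient_topology:
  assumes r: "equiv (topspace X) r"
  shows "openin (quotient_topology X r) \<U> \<longleftrightarrow> \<U> \<subseteq> topspace X // r \<and> openin X (\<Union>\<U>)"
proof -
  have "istopology (\<lambda>\<U>. \<U> \<subseteq> topspace X // r \<and> openin X (\<Union>\<U>))"
    unfolding istopology_def
  proof (intro conjI allI impI)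
    fix \<U> \<V>
    assume U: "\<U> \<subseteq> topspace X // r \<and> openin X (\<Union>\<U>)"
      and V: "\<V> \<subseteq> topspace X // r \<and> openin X (\<Union>\<V>)"
    have "\<Union>\<U> \<inter> \<Union>\<V> \<subseteq> \<Union>(\<U> \<inter> \<V>)"
    proof
      fix x assume "x \<in> \<Union>\<U> \<inter> \<Union>\<V>"
      then obtain A B where AB: "A \<in> \<U>" "x \<in> A" "B \<in> \<V>" "x \<in> B" by blast
      then have "A = B" using quotient_disj[OF r, of A B] U V by blast
      then show "x \<in> \<Union>(\<U> \<inter> \<V>)" using AB by blast
    qed
    then have "\<Union>(\<U> \<inter> \<V>) = \<Union>\<U> \<inter> \<Union>\<V>" by blast
    then show "openin X (\<Union>(\<U> \<inter> \<V>))" using U V by auto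
    show "\<U> \<inter> \<V> \<subseteq> topspace X // r" using U by blast
  next
    fix \<K>
    assume K: "\<forall>K\<in>\<K>. K \<subseteq> topspace X // r \<and> openin X (\<Union>K)"
    then show "\<Union>\<K> \<subseteq> topspace X // r" by blast
    have "\<Union>(\<Union>\<K>) = (\<Union>K\<in>\<K>. \<Union>K)" by blast
    then show "openin X (\<Union>(\<Union>\<K>))" using K by auto
  qed
  then show ?thesis by (simp add: quotient_topology_def topology_inverse')
qed

lemma topspace_quotient_topology:
  assumes r: "equiv (topspace X) r"
  shows "topspace (quotient_topology X r) = topspace X // r"
proof -
  have "openin (quotient_topology X r) (topspace X // r)"
    by (simp add: openin_quotient_topology[OF r] Union_quotient[OF r])
  then show ?thesis
    using openin_quotient_topology[OF r] openin_subset openin_topspace by (metis subset_antisym)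
qed

lemma quotient_map_quotient_topology:
  assumes r: "equiv (topspace X) r"
  shows "quotient_map X (quotient_topology X r) (\<lambda>x. r `` {x})"
proof -
  have "{x \<in> topspace X. r `` {x} \<in> \<U>} = \<Union>\<U>" if "\<U> \<subseteq> topspace X // r" for \<U>
  proof
    show "{x \<in> topspace X. r `` {x} \<in> \<U>} \<subseteq> \<Union>\<U>"
      using equiv_class_self[OF r] by blast
    show "\<Union>\<U> \<subseteq> {x \<in> topspace X. r `` {x} \<in> \<U>}"
    proof
      fix x assume "x \<in> \<Union>\<U>"
      then obtain A where A: "A \<in> \<U>" "x \<in> A" by blast
      then obtain y where y: "y \<in> topspace X" "A = r `` {y}"
        using \<open>\<U> \<subseteq> topspace X // r\<close> by (meson quotientE subsetD)
      then have "(y, x) \<in> r" using A by simp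
      then have "r `` {x} = A" "x \<in> topspace X"
        using equiv_class_eq[OF r] equiv_type[OF r] y by blast+
      then show "x \<in> {x \<in> topspace X. r `` {x} \<in> \<U>}" using A by simp
    qed
  qed
  moreover have "(\<lambda>x. r `` {x}) ` topspace X = topspace X // r"
    by (auto simp: quotient_def)
  ultimately show ?thesis
    by (auto simp: quotient_map_def topspace_quotient_topology[OF r] openin_quotient_topology[OF r])
qed

text \<open>Squares are numbered \<open>0, \<dots>, squares Q - 1\<close>. The right edge of square \<open>i\<close> is glued to the
  left edge of square \<open>right Q i\<close>, its upper edge to the lower edge of square \<open>up Q i\<close>.\<close>

record origami_data =
  squares :: nat
  right :: "nat \<Rightarrow> nat"
  up :: "nat \<Rightarrow> nat"

definition unit_square :: "complex set" where
  "unit_square = {z. 0 \<le> Re z \<and> Re z \<le> 1 \<and> 0 \<le> Im z \<and> Im z \<le> 1}"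

definition square_union :: "origami_data \<Rightarrow> (nat \<times> complex) topology" where
  "square_union Q = prod_topology (discrete_topology {..<squares Q}) (top_of_set unit_square)"

definition edge_pairs :: "origami_data \<Rightarrow> ((nat \<times> complex) \<times> (nat \<times> complex)) set" where
  "edge_pairs Q =
     {((i, Complex 1 y), (right Q i, Complex 0 y)) | i y. i < squares Q \<and> 0 \<le> y \<and> y \<le> 1} \<union>
     {((i, Complex x 1), (up Q i, Complex x 0)) | i x. i < squares Q \<and> 0 \<le> x \<and> x \<le> 1}"

definition gluing :: "origami_data \<Rightarrow> ((nat \<times> complex) \<times> (nat \<times> complex)) set" where
  "gluing Q = (edge_pairs Q \<union> (edge_pairs Q)\<inverse>)\<^sup>* \<inter> (topspace (square_union Q) \<times> topspace (square_union Q))"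

lemma equiv_gluing: "equiv (topspace (square_union Q)) (gluing Q)"
proof -
  let ?R = "edge_pairs Q \<union> (edge_pairs Q)\<inverse>"
  have "sym (?R\<^sup>*)" by (intro sym_rtrancl) (auto simp: sym_def)
  then show ?thesis
    unfolding equiv_def gluing_def refl_on_def sym_def trans_def
    by (auto intro: rtrancl_trans)
qed

definition glued_surface :: "origami_data \<Rightarrow> (nat \<times> complex) set topology" where
  "glued_surface Q = quotient_topology (square_union Q) (gluing Q)"

definition glued_point :: "origami_data \<Rightarrow> nat \<Rightarrow> complex \<Rightarrow> (nat \<times> complex) set" where
  "glued_point Q i z = gluing Q `` {(i, z)}"

definition origami :: "origami_data \<Rightarrow> bool" where
  "origami Q \<longleftrightarrow> squares Q > 0 \<and> right Q permutes {..<squares Q} \<and> up Q permutes {..<squares Q} \<and>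
     connected_space (glued_surface Q)"

definition vertices :: "origami_data \<Rightarrow> (nat \<times> complex) set set" where
  "vertices Q = {glued_point Q i z | i z. i < squares Q \<and> z \<in> {0, 1, \<i>, 1 + \<i>}}"

text \<open>A vertex is the set of the corners of squares which are glued together, and each corner
  contributes an angle of \<open>\<pi>/2\<close>.\<close>

definition vertex_angle :: "(nat \<times> complex) set \<Rightarrow> real" where
  "vertex_angle p = real (card p) * (pi / 2)"

definition singular_vertices :: "origami_data \<Rightarrow> (nat \<times> complex) set set" where
  "singular_vertices Q = {p \<in> vertices Q. vertex_angle p > 2 * pi}"

text \<open>The maximal atlas: the charts are the homeomorphisms between open subsets of \<open>X\<close> and of the
  plane which are locally translations on each of the closed squares.\<close>

definition origami_atlas ::
  "origami_data \<Rightarrow> ((nat \<times> complex) set set \<times> ((nat \<times> complex) set \<Rightarrow> complex)) set" where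
  "origami_atlas Q = {(U, \<phi>). openin (glued_surface Q) U \<and> U \<inter> singular_vertices Q = {} \<and>
     open (\<phi> ` U) \<and> homeomorphic_map (subtopology (glued_surface Q) U) (top_of_set (\<phi> ` U)) \<phi> \<and>
     (\<forall>i<squares Q. \<forall>z\<in>unit_square. glued_point Q i z \<in> U \<longrightarrow>
        (\<exists>c. \<exists>\<epsilon>>0. \<forall>w\<in>unit_square. dist w z < \<epsilon> \<longrightarrow> \<phi> (glued_point Q i w) = w + c))}"

definition origami_surface :: "origami_data \<Rightarrow> (nat \<times> complex) set flat_surface" where
  "origami_surface Q =
     \<lparr>completion = glued_surface Q, singularities = singular_vertices Q, atlas = origami_atlas Q\<rparr>"


section \<open>Totally non congruence groups\<close>

definition SL2Z :: "(int ^ 2 ^ 2) monoid" where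
  "SL2Z = \<lparr>carrier = {A. det A = 1}, monoid.mult = (**), one = mat 1\<rparr>"

text \<open>Residue classes modulo \<open>n\<close> are represented by \<open>0, \<dots>, n - 1\<close>.\<close>

definition SL2_mod :: "nat \<Rightarrow> (int ^ 2 ^ 2) set" where
  "SL2_mod n = {A. (\<forall>i j. A $ i $ j \<in> {0..<int n}) \<and> det A mod int n = 1 mod int n}"

definition reduce_mod :: "nat \<Rightarrow> int ^ 2 ^ 2 \<Rightarrow> int ^ 2 ^ 2" where
  "reduce_mod n A = (\<chi> i j. A $ i $ j mod int n)"

definition finite_index_subgroup :: "'g set \<Rightarrow> ('g, 'm) monoid_scheme \<Rightarrow> bool" where
  "finite_index_subgroup H G \<longleftrightarrow> subgroup H G \<and> finite (rcosets\<^bsub>G\<^esub> H)"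

definition totally_non_congruence :: "(int ^ 2 ^ 2) set \<Rightarrow> bool" where
  "totally_non_congruence \<Gamma> \<longleftrightarrow>
     finite_index_subgroup \<Gamma> SL2Z \<and> (\<forall>n\<ge>1. reduce_mod n ` \<Gamma> = SL2_mod n)"

definition real_matrix :: "int ^ 2 ^ 2 \<Rightarrow> real ^ 2 ^ 2" where
  "real_matrix A = (\<chi> i j. real_of_int (A $ i $ j))"

end

theory Submission
  imports Defs "HOL-Combinatorics.Orbits" "HOL-Number_Theory.Cong"
begin

text \<open>
  The origamis consist of a single horizontal cylinder: \<open>right\<close> is an \<open>N\<close>-cycle, and \<open>up\<close> is a product
  of disjoint 3-cycles and 5-cycles on consecutive squares. Each such block lengthens the last cycle of
  the commutator of the two permutations by \<open>2\<close>, or lengthens it by \<open>1\<close>, closes it and starts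
  a new transposition; an unused square between two blocks also closes the last cycle. Thus, since the sum of the orders of the zeroes
  is even, every stratum is reached, with \<open>N\<close> arbitrary above a bound. If \<open>C\<close> is the number of blocks,
  doubled, then \<open>right ^ N\<close>, \<open>up ^ 15\<close> and \<open>(up \<circ> right\<inverse>) ^ (N - C)\<close> are trivial. Hence the Veech group
  contains the powers with exponents \<open>N\<close>, \<open>15\<close> and \<open>N - C\<close> of three elementary parabolic matrices, and \<open>N\<close>
  can be chosen in infinitely many ways such that these exponents are pairwise coprime. Modulo any prime
  power at least two of the three exponents are invertible, and two of the three parabolic matrices
  generate \<open>SL(2, \<int>)\<close>; so the Veech group surjects onto \<open>SL(2)\<close> modulo every \<open>n\<close>.

  The Veech group is integral because all singularities lie over one point of the torus
  \<open>\<complex> / \<int>[\<i>]\<close>, so that the affine image of a saddle connection again has an integral development vector.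
\<close>

text \<open>Three pairwise coprime exponents leave at most one even, so two of
  \<open>right Q\<close>, \<open>up Q\<close> and \<open>up Q \<circ> inv (right Q)\<close> have odd
  order and all three are even permutations. Transpositions, which would already lengthen the last
  cycle of the commutator by two, are thereby excluded as blocks when their number is odd; the
  3-cycle takes their place. Zeroes of odd order come in pairs, and the 5-cycle is arranged to
  finish one of them and start the next. Both kinds of block take exactly two points out of the long
  cycle of \<open>up Q \<circ> inv (right Q)\<close>, hence the doubling in \<open>C\<close>. As
  only these two cycle lengths occur, the exponent 15 serves all strata.

  Most of the length is due to the topological notions. They are reduced to permutations by a normal
  form of glued points and by one family of charts, \<open>cone_chart\<close>, whose
  \<open>k\<close>-th power is the displacement inside the squares. The number of squares is a
  translation invariant, being the size of a generic fibre over the torus, so different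
  \<open>N\<close> give inequivalent surfaces.\<close>

unbundle no m_inv_syntax

section \<open>The gluing of the squares\<close>

text \<open>Moves a point on a right or upper edge into the half-open square. At the corner (1, 1)
  the two routes end in different squares, \<open>right Q (up Q i)\<close> and
  \<open>up Q (right Q i)\<close>; going up first is a convention, and the other route differs from
  it by \<open>commutator Q\<close>.\<close>

definition edge_shift :: "origami_data \<Rightarrow> complex \<Rightarrow> nat \<Rightarrow> nat" where
  "edge_shift Q z i = (if Re z = 1 then right Q else id) ((if Im z = 1 then up Q else id) i)"

definition torus_rep :: "complex \<Rightarrow> complex" where
  "torus_rep z = Complex (if Re z = 1 then 0 else Re z) (if Im z = 1 then 0 else Im z)"

definition commutator :: "origami_data \<Rightarrow> nat \<Rightarrow> nat" where
  "commutator Q = up Q \<circ> right Q \<circ> inv (up Q) \<circ> inv (right Q)"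

text \<open>A complete invariant of the points of the glued surface: going once around a vertex leads
  from the lower left corner of a square to the lower left corner of its image under the
  commutator.\<close>

definition normal_form :: "origami_data \<Rightarrow> nat \<Rightarrow> complex \<Rightarrow> nat set \<times> complex" where
  "normal_form Q i z =
     (if torus_rep z = 0 then orbit (commutator Q) (edge_shift Q z i) else {edge_shift Q z i}, torus_rep z)"

text \<open>Zero distances are discarded, so the gap is positive on the boundary too: a point of the
  square nearer to \<open>z\<close> than the gap lies only on those edges that contain
  \<open>z\<close>.\<close>

definition boundary_gap :: "complex \<Rightarrow> real" where
  "boundary_gap z = Min ({Re z, 1 - Re z, Im z, 1 - Im z} - {0})"

text \<open>A neighbourhood of \<open>p\<close> put together from discs in the squares around all
  representatives of \<open>p\<close>. It is open once \<open>e\<close> is at most the boundary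
  gap.\<close>

definition star :: "origami_data \<Rightarrow> (nat \<times> complex) set \<Rightarrow> real \<Rightarrow> (nat \<times> complex) set set" where
  "star Q p e = {glued_point Q i w | i z w. (i, z) \<in> p \<and> w \<in> unit_square \<and> dist w z < e}"

lemma unit_square_iff: "z \<in> unit_square \<longleftrightarrow> 0 \<le> Re z \<and> Re z \<le> 1 \<and> 0 \<le> Im z \<and> Im z \<le> 1"
  by (simp add: unit_square_def)

lemma unit_square_eq_cbox: "unit_square = cbox 0 (Complex 1 1)"
  by (auto simp: unit_square_def mem_box Basis_complex_def inner_complex_def)

lemma torus_rep_zero [simp]: "torus_rep 0 = 0"
  by (simp add: torus_rep_def complex_eq_iff)

lemma edge_shift_torus_rep [simp]: "edge_shift Q (torus_rep z) i = i"
  by (auto simp: edge_shift_def torus_rep_def)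

lemma
  assumes "z \<in> unit_square"
  shows boundary_gap_pos: "0 < boundary_gap z"
    and boundary_gap_le_one: "boundary_gap z \<le> 1"
    and boundary_gap_Re: "Re z \<noteq> 0 \<Longrightarrow> boundary_gap z \<le> Re z"
    and boundary_gap_Re': "Re z \<noteq> 1 \<Longrightarrow> boundary_gap z \<le> 1 - Re z"
    and boundary_gap_Im: "Im z \<noteq> 0 \<Longrightarrow> boundary_gap z \<le> Im z"
    and boundary_gap_Im': "Im z \<noteq> 1 \<Longrightarrow> boundary_gap z \<le> 1 - Im z"
proof -
  let ?S = "{Re z, 1 - Re z, Im z, 1 - Im z} - {0}"
  have ne: "?S \<noteq> {}" using assms by (cases "Re z = 0") (auto simp: unit_square_def)
  have "\<forall>x\<in>?S. 0 < x \<and> x \<le> 1" using assms by (auto simp: unit_square_def)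
  moreover have "Min ?S \<in> ?S" by (rule Min_in) (use ne in auto)
  ultimately show "0 < boundary_gap z" "boundary_gap z \<le> 1" unfolding boundary_gap_def by blast+
  show "Re z \<noteq> 0 \<Longrightarrow> boundary_gap z \<le> Re z" "Re z \<noteq> 1 \<Longrightarrow> boundary_gap z \<le> 1 - Re z"
    "Im z \<noteq> 0 \<Longrightarrow> boundary_gap z \<le> Im z" "Im z \<noteq> 1 \<Longrightarrow> boundary_gap z \<le> 1 - Im z"
    unfolding boundary_gap_def by (auto intro!: Min_le)
qed

text \<open>Replacing the coordinate 1 by 0 only exchanges the distances to two opposite sides. The
  gap is therefore the same for all representatives of a glued point.\<close>

lemma boundary_gap_torus_rep: "boundary_gap (torus_rep z) = boundary_gap z"
proof -
  have "{Re (torus_rep z), 1 - Re (torus_rep z), Im (torus_rep z), 1 - Im (torus_rep z)} - {0} =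
      {Re z, 1 - Re z, Im z, 1 - Im z} - {0}"
    by (auto simp: torus_rep_def)
  then show ?thesis by (simp add: boundary_gap_def)
qed

lemma near_boundary:
  assumes "z \<in> unit_square" "w \<in> unit_square" "dist w z < boundary_gap z"
  shows "Re w = 1 \<Longrightarrow> Re z = 1" "Re w = 0 \<Longrightarrow> Re z = 0" "Im w = 1 \<Longrightarrow> Im z = 1" "Im w = 0 \<Longrightarrow> Im z = 0"
proof -
  have "\<bar>Re w - Re z\<bar> < boundary_gap z" "\<bar>Im w - Im z\<bar> < boundary_gap z"
    using assms(3) abs_Re_le_cmod[of "w - z"] abs_Im_le_cmod[of "w - z"] by (auto simp: dist_norm)
  then show "Re w = 1 \<Longrightarrow> Re z = 1" "Re w = 0 \<Longrightarrow> Re z = 0" "Im w = 1 \<Longrightarrow> Im z = 1" "Im w = 0 \<Longrightarrow> Im z = 0"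
    using boundary_gap_Re[OF assms(1)] boundary_gap_Re'[OF assms(1)] boundary_gap_Im[OF assms(1)]
      boundary_gap_Im'[OF assms(1)] by linarith+
qed

lemma topspace_square_union: "topspace (square_union Q) = {..<squares Q} \<times> unit_square"
  by (simp add: square_union_def)

lemma openin_square_union_iff:
  "openin (square_union Q) S \<longleftrightarrow> S \<subseteq> {..<squares Q} \<times> unit_square \<and>
     (\<forall>i z. (i, z) \<in> S \<longrightarrow> (\<exists>e>0. \<forall>w\<in>unit_square. dist w z < e \<longrightarrow> (i, w) \<in> S))"
  (is "?l \<longleftrightarrow> ?r1 \<and> ?r2")
proof
  assume l: ?l
  then have r1: ?r1 using openin_subset[of "square_union Q" S] by (simp add: topspace_square_union)
  moreover have ?r2
  proof (intro allI impI)
    fix i z assume "(i, z) \<in> S"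
    then obtain U V where UV: "openin (top_of_set unit_square) V" "i \<in> U" "z \<in> V" "U \<times> V \<subseteq> S"
      using l[unfolded square_union_def openin_prod_topology_alt, rule_format, of i z] by auto
    then obtain e where "e > 0" "\<forall>w\<in>unit_square. dist w z < e \<longrightarrow> w \<in> V"
      unfolding openin_euclidean_subtopology_iff by metis
    with UV show "\<exists>e>0. \<forall>w\<in>unit_square. dist w z < e \<longrightarrow> (i, w) \<in> S" by blast
  qed
  ultimately show "?r1 \<and> ?r2" by blast
next
  assume r: "?r1 \<and> ?r2"
  show ?l unfolding square_union_def openin_prod_topology_alt
  proof (intro allI impI)
    fix i z assume iz: "(i, z) \<in> S"
    then obtain e where e: "e > 0" "\<forall>w\<in>unit_square. dist w z < e \<longrightarrow> (i, w) \<in> S" using r by blast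
    have "openin (top_of_set unit_square) (unit_square \<inter> ball z e)" by (simp add: openin_open_Int)
    moreover have "{i} \<times> (unit_square \<inter> ball z e) \<subseteq> S" using e by (auto simp: dist_commute)
    moreover have "openin (discrete_topology {..<squares Q}) {i}" using iz r by auto
    moreover have "z \<in> unit_square \<inter> ball z e" using iz r e by auto
    ultimately show "\<exists>U V. openin (discrete_topology {..<squares Q}) U \<and>
      openin (top_of_set unit_square) V \<and> i \<in> U \<and> z \<in> V \<and> U \<times> V \<subseteq> S" by blast
  qed
qed

section \<open>Equality of glued points and the commutator\<close>

locale square_gluing =
  fixes Q :: origami_data
  assumes right_permutes: "right Q permutes {..<squares Q}"
    and up_permutes: "up Q permutes {..<squares Q}"
begin

lemma right_less [simp]: "right Q i < squares Q \<longleftrightarrow> i < squares Q"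
  using permutes_in_image[OF right_permutes, of i] by simp

lemma up_less [simp]: "up Q i < squares Q \<longleftrightarrow> i < squares Q"
  using permutes_in_image[OF up_permutes, of i] by simp

lemma inv_right_less [simp]: "inv (right Q) i < squares Q \<longleftrightarrow> i < squares Q"
  using permutes_in_image[OF permutes_inv[OF right_permutes], of i] by simp

lemma inv_up_less [simp]: "inv (up Q) i < squares Q \<longleftrightarrow> i < squares Q"
  using permutes_in_image[OF permutes_inv[OF up_permutes], of i] by simp

lemma inverses [simp]:
  "right Q (inv (right Q) i) = i" "inv (right Q) (right Q i) = i"
  "up Q (inv (up Q) i) = i" "inv (up Q) (up Q i) = i"
  using permutes_inverses[OF right_permutes] permutes_inverses[OF up_permutes] by auto

lemma commutator_permutes: "commutator Q permutes {..<squares Q}"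
  unfolding commutator_def
  by (intro permutes_compose permutes_inv right_permutes up_permutes)

lemma commutator_less [simp]: "commutator Q i < squares Q \<longleftrightarrow> i < squares Q"
  using permutes_in_image[OF commutator_permutes, of i] by simp

lemma permutation_commutator: "permutation (commutator Q)"
  using commutator_permutes permutation_permutes by blast

lemma commutator_right_up: "commutator Q (right Q (up Q i)) = up Q (right Q i)"
  by (simp add: commutator_def)

lemma edge_shift_less [simp]: "edge_shift Q z i < squares Q \<longleftrightarrow> i < squares Q"
  by (simp add: edge_shift_def)

lemma inj_edge_shift: "inj (edge_shift Q z)"
  by (auto simp: edge_shift_def[abs_def] inj_def dest: injD[OF permutes_inj[OF right_permutes]]
    injD[OF permutes_inj[OF up_permutes]])

lemma mem_glued_point_iff:
  assumes "j < squares Q" "w \<in> unit_square"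
  shows "(i, z) \<in> glued_point Q j w \<longleftrightarrow>
    i < squares Q \<and> z \<in> unit_square \<and> glued_point Q i z = glued_point Q j w"
proof -
  have "(i, z) \<in> glued_point Q j w \<longleftrightarrow> ((j, w), (i, z)) \<in> gluing Q"
    by (simp add: glued_point_def)
  also have "\<dots> \<longleftrightarrow> i < squares Q \<and> z \<in> unit_square \<and> ((j, w), (i, z)) \<in> gluing Q"
    by (auto simp: gluing_def topspace_square_union)
  also have "\<dots> \<longleftrightarrow> i < squares Q \<and> z \<in> unit_square \<and> glued_point Q j w = glued_point Q i z"
    unfolding glued_point_def
    using eq_equiv_class_iff[OF equiv_gluing, of "(j, w)" Q "(i, z)"] assms
    by (auto simp: topspace_square_union)
  finally show ?thesis by auto
qed

lemma self_mem_glued_point: "i < squares Q \<Longrightarrow> z \<in> unit_square \<Longrightarrow> (i, z) \<in> glued_point Q i z"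
  by (simp add: mem_glued_point_iff)

lemma glued_point_eqI:
  assumes "((i, z), (j, w)) \<in> edge_pairs Q" "i < squares Q" "z \<in> unit_square" "w \<in> unit_square" "j < squares Q"
  shows "glued_point Q i z = glued_point Q j w"
proof -
  have "((i, z), (j, w)) \<in> gluing Q" using assms by (auto simp: gluing_def topspace_square_union)
  then show ?thesis unfolding glued_point_def by (rule equiv_class_eq[OF equiv_gluing])
qed

lemma glued_point_right:
  assumes "i < squares Q" "z \<in> unit_square" "Re z = 1"
  shows "glued_point Q i z = glued_point Q (right Q i) (Complex 0 (Im z))"
proof (rule glued_point_eqI)
  have "z = Complex 1 (Im z)" using assms by (simp add: complex_eq_iff)
  then show "((i, z), right Q i, Complex 0 (Im z)) \<in> edge_pairs Q"
    using assms unfolding edge_pairs_def unit_square_iff by blast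
qed (use assms in \<open>auto simp: unit_square_iff\<close>)

lemma glued_point_up:
  assumes "i < squares Q" "z \<in> unit_square" "Im z = 1"
  shows "glued_point Q i z = glued_point Q (up Q i) (Complex (Re z) 0)"
proof (rule glued_point_eqI)
  have "z = Complex (Re z) 1" using assms by (simp add: complex_eq_iff)
  then show "((i, z), up Q i, Complex (Re z) 0) \<in> edge_pairs Q"
    using assms unfolding edge_pairs_def unit_square_iff by blast
qed (use assms in \<open>auto simp: unit_square_iff\<close>)

lemma glued_point_edge_shift:
  assumes "i < squares Q" "z \<in> unit_square"
  shows "glued_point Q i z = glued_point Q (edge_shift Q z i) (torus_rep z)"
proof (cases "Im z = 1")
  case True
  then have 1: "glued_point Q i z = glued_point Q (up Q i) (Complex (Re z) 0)"
    using glued_point_up assms by simp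
  show ?thesis
  proof (cases "Re z = 1")
    case R: True
    have "glued_point Q (up Q i) (Complex (Re z) 0) = glued_point Q (right Q (up Q i)) (Complex 0 0)"
      using glued_point_right[of "up Q i" "Complex (Re z) 0"] assms R by (simp add: unit_square_iff)
    then show ?thesis using 1 True R by (simp add: edge_shift_def torus_rep_def)
  qed (use 1 True in \<open>simp add: edge_shift_def torus_rep_def\<close>)
next
  case False
  show ?thesis
  proof (cases "Re z = 1")
    case True
    then show ?thesis using glued_point_right[OF assms] False by (simp add: edge_shift_def torus_rep_def)
  qed (use False in \<open>simp add: edge_shift_def torus_rep_def\<close>)
qed

lemma glued_point_commutator:
  assumes i: "i < squares Q"
  shows "glued_point Q (commutator Q i) 0 = glued_point Q i 0"
proof -
  \<comment> \<open>The square whose upper right corner is the vertex. From it, going up and then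
    right leads to \<open>i\<close>, going right and then up leads to
    \<open>commutator Q i\<close>.\<close>
  let ?m = "inv (up Q) (inv (right Q) i)"
  have m: "?m < squares Q" using i by simp
  have c: "Complex 1 1 \<in> unit_square" "Complex 0 1 \<in> unit_square" by (auto simp: unit_square_iff)
  have "glued_point Q ?m (Complex 1 1) = glued_point Q i 0"
    using glued_point_edge_shift[OF m c(1)]
    by (simp add: edge_shift_def torus_rep_def zero_complex.code)
  moreover have "glued_point Q ?m (Complex 1 1) = glued_point Q (right Q ?m) (Complex 0 1)"
    using glued_point_right[OF m c(1)] by simp
  moreover have "\<dots> = glued_point Q (commutator Q i) 0"
    using glued_point_up[of "right Q ?m" "Complex 0 1"] m c
    by (simp add: commutator_def zero_complex.code)
  ultimately show ?thesis by simp
qed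

lemma glued_point_orbit:
  assumes "j \<in> orbit (commutator Q) i" "i < squares Q"
  shows "j < squares Q \<and> glued_point Q j 0 = glued_point Q i 0"
  using assms by (induction rule: orbit.induct) (auto simp: glued_point_commutator)

lemma orbit_eq_iff:
  "orbit (commutator Q) i = orbit (commutator Q) j \<longleftrightarrow> i \<in> orbit (commutator Q) j"
  by (metis permutation_commutator permutation_self_in_orbit cyclic_on_orbit' orbit_cyclic_eq3)

lemma normal_form_edge:
  assumes "((i, z), (j, w)) \<in> edge_pairs Q"
  shows "normal_form Q i z = normal_form Q j w"
proof -
  \<comment> \<open>Needed at the upper end of a glued right edge: there the corner (1, 1) of
    \<open>i\<close> is shifted to \<open>right Q (up Q i)\<close>, the corner (0, 1) of
    \<open>right Q i\<close> to \<open>up Q (right Q i)\<close>.\<close>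
  have *: "orbit (commutator Q) (right Q (up Q i)) = orbit (commutator Q) (up Q (right Q i))" for i
    by (metis commutator_right_up permutation_orbit_step[OF permutation_commutator])
  show ?thesis
    using assms unfolding edge_pairs_def
    by (auto simp: normal_form_def edge_shift_def torus_rep_def complex_eq_iff * split: if_splits)
qed

text \<open>The normal form is preserved by each edge pair, hence along the closure that defines the
  gluing. Conversely every point is glued to its representative in the half-open square, and squares
  in one commutator orbit have their lower left corners glued by walking around the vertex.\<close>

theorem glued_point_eq_iff:
  assumes "i < squares Q" "z \<in> unit_square" "j < squares Q" "w \<in> unit_square"
  shows "glued_point Q i z = glued_point Q j w \<longleftrightarrow> normal_form Q i z = normal_form Q j w"
proof
  assume "glued_point Q i z = glued_point Q j w"
  then have "(j, w) \<in> glued_point Q i z" using assms by (simp add: mem_glued_point_iff)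
  then have "((i, z), (j, w)) \<in> (edge_pairs Q \<union> (edge_pairs Q)\<inverse>)\<^sup>*"
    by (simp add: glued_point_def gluing_def)
  then have "case_prod (normal_form Q) (i, z) = case_prod (normal_form Q) (j, w)"
  proof (induction rule: rtrancl_induct)
    case (step a b)
    then have "case_prod (normal_form Q) a = case_prod (normal_form Q) b"
      using normal_form_edge[of "fst a" "snd a" "fst b" "snd b"]
        normal_form_edge[of "fst b" "snd b" "fst a" "snd a"] by (auto simp: case_prod_unfold)
    with step.IH show ?case by simp
  qed simp
  then show "normal_form Q i z = normal_form Q j w" by simp
next
  assume nf: "normal_form Q i z = normal_form Q j w"
  then have t: "torus_rep z = torus_rep w" by (simp add: normal_form_def)
  have "glued_point Q (edge_shift Q z i) (torus_rep z) = glued_point Q (edge_shift Q w j) (torus_rep w)"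
  proof (cases "torus_rep z = 0")
    case True
    then have "orbit (commutator Q) (edge_shift Q z i) = orbit (commutator Q) (edge_shift Q w j)"
      using nf t by (simp add: normal_form_def)
    then have "edge_shift Q z i \<in> orbit (commutator Q) (edge_shift Q w j)"
      by (simp only: orbit_eq_iff)
    then show ?thesis using glued_point_orbit assms True t by simp
  next
    case False
    then show ?thesis using nf t by (simp add: normal_form_def)
  qed
  then show "glued_point Q i z = glued_point Q j w"
    using glued_point_edge_shift assms by simp
qed

text \<open>All representatives lie over one point of the torus, and each of their coordinates is
  either that of \<open>torus_rep z\<close> or 1.\<close>

lemma finite_glued_point:
  assumes "i < squares Q" "z \<in> unit_square"
  shows "finite (glued_point Q i z)"
proof -
  let ?t = "torus_rep z"
  have "w \<in> {Complex a b | a b. a \<in> {Re ?t, 1} \<and> b \<in> {Im ?t, 1}}" if "torus_rep w = ?t" for w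
  proof -
    have "Re w \<in> {Re ?t, 1}" "Im w \<in> {Im ?t, 1}" using that[symmetric] by (auto simp: torus_rep_def)
    then show ?thesis by (metis (mono_tags, lifting) complex.collapse mem_Collect_eq)
  qed
  then have "glued_point Q i z \<subseteq> {..<squares Q} \<times> {Complex a b | a b. a \<in> {Re ?t, 1} \<and> b \<in> {Im ?t, 1}}"
    using assms by (force simp: mem_glued_point_iff glued_point_eq_iff normal_form_def)
  moreover have "finite {Complex a b | a b. a \<in> {Re ?t, 1} \<and> b \<in> {Im ?t, 1}}"
    by (rule finite_image_set2) auto
  ultimately show ?thesis using finite_subset by blast
qed

lemma torus_rep_eq_if_glued:
  assumes "i < squares Q" "z \<in> unit_square" "(j, w) \<in> glued_point Q i z"
  shows "torus_rep w = torus_rep z"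
  using assms by (auto simp: mem_glued_point_iff glued_point_eq_iff normal_form_def)

lemma boundary_gap_eq_if_glued:
  assumes "i < squares Q" "z \<in> unit_square" "(j, w) \<in> glued_point Q i z"
  shows "boundary_gap w = boundary_gap z"
  using torus_rep_eq_if_glued[OF assms] boundary_gap_torus_rep by metis

section \<open>Topology of the glued surface\<close>

lemma topspace_glued_surface:
  "topspace (glued_surface Q) = {glued_point Q i z | i z. i < squares Q \<and> z \<in> unit_square}"
  unfolding glued_surface_def topspace_quotient_topology[OF equiv_gluing]
  by (auto simp: quotient_def topspace_square_union glued_point_def)

lemma glued_point_in_topspace [simp]:
  "i < squares Q \<Longrightarrow> z \<in> unit_square \<Longrightarrow> glued_point Q i z \<in> topspace (glued_surface Q)"
  using topspace_glued_surface by auto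

lemma openin_glued_surface_iff:
  "openin (glued_surface Q) U \<longleftrightarrow> U \<subseteq> topspace (glued_surface Q) \<and>
    (\<forall>i<squares Q. \<forall>z\<in>unit_square. glued_point Q i z \<in> U \<longrightarrow>
      (\<exists>e>0. \<forall>w\<in>unit_square. dist w z < e \<longrightarrow> glued_point Q i w \<in> U))"
proof (cases "U \<subseteq> topspace (glued_surface Q)")
  case True
  have mem: "(i, z) \<in> \<Union>U \<longleftrightarrow> i < squares Q \<and> z \<in> unit_square \<and> glued_point Q i z \<in> U" for i z
  proof
    assume "(i, z) \<in> \<Union>U"
    then obtain j w where "j < squares Q" "w \<in> unit_square" "(i, z) \<in> glued_point Q j w" "glued_point Q j w \<in> U"
      using True unfolding topspace_glued_surface by blast
    then show "i < squares Q \<and> z \<in> unit_square \<and> glued_point Q i z \<in> U"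
      by (simp add: mem_glued_point_iff)
  qed (use self_mem_glued_point in blast)
  have "openin (glued_surface Q) U \<longleftrightarrow> openin (square_union Q) (\<Union>U)"
    using True topspace_quotient_topology[OF equiv_gluing]
    unfolding glued_surface_def openin_quotient_topology[OF equiv_gluing] by blast
  also have "\<dots> \<longleftrightarrow> (\<forall>i<squares Q. \<forall>z\<in>unit_square. glued_point Q i z \<in> U \<longrightarrow>
      (\<exists>e>0. \<forall>w\<in>unit_square. dist w z < e \<longrightarrow> glued_point Q i w \<in> U))"
    (is "_ \<longleftrightarrow> ?r")
  proof
    assume "openin (square_union Q) (\<Union>U)"
    then show ?r unfolding openin_square_union_iff mem by blast
  next
    assume r: ?r
    have "\<Union>U \<subseteq> {..<squares Q} \<times> unit_square" using mem by (auto simp del: Union_iff)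
    then show "openin (square_union Q) (\<Union>U)"
      using r unfolding openin_square_union_iff mem by blast
  qed
  finally show ?thesis using True by simp
qed (use openin_subset in blast)

lemma continuous_map_glued_point:
  assumes "i < squares Q"
  shows "continuous_map (top_of_set unit_square) (glued_surface Q) (glued_point Q i)"
  unfolding continuous_map_def
proof (intro conjI allI impI)
  show "glued_point Q i \<in> topspace (top_of_set unit_square) \<rightarrow> topspace (glued_surface Q)"
    using assms by auto
  fix U assume "openin (glued_surface Q) U"
  then show "openin (top_of_set unit_square) {x \<in> topspace (top_of_set unit_square). glued_point Q i x \<in> U}"
    using assms unfolding openin_glued_surface_iff openin_euclidean_subtopology_iff by fastforce
qed

text \<open>Below the boundary gap, \<open>w\<close> can lie on an edge only if \<open>z\<close>
  does. Crossing that edge then moves \<open>w\<close> and \<open>z\<close> by the same translation,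
  and their distance is kept.\<close>

lemma star_edge_saturated:
  assumes p: "i0 < squares Q" "z0 \<in> unit_square" and e: "e \<le> boundary_gap z0"
    and st: "(i, z) \<in> glued_point Q i0 z0" "dist w z < e"
    and ed: "((i, w), (j, v)) \<in> edge_pairs Q \<union> (edge_pairs Q)\<inverse>"
  shows "\<exists>y. (j, y) \<in> glued_point Q i0 z0 \<and> dist v y < e"
proof -
  have iz: "i < squares Q" "z \<in> unit_square" "glued_point Q i z = glued_point Q i0 z0"
    using st p by (simp_all add: mem_glued_point_iff)
  have e': "dist w z < boundary_gap z" using boundary_gap_eq_if_glued[OF p st(1)] e st by simp
  have w: "w \<in> unit_square" using ed by (auto simp: edge_pairs_def unit_square_iff)
  note nb = near_boundary[OF iz(2) w e']
  have step: "\<exists>y. (j, y) \<in> glued_point Q i0 z0 \<and> dist v y < e"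
    if y: "j < squares Q" "y \<in> unit_square" "glued_point Q j y = glued_point Q i z" "v - y = w - z" for y
    using y iz p st(2) by (intro exI[of _ y]) (simp add: mem_glued_point_iff dist_norm)
  consider (r) "Re w = 1" "j = right Q i" "v = Complex 0 (Im w)"
    | (u) "Im w = 1" "j = up Q i" "v = Complex (Re w) 0"
    | (l) "Re w = 0" "i = right Q j" "j < squares Q" "v = Complex 1 (Im w)"
    | (d) "Im w = 0" "i = up Q j" "j < squares Q" "v = Complex (Re w) 1"
    using ed by (auto simp: edge_pairs_def complex_eq_iff)
  then show ?thesis
  proof cases
    case r
    then show ?thesis using step[of "Complex 0 (Im z)"] nb glued_point_right[of i z] iz
      by (auto simp: unit_square_iff complex_eq_iff)
  next
    case u
    then show ?thesis using step[of "Complex (Re z) 0"] nb glued_point_up[of i z] iz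
      by (auto simp: unit_square_iff complex_eq_iff)
  next
    case l
    then have z: "Complex 0 (Im z) = z" and "v - Complex 1 (Im z) = w - z"
      using nb by (simp_all add: complex_eq_iff)
    then show ?thesis using step[of "Complex 1 (Im z)"] l(2,3) glued_point_right[of j "Complex 1 (Im z)"] iz
      by (simp add: unit_square_iff)
  next
    case d
    then have z: "Complex (Re z) 0 = z" and "v - Complex (Re z) 1 = w - z"
      using nb by (simp_all add: complex_eq_iff)
    then show ?thesis using step[of "Complex (Re z) 1"] d(2,3) glued_point_up[of j "Complex (Re z) 1"] iz
      by (simp add: unit_square_iff)
  qed
qed

text \<open>Edge crossings preserve closeness to some representative of the centre, so this passes
  along the whole gluing relation. Without the bound on \<open>e\<close> a point could be close to
  the centre in one square and not in the adjacent one.\<close>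

lemma glued_point_in_star_iff:
  assumes p: "i0 < squares Q" "z0 \<in> unit_square" and e: "e \<le> boundary_gap z0"
    and i: "i < squares Q" "w \<in> unit_square"
  shows "glued_point Q i w \<in> star Q (glued_point Q i0 z0) e \<longleftrightarrow>
    (\<exists>z. (i, z) \<in> glued_point Q i0 z0 \<and> dist w z < e)"
proof
  assume "glued_point Q i w \<in> star Q (glued_point Q i0 z0) e"
  then obtain j y v where j: "glued_point Q j v = glued_point Q i w" "(j, y) \<in> glued_point Q i0 z0"
    "v \<in> unit_square" "dist v y < e"
    unfolding star_def by force
  then have "(i, w) \<in> glued_point Q j v" using i p by (simp add: mem_glued_point_iff)
  then have "((j, v), (i, w)) \<in> (edge_pairs Q \<union> (edge_pairs Q)\<inverse>)\<^sup>*"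
    by (simp add: glued_point_def gluing_def)
  then have "\<exists>z. (fst (i, w), z) \<in> glued_point Q i0 z0 \<and> dist (snd (i, w)) z < e"
  proof (induction rule: rtrancl_induct)
    case base
    then show ?case using j by auto
  next
    case (step a b)
    then show ?case using star_edge_saturated[OF p e, of "fst a" _ "snd a" "fst b" "snd b"] by auto
  qed
  then show "\<exists>z. (i, z) \<in> glued_point Q i0 z0 \<and> dist w z < e" by simp
qed (use i in \<open>auto simp: star_def\<close>)

lemma star_subset_topspace:
  assumes p: "i0 < squares Q" "z0 \<in> unit_square"
  shows "star Q (glued_point Q i0 z0) e \<subseteq> topspace (glued_surface Q)"
  using p unfolding star_def by (auto simp: mem_glued_point_iff)

lemma openin_star:
  assumes p: "i0 < squares Q" "z0 \<in> unit_square" and e: "e \<le> boundary_gap z0"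
  shows "openin (glued_surface Q) (star Q (glued_point Q i0 z0) e)"
  unfolding openin_glued_surface_iff
proof (intro conjI allI impI ballI star_subset_topspace p)
  fix i z assume i: "i < squares Q" "z \<in> unit_square" and "glued_point Q i z \<in> star Q (glued_point Q i0 z0) e"
  then obtain y where y: "(i, y) \<in> glued_point Q i0 z0" "dist z y < e"
    using glued_point_in_star_iff[OF p e] by blast
  show "\<exists>d>0. \<forall>w\<in>unit_square. dist w z < d \<longrightarrow> glued_point Q i w \<in> star Q (glued_point Q i0 z0) e"
  proof (intro exI[of _ "e - dist z y"] conjI ballI impI)
    fix w assume w: "w \<in> unit_square" "dist w z < e - dist z y"
    then have "dist w y < e" using dist_triangle[of w y z] by simp
    then show "glued_point Q i w \<in> star Q (glued_point Q i0 z0) e"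
      using glued_point_in_star_iff[OF p e i(1) w(1)] y by blast
  qed (use y in simp)
qed

lemma center_in_star:
  assumes "i < squares Q" "z \<in> unit_square" "e > 0"
  shows "glued_point Q i z \<in> star Q (glued_point Q i z) e"
  using assms self_mem_glued_point by (force simp: star_def)

lemma Hausdorff_glued_surface: "Hausdorff_space (glued_surface Q)"
  unfolding Hausdorff_space_def
proof (intro allI impI)
  fix p q assume "p \<in> topspace (glued_surface Q) \<and> q \<in> topspace (glued_surface Q) \<and> p \<noteq> q"
  then obtain i z j w where i: "i < squares Q" "z \<in> unit_square" and j: "j < squares Q" "w \<in> unit_square"
    and pq: "p = glued_point Q i z" "q = glued_point Q j w" "p \<noteq> q"
    unfolding topspace_glued_surface by blast
  have disj: "p \<inter> q = {}" using pq i j by (auto simp: mem_glued_point_iff)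
  \<comment> \<open>The finitely many distances between representatives of \<open>p\<close> and of
    \<open>q\<close> in a common square. They are positive since the two classes are disjoint, and
    half of their minimum separates the stars; the added 1 covers the case of no common
    square.\<close>
  define D where "D = (\<lambda>((_, y), (_, y')). dist y y') ` {(a, b) \<in> p \<times> q. fst a = fst b}"
  have "finite D" unfolding D_def
    by (rule finite_imageI, rule finite_subset[of _ "p \<times> q"]) (use finite_glued_point i j pq in auto)
  moreover have "\<forall>d\<in>D. d > 0" unfolding D_def using disj by auto
  ultimately have m: "Min (insert 1 D) > 0" "\<forall>d\<in>D. Min (insert 1 D) \<le> d" by simp_all
  define e where "e = min (Min (insert 1 D) / 2) (min (boundary_gap z) (boundary_gap w))"
  have e: "e > 0" "e \<le> boundary_gap z" "e \<le> boundary_gap w" "2 * e \<le> Min (insert 1 D)"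
    using m boundary_gap_pos i j by (auto simp: e_def)
  have "disjnt (star Q p e) (star Q q e)"
  proof (rule ccontr)
    assume "\<not> ?thesis"
    then obtain x where x: "x \<in> star Q p e" "x \<in> star Q q e" by (auto simp: disjnt_def)
    then obtain k v where k: "k < squares Q" "v \<in> unit_square" "x = glued_point Q k v"
      using star_subset_topspace[OF i] pq unfolding topspace_glued_surface by blast
    then obtain y y' where y: "(k, y) \<in> p" "dist v y < e" "(k, y') \<in> q" "dist v y' < e"
      using x glued_point_in_star_iff[OF i e(2)] glued_point_in_star_iff[OF j e(3)] pq by blast
    then have "dist y y' \<in> D" unfolding D_def by force
    then have "2 * e \<le> dist y y'" using m e by force
    then show False using y dist_triangle3[of y y' v] by (simp add: dist_commute)
  qed
  then show "\<exists>U V. openin (glued_surface Q) U \<and> openin (glued_surface Q) V \<and> p \<in> U \<and> q \<in> V \<and> disjnt U V"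
    using openin_star[OF i e(2)] openin_star[OF j e(3)] center_in_star e(1) i j pq by blast
qed

lemma compact_glued_surface: "compact_space (glued_surface Q)"
proof -
  have "compact_space (square_union Q)"
    unfolding square_union_def
    by (simp add: compact_space_prod_topology compact_space_discrete_topology compact_space_subtopology
        unit_square_eq_cbox)
  moreover have "quotient_map (square_union Q) (glued_surface Q) (\<lambda>x. gluing Q `` {x})"
    unfolding glued_surface_def by (rule quotient_map_quotient_topology[OF equiv_gluing])
  ultimately show ?thesis
    by (metis compact_space_def image_compactin quotient_imp_continuous_map quotient_imp_surjective_map)
qed

end

section \<open>Vertices\<close>

context square_gluing
begin

lemma edge_shift_permutes: "edge_shift Q z permutes {..<squares Q}"
proof -
  have "edge_shift Q z = (if Re z = 1 then right Q else id) \<circ> (if Im z = 1 then up Q else id)"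
    by (auto simp: edge_shift_def fun_eq_iff)
  then show ?thesis
    by (auto intro!: permutes_compose right_permutes up_permutes permutes_id simp del: id_apply)
qed

lemma commutator_orbit_subset: "i < squares Q \<Longrightarrow> orbit (commutator Q) i \<subseteq> {..<squares Q}"
  using permutes_orbit_subset[OF commutator_permutes] by blast

lemma glued_corner:
  assumes "i < squares Q" "torus_rep z = 0" "z \<in> unit_square"
  shows "glued_point Q i z = glued_point Q (edge_shift Q z i) 0"
  using glued_point_edge_shift[OF assms(1,3)] assms by simp

lemma torus_rep_eq_0_iff: "torus_rep z = 0 \<longleftrightarrow> z \<in> {0, 1, \<i>, 1 + \<i>}"
  by (auto simp: torus_rep_def complex_eq_iff)

lemma vertices_eq: "vertices Q = {glued_point Q i 0 | i. i < squares Q}"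
proof -
  have "z \<in> unit_square" if "z \<in> {0, 1, \<i>, 1 + \<i>}" for z
    using that by (auto simp: unit_square_iff)
  then show ?thesis
    unfolding vertices_def torus_rep_eq_0_iff[symmetric]
    by (auto, metis glued_corner edge_shift_less torus_rep_eq_0_iff, metis torus_rep_zero)
qed

lemma glued_vertex_eq_iff:
  assumes "i < squares Q" "j < squares Q"
  shows "glued_point Q i 0 = glued_point Q j 0 \<longleftrightarrow> i \<in> orbit (commutator Q) j"
proof -
  have "edge_shift Q 0 k = k" for k by (simp add: edge_shift_def)
  then show ?thesis
    using glued_point_eq_iff[OF assms(1) _ assms(2), of 0 0]
    by (simp add: normal_form_def unit_square_iff orbit_eq_iff)
qed

lemma mem_glued_vertex_iff:
  assumes "i < squares Q"
  shows "(j, z) \<in> glued_point Q i 0 \<longleftrightarrow>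
    z \<in> {0, 1, \<i>, 1 + \<i>} \<and> edge_shift Q z j \<in> orbit (commutator Q) i"
proof -
  have z: "z \<in> unit_square" if "torus_rep z = 0"
    using that unfolding torus_rep_eq_0_iff by (auto simp: unit_square_iff)
  have 0: "edge_shift Q 0 k = k" for k by (simp add: edge_shift_def)
  have "(j, z) \<in> glued_point Q i 0 \<longleftrightarrow> j < squares Q \<and> z \<in> unit_square \<and> normal_form Q j z = normal_form Q i 0"
    using assms by (auto simp: mem_glued_point_iff unit_square_iff glued_point_eq_iff)
  also have "\<dots> \<longleftrightarrow> j < squares Q \<and> torus_rep z = 0 \<and> edge_shift Q z j \<in> orbit (commutator Q) i"
    using z by (auto simp: normal_form_def 0 orbit_eq_iff[symmetric])
  also have "\<dots> \<longleftrightarrow> torus_rep z = 0 \<and> edge_shift Q z j \<in> orbit (commutator Q) i"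
    using commutator_orbit_subset[OF assms] by auto
  finally show ?thesis by (simp only: torus_rep_eq_0_iff)
qed

text \<open>At a fixed corner \<open>z\<close> the map \<open>edge_shift Q z\<close> is a bijection
  of the squares, so each of the four kinds of corner contributes one copy of the orbit. With a
  right angle at each corner, an orbit of length \<open>k\<close> has cone angle
  \<open>2 * pi * k\<close>.\<close>

lemma card_glued_vertex:
  assumes "i < squares Q"
  shows "card (glued_point Q i 0) = 4 * card (orbit (commutator Q) i)"
proof -
  let ?C = "{0, 1, \<i>, 1 + \<i>} :: complex set" and ?O = "orbit (commutator Q) i"
  let ?f = "\<lambda>(j, z). (edge_shift Q z j, z)"
  have "inj ?f" using inj_edge_shift by (auto simp: inj_def)
  moreover have "?f ` glued_point Q i 0 = ?O \<times> ?C"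
  proof -
    have "(k, z) \<in> ?f ` glued_point Q i 0" if "k \<in> ?O" "z \<in> ?C" for k z
    proof -
      obtain j where "k = edge_shift Q z j" using permutes_surj[OF edge_shift_permutes] by (metis surjD)
      then show ?thesis using that mem_glued_vertex_iff[OF assms, of j z] by force
    qed
    moreover have "?f x \<in> ?O \<times> ?C" if "x \<in> glued_point Q i 0" for x
      using that mem_glued_vertex_iff[OF assms, of "fst x" "snd x"] by (auto simp: case_prod_unfold)
    ultimately show ?thesis by (auto simp del: insert_iff)
  qed
  moreover have "card ?C = 4" by (simp add: complex_eq_iff)
  ultimately have "card (?O \<times> ?C) = card (glued_point Q i 0)"
    using card_image[OF inj_on_subset[OF _ subset_UNIV], of ?f "glued_point Q i 0"] by presburger
  then show ?thesis using \<open>card ?C = 4\<close> by (simp only: card_cartesian_product)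
qed

lemma card_orbit_gt_1_iff: "card (orbit (commutator Q) i) > 1 \<longleftrightarrow> commutator Q i \<noteq> i"
proof -
  have fin: "finite (orbit (commutator Q) i)"
    by (rule finite_orbit) (rule permutation_self_in_orbit[OF permutation_commutator])
  show ?thesis
  proof
    assume "card (orbit (commutator Q) i) > 1"
    then show "commutator Q i \<noteq> i" by (metis card.empty card_insert_disjoint finite.emptyI empty_iff less_irrefl
          orbit_eq_singleton_iff One_nat_def)
  next
    assume "commutator Q i \<noteq> i"
    moreover have "{i, commutator Q i} \<subseteq> orbit (commutator Q) i"
      using permutation_self_in_orbit[OF permutation_commutator] orbit.base by fastforce
    ultimately show "card (orbit (commutator Q) i) > 1"
      using card_mono[OF fin, of "{i, commutator Q i}"] by simp
  qed
qed

lemma singular_vertices_eq: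
  "singular_vertices Q = {glued_point Q i 0 | i. i < squares Q \<and> commutator Q i \<noteq> i}"
proof -
  have "vertex_angle (glued_point Q i 0) > 2 * pi \<longleftrightarrow> commutator Q i \<noteq> i" if "i < squares Q" for i
  proof -
    have "vertex_angle (glued_point Q i 0) > 2 * pi \<longleftrightarrow> card (orbit (commutator Q) i) > 1"
      by (simp add: vertex_angle_def card_glued_vertex that)
    then show ?thesis by (simp only: card_orbit_gt_1_iff)
  qed
  then show ?thesis unfolding singular_vertices_def vertices_eq by blast
qed

lemma finite_singular_vertices: "finite (singular_vertices Q)"
  unfolding singular_vertices_eq by simp

lemma singular_vertices_subset: "singular_vertices Q \<subseteq> topspace (glued_surface Q)"
  unfolding singular_vertices_eq by (auto simp: unit_square_iff)

lemma singular_glued_point: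
  assumes "i < squares Q" "z \<in> unit_square" "glued_point Q i z \<in> singular_vertices Q"
  shows "z \<in> {0, 1, \<i>, 1 + \<i>}"
proof -
  obtain j where j: "j < squares Q" "glued_point Q i z = glued_point Q j 0"
    using assms(3) unfolding singular_vertices_eq by blast
  then show ?thesis
    using mem_glued_vertex_iff[OF j(1), of i z] self_mem_glued_point[OF assms(1,2)] by simp
qed

text \<open>A singularity has a representative at the corner 0 of some square, and a point
  \<open>z\<close> with 0 within its boundary gap must be 0 itself.\<close>

lemma star_meets_singular:
  assumes p: "i0 < squares Q" "z0 \<in> unit_square" and e: "e \<le> boundary_gap z0"
  shows "star Q (glued_point Q i0 z0) e \<inter> singular_vertices Q \<subseteq> {glued_point Q i0 z0}"
proof
  fix x assume x: "x \<in> star Q (glued_point Q i0 z0) e \<inter> singular_vertices Q"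
  then obtain i where i: "i < squares Q" "x = glued_point Q i 0" unfolding singular_vertices_eq by blast
  have 0: "0 \<in> unit_square" by (simp add: unit_square_iff)
  obtain z where z: "(i, z) \<in> glued_point Q i0 z0" "dist 0 z < e"
    using glued_point_in_star_iff[OF p e i(1) 0] x i by auto
  then have "z \<in> unit_square" "boundary_gap z = boundary_gap z0"
    using p boundary_gap_eq_if_glued[OF p z(1)] by (auto simp: mem_glued_point_iff)
  with z e near_boundary[of z 0] 0 have "z = 0" by (simp add: complex_eq_iff)
  then show "x \<in> {glued_point Q i0 z0}" using z p i by (simp add: mem_glued_point_iff)
qed

text \<open>A glued point has finitely many representatives, so radii found in the single squares
  have a positive minimum. This turns statements proved square by square into statements on a
  \<open>star\<close>.\<close>

lemma uniform_radius:
  assumes p: "i0 < squares Q" "z0 \<in> unit_square"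
    and R: "\<And>i z. (i, z) \<in> glued_point Q i0 z0 \<Longrightarrow> \<exists>e>0. \<forall>w\<in>unit_square. dist w z < e \<longrightarrow> R i z w"
  shows "\<exists>e>0. e \<le> boundary_gap z0 \<and>
    (\<forall>(i, z)\<in>glued_point Q i0 z0. \<forall>w\<in>unit_square. dist w z < e \<longrightarrow> R i z w)"
proof -
  have "\<forall>a\<in>glued_point Q i0 z0. \<exists>e>0. \<forall>w\<in>unit_square. dist w (snd a) < e \<longrightarrow> R (fst a) (snd a) w"
    using R by simp
  then obtain E where E: "\<And>a. a \<in> glued_point Q i0 z0 \<Longrightarrow> E a > (0::real)"
    "\<And>a w. a \<in> glued_point Q i0 z0 \<Longrightarrow> w \<in> unit_square \<Longrightarrow> dist w (snd a) < E a \<Longrightarrow> R (fst a) (snd a) w"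
    by metis
  define e where "e = Min (insert (boundary_gap z0) (E ` glued_point Q i0 z0))"
  have fin: "finite (insert (boundary_gap z0) (E ` glued_point Q i0 z0))"
    using finite_glued_point[OF p] by simp
  have "e > 0" unfolding e_def using fin E(1) boundary_gap_pos[OF p(2)] by (subst Min_gr_iff) auto
  moreover have "e \<le> boundary_gap z0" "\<And>a. a \<in> glued_point Q i0 z0 \<Longrightarrow> e \<le> E a"
    unfolding e_def using fin by auto
  ultimately show ?thesis using E(2) by (intro exI[of _ e]) force
qed

section \<open>The regular part and its charts in terms of the squares\<close>

lemma topspace_regular_part:
  "topspace (regular_part (origami_surface Q)) = topspace (glued_surface Q) - singular_vertices Q"
  by (auto simp: regular_part_def origami_surface_def)

lemma openin_regular_part:
  assumes "openin (glued_surface Q) W" "W \<inter> singular_vertices Q = {}"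
  shows "openin (regular_part (origami_surface Q)) W"
proof -
  have "W = W \<inter> (topspace (glued_surface Q) - singular_vertices Q)"
    using assms openin_subset by blast
  then show ?thesis
    unfolding regular_part_def origami_surface_def using assms(1) by (auto simp: openin_subtopology)
qed

lemma atlas_local:
  assumes a: "(U, \<phi>) \<in> origami_atlas Q" and p: "i < squares Q" "z \<in> unit_square" "glued_point Q i z \<in> U"
  shows "\<exists>e>0. \<forall>w\<in>unit_square. dist w z < e \<longrightarrow>
    glued_point Q i w \<in> U \<and> \<phi> (glued_point Q i w) = \<phi> (glued_point Q i z) + (w - z)"
proof -
  obtain c e where e: "e > 0" "\<forall>w\<in>unit_square. dist w z < e \<longrightarrow> \<phi> (glued_point Q i w) = w + c"
  proof -
    have "\<forall>i<squares Q. \<forall>z\<in>unit_square. glued_point Q i z \<in> U \<longrightarrow>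
        (\<exists>c. \<exists>e>0. \<forall>w\<in>unit_square. dist w z < e \<longrightarrow> \<phi> (glued_point Q i w) = w + c)"
      using a by (simp add: origami_atlas_def)
    then show thesis using p that by meson
  qed
  have "openin (glued_surface Q) U" using a unfolding origami_atlas_def by blast
  then obtain d where d: "d > 0" "\<forall>w\<in>unit_square. dist w z < d \<longrightarrow> glued_point Q i w \<in> U"
    using p unfolding openin_glued_surface_iff by blast
  have "\<phi> (glued_point Q i z) = z + c" using e p by auto
  then show ?thesis using e d by (intro exI[of _ "min d e"]) auto
qed

text \<open>The constant by which a chart translates may differ from square to square. The value at
  the common centre fixes it in each of them, which gives one formula on the whole star.\<close>

lemma atlas_star:
  assumes a: "(U, \<phi>) \<in> origami_atlas Q" and p: "i0 < squares Q" "z0 \<in> unit_square" "glued_point Q i0 z0 \<in> U"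
  shows "\<exists>e>0. e \<le> boundary_gap z0 \<and> (\<forall>(i, z)\<in>glued_point Q i0 z0. \<forall>w\<in>unit_square. dist w z < e \<longrightarrow>
    glued_point Q i w \<in> U \<and> \<phi> (glued_point Q i w) = \<phi> (glued_point Q i0 z0) + (w - z))"
proof (rule uniform_radius[OF p(1,2)])
  fix i z assume "(i, z) \<in> glued_point Q i0 z0"
  then have iz: "i < squares Q" "z \<in> unit_square" "glued_point Q i z = glued_point Q i0 z0"
    using p by (simp_all add: mem_glued_point_iff)
  then show "\<exists>e>0. \<forall>w\<in>unit_square. dist w z < e \<longrightarrow>
    glued_point Q i w \<in> U \<and> \<phi> (glued_point Q i w) = \<phi> (glued_point Q i0 z0) + (w - z)"
    using atlas_local[OF a iz(1,2)] p by simp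
qed

end

section \<open>Affine maps between square-tiled surfaces\<close>

lemma linear_plane_map: "linear (plane_map A)"
  by (rule linearI) (simp_all add: plane_map_def complex_eq_iff algebra_simps)

lemma plane_map_mult: "plane_map (A ** B) z = plane_map A (plane_map B z)"
  by (simp add: plane_map_def matrix_matrix_mult_def sum_2 complex_eq_iff algebra_simps)

lemma plane_map_one [simp]: "plane_map (mat 1) z = z"
  by (simp add: plane_map_def mat_def)

lemma plane_map_add: "plane_map A (z + w) = plane_map A z + plane_map A w"
  and plane_map_diff: "plane_map A (z - w) = plane_map A z - plane_map A w"
  and plane_map_zero [simp]: "plane_map A 0 = 0"
  using linear_add[OF linear_plane_map] linear_diff[OF linear_plane_map] linear_0[OF linear_plane_map] by auto

lemma plane_map_bound: "\<exists>K>0. \<forall>z. cmod (plane_map A z) \<le> cmod z * K"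
  using bounded_linear.pos_bounded linear_plane_map linear_conv_bounded_linear by blast

text \<open>A chart-free form of affinity that makes sense at vertices as well. The target square
  \<open>j\<close> may depend on \<open>w\<close>, since the image of a small disc need not lie in
  one square; it only has to contain representatives of the two image points.\<close>

definition locally_affine ::
  "real ^ 2 ^ 2 \<Rightarrow> origami_data \<Rightarrow> origami_data \<Rightarrow> ((nat \<times> complex) set \<Rightarrow> (nat \<times> complex) set) \<Rightarrow> bool" where
  "locally_affine A P Q f \<longleftrightarrow> (\<forall>i<squares P. \<forall>z\<in>unit_square. \<exists>e>0. \<forall>w\<in>unit_square. dist w z < e \<longrightarrow>
     (\<exists>j z' w'. j < squares Q \<and> z' \<in> unit_square \<and> w' \<in> unit_square \<and>
        f (glued_point P i z) = glued_point Q j z' \<and> f (glued_point P i w) = glued_point Q j w' \<and>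
        w' - z' = plane_map A (w - z)))"

definition glued_lift :: "(nat \<Rightarrow> complex \<Rightarrow> 'b) \<Rightarrow> (nat \<times> complex) set \<Rightarrow> 'b" where
  "glued_lift F x = case_prod F (SOME a. a \<in> x)"

lemma (in square_gluing) glued_lift:
  assumes F: "\<And>i z j w. ((i, z), (j, w)) \<in> edge_pairs Q \<Longrightarrow> F i z = F j w"
    and p: "i < squares Q" "z \<in> unit_square"
  shows "glued_lift F (glued_point Q i z) = F i z"
proof -
  have "(SOME a. a \<in> glued_point Q i z) \<in> glued_point Q i z"
    using self_mem_glued_point[OF p] by (rule someI)
  then have "((i, z), SOME a. a \<in> glued_point Q i z) \<in> (edge_pairs Q \<union> (edge_pairs Q)\<inverse>)\<^sup>*"
    unfolding glued_point_def gluing_def by blast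
  then have "case_prod F (i, z) = case_prod F (SOME a. a \<in> glued_point Q i z)"
  proof (induction rule: rtrancl_induct)
    case (step a b)
    then show ?case
      using F[of "fst a" "snd a" "fst b" "snd b"] F[of "fst b" "snd b" "fst a" "snd a"]
      by (auto simp: case_prod_unfold)
  qed simp
  then show ?thesis by (simp add: glued_lift_def)
qed

lemma locally_affine_continuous:
  assumes P: "square_gluing P" and Q: "square_gluing Q" and f: "locally_affine A P Q f"
  shows "continuous_map (glued_surface P) (glued_surface Q) f"
proof -
  interpret P: square_gluing P by fact
  interpret Q: square_gluing Q by fact
  have im: "f x \<in> topspace (glued_surface Q)" if x: "x \<in> topspace (glued_surface P)" for x
  proof -
    obtain i z where "i < squares P" "z \<in> unit_square" "x = glued_point P i z"
      using x unfolding P.topspace_glued_surface by blast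
    then show ?thesis using f unfolding locally_affine_def
      by (metis Q.glued_point_in_topspace dist_self)
  qed
  have "openin (glued_surface P) {x \<in> topspace (glued_surface P). f x \<in> U}"
    if U: "openin (glued_surface Q) U" for U
    unfolding P.openin_glued_surface_iff
  proof (intro conjI allI impI ballI)
    fix i z assume p: "i < squares P" "z \<in> unit_square" "glued_point P i z \<in> {x \<in> topspace (glued_surface P). f x \<in> U}"
    obtain k v where k: "k < squares Q" "v \<in> unit_square" "f (glued_point P i z) = glued_point Q k v"
      using im[of "glued_point P i z"] p(3) unfolding Q.topspace_glued_surface by blast
    obtain e where e: "e > 0" and E: "\<And>w. w \<in> unit_square \<Longrightarrow> dist w z < e \<Longrightarrow>
     (\<exists>j z' w'. j < squares Q \<and> z' \<in> unit_square \<and> w' \<in> unit_square \<and>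
        f (glued_point P i z) = glued_point Q j z' \<and> f (glued_point P i w) = glued_point Q j w' \<and>
        w' - z' = plane_map A (w - z))"
      using f p unfolding locally_affine_def by blast
    have "\<exists>d>0. d \<le> boundary_gap v \<and>
      (\<forall>(j, y)\<in>glued_point Q k v. \<forall>w\<in>unit_square. dist w y < d \<longrightarrow> glued_point Q j w \<in> U)"
    proof (rule Q.uniform_radius[OF k(1,2)])
      fix j y assume "(j, y) \<in> glued_point Q k v"
      then have "j < squares Q" "y \<in> unit_square" "glued_point Q j y \<in> U"
        using k p by (auto simp: Q.mem_glued_point_iff)
      then show "\<exists>e>0. \<forall>w\<in>unit_square. dist w y < e \<longrightarrow> glued_point Q j w \<in> U"
        using U unfolding Q.openin_glued_surface_iff by blast
    qed
    then obtain d where d: "d > 0" and D: "\<And>j y w. (j, y) \<in> glued_point Q k v \<Longrightarrow> w \<in> unit_square \<Longrightarrow>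
      dist w y < d \<Longrightarrow> glued_point Q j w \<in> U" by blast
    obtain K where K: "K > 0" "\<And>z. cmod (plane_map A z) \<le> cmod z * K" using plane_map_bound by blast
    show "\<exists>e>0. \<forall>w\<in>unit_square. dist w z < e \<longrightarrow> glued_point P i w \<in> {x \<in> topspace (glued_surface P). f x \<in> U}"
    proof (intro exI[of _ "min e (d / K)"] conjI ballI impI)
      fix w assume w: "w \<in> unit_square" "dist w z < min e (d / K)"
      then obtain j z' w' where j: "j < squares Q" "z' \<in> unit_square" "w' \<in> unit_square"
        "f (glued_point P i z) = glued_point Q j z'" "f (glued_point P i w) = glued_point Q j w'"
        "w' - z' = plane_map A (w - z)" using E[of w] by auto
      have "dist w' z' \<le> dist w z * K" using K(2)[of "w - z"] j by (simp add: dist_norm)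
      also have "\<dots> < d" using w K by (simp add: pos_less_divide_eq)
      finally have "glued_point Q j w' \<in> U" using D[of j z' w'] j k by (simp add: Q.mem_glued_point_iff)
      then show "glued_point P i w \<in> {x \<in> topspace (glued_surface P). f x \<in> U}" using j p w by simp
    qed (use e d K in auto)
  qed auto
  then show ?thesis using im by (auto simp: continuous_map_def)
qed

text \<open>Continuity of the inverse is automatic for a continuous bijection from a compact to a
  Hausdorff space. Charts on both sides are translations on the squares, so the affine formula in
  the squares becomes one in the charts, with a radius uniform over the representatives.\<close>

lemma locally_affine_imp_affine_homeo:
  assumes P: "square_gluing P" and Q: "square_gluing Q" and f: "locally_affine A P Q f"
    and bij: "bij_betw f (topspace (glued_surface P)) (topspace (glued_surface Q))"
    and sing: "f ` singular_vertices P = singular_vertices Q"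
  shows "affine_homeo A (origami_surface P) (origami_surface Q) f"
proof -
  interpret P: square_gluing P by fact
  interpret Q: square_gluing Q by fact
  have hom: "homeomorphic_map (glued_surface P) (glued_surface Q) f"
    using bij locally_affine_continuous[OF P Q f] P.compact_glued_surface Q.Hausdorff_glued_surface
    by (intro continuous_imp_homeomorphic_map) (auto simp: bij_betw_def)
  have "f ` (topspace (glued_surface P) - singular_vertices P) = topspace (glued_surface Q) - singular_vertices Q"
    using bij sing P.singular_vertices_subset
      inj_on_image_set_diff[of f "topspace (glued_surface P)" "topspace (glued_surface P)" "singular_vertices P"]
    by (auto simp: bij_betw_def)
  then have 1: "homeomorphic_map (regular_part (origami_surface P)) (regular_part (origami_surface Q)) f"
    unfolding regular_part_def origami_surface_def
    by (intro homeomorphic_map_subtopologies[OF _] ) (simp_all add: hom Int_absorb1)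
  have "\<exists>b W. openin (regular_part (origami_surface P)) W \<and> x \<in> W \<and> W \<subseteq> U \<and> f ` W \<subseteq> V \<and>
           (\<forall>y\<in>W. \<psi> (f y) = plane_map A (\<phi> y) + b)"
    if U: "(U, \<phi>) \<in> origami_atlas P" and V: "(V, \<psi>) \<in> origami_atlas Q" and x: "x \<in> U" "f x \<in> V" for U \<phi> V \<psi> x
  proof -
    have Uo: "openin (glued_surface P) U" "U \<inter> singular_vertices P = {}"
      and Vo: "openin (glued_surface Q) V" using U V unfolding origami_atlas_def by auto
    obtain i0 z0 where p: "i0 < squares P" "z0 \<in> unit_square" "x = glued_point P i0 z0"
      using openin_subset[OF Uo(1)] x unfolding P.topspace_glued_surface by blast
    obtain k v where k: "k < squares Q" "v \<in> unit_square" "f x = glued_point Q k v"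
      using openin_subset[OF Vo(1)] x unfolding Q.topspace_glued_surface by blast
    obtain d where d: "d > 0" and D: "\<And>j y w. (j, y) \<in> glued_point Q k v \<Longrightarrow> w \<in> unit_square \<Longrightarrow>
      dist w y < d \<Longrightarrow> glued_point Q j w \<in> V \<and> \<psi> (glued_point Q j w) = \<psi> (glued_point Q k v) + (w - y)"
      using Q.atlas_star[OF V k(1,2)] x(2)[unfolded k(3)] by blast
    obtain K where K: "K > 0" "\<And>z. cmod (plane_map A z) \<le> cmod z * K" using plane_map_bound by blast
    have "\<exists>e>0. e \<le> boundary_gap z0 \<and> (\<forall>(i, z)\<in>glued_point P i0 z0. \<forall>w\<in>unit_square. dist w z < e \<longrightarrow>
       glued_point P i w \<in> U \<and> f (glued_point P i w) \<in> V \<and>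
       \<psi> (f (glued_point P i w)) = plane_map A (\<phi> (glued_point P i w)) + (\<psi> (f x) - plane_map A (\<phi> x)))"
    proof (rule P.uniform_radius[OF p(1,2)])
      fix i z assume "(i, z) \<in> glued_point P i0 z0"
      then have iz: "i < squares P" "z \<in> unit_square" "glued_point P i z = x"
        using p by (auto simp: P.mem_glued_point_iff)
      obtain e1 where e1: "e1 > 0" "\<And>w. w \<in> unit_square \<Longrightarrow> dist w z < e1 \<Longrightarrow>
        glued_point P i w \<in> U \<and> \<phi> (glued_point P i w) = \<phi> x + (w - z)"
        using P.atlas_local[OF U iz(1,2)] iz x by auto
      obtain e2 where e2: "e2 > 0" "\<And>w. w \<in> unit_square \<Longrightarrow> dist w z < e2 \<Longrightarrow>
       (\<exists>j z' w'. j < squares Q \<and> z' \<in> unit_square \<and> w' \<in> unit_square \<and>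
        f (glued_point P i z) = glued_point Q j z' \<and> f (glued_point P i w) = glued_point Q j w' \<and>
        w' - z' = plane_map A (w - z))"
        using f iz unfolding locally_affine_def by blast
      show "\<exists>e>0. \<forall>w\<in>unit_square. dist w z < e \<longrightarrow>
         glued_point P i w \<in> U \<and> f (glued_point P i w) \<in> V \<and>
       \<psi> (f (glued_point P i w)) = plane_map A (\<phi> (glued_point P i w)) + (\<psi> (f x) - plane_map A (\<phi> x))"
      proof (intro exI[of _ "min e1 (min e2 (d / K))"] conjI ballI impI)
        fix w assume w: "w \<in> unit_square" "dist w z < min e1 (min e2 (d / K))"
        then have 1: "glued_point P i w \<in> U" "\<phi> (glued_point P i w) = \<phi> x + (w - z)" using e1 by auto
        obtain j z' w' where j: "j < squares Q" "z' \<in> unit_square" "w' \<in> unit_square"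
          "f (glued_point P i z) = glued_point Q j z'" "f (glued_point P i w) = glued_point Q j w'"
          "w' - z' = plane_map A (w - z)" using e2(2)[of w] w by auto
        have "dist w' z' \<le> dist w z * K" using K(2)[of "w - z"] j by (simp add: dist_norm)
        also have "\<dots> < d" using w K by (simp add: pos_less_divide_eq)
        finally have 2: "glued_point Q j w' \<in> V \<and> \<psi> (glued_point Q j w') = \<psi> (glued_point Q k v) + (w' - z')"
          using D[of j z' w'] j k iz by (simp add: Q.mem_glued_point_iff)
        then show "glued_point P i w \<in> U" "f (glued_point P i w) \<in> V"
          "\<psi> (f (glued_point P i w)) = plane_map A (\<phi> (glued_point P i w)) + (\<psi> (f x) - plane_map A (\<phi> x))"
          using 1 j k by (simp_all add: plane_map_add)
      qed (use e1 e2 d K in auto)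
    qed
    then obtain e where e: "e > 0" "e \<le> boundary_gap z0" and E: "\<And>i z w. (i, z) \<in> glued_point P i0 z0 \<Longrightarrow>
       w \<in> unit_square \<Longrightarrow> dist w z < e \<Longrightarrow> glued_point P i w \<in> U \<and> f (glued_point P i w) \<in> V \<and>
       \<psi> (f (glued_point P i w)) = plane_map A (\<phi> (glued_point P i w)) + (\<psi> (f x) - plane_map A (\<phi> x))" by blast
    let ?W = "star P x e"
    have W: "y \<in> U \<and> f y \<in> V \<and> \<psi> (f y) = plane_map A (\<phi> y) + (\<psi> (f x) - plane_map A (\<phi> x))" if "y \<in> ?W" for y
      using that E p(3) unfolding star_def by blast
    then have "?W \<inter> singular_vertices P = {}" using Uo by blast
    then have "openin (regular_part (origami_surface P)) ?W"
      using P.openin_regular_part P.openin_star[OF p(1,2) e(2)] p(3) by simp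
    moreover have "x \<in> ?W" using P.center_in_star[OF p(1,2) e(1)] p(3) by simp
    ultimately show ?thesis using W by blast
  qed
  with 1 show ?thesis by (auto simp: affine_homeo_def origami_surface_def regular_part_def)
qed

text \<open>Maps given by formulas on the squares; the compatibility with the gluing makes them well defined.\<close>

lemma affine_homeo_lift:
  assumes P: "square_gluing P" and Q: "square_gluing Q"
    and F: "\<And>i z. i < squares P \<Longrightarrow> z \<in> unit_square \<Longrightarrow> F i z \<in> topspace (glued_surface Q)"
    and G: "\<And>i z. i < squares Q \<Longrightarrow> z \<in> unit_square \<Longrightarrow> G i z \<in> topspace (glued_surface P)"
    and FE: "\<And>i z j w. ((i, z), (j, w)) \<in> edge_pairs P \<Longrightarrow> F i z = F j w"
    and GE: "\<And>i z j w. ((i, z), (j, w)) \<in> edge_pairs Q \<Longrightarrow> G i z = G j w"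
    and GF: "\<And>i z. i < squares P \<Longrightarrow> z \<in> unit_square \<Longrightarrow> glued_lift G (F i z) = glued_point P i z"
    and FG: "\<And>i z. i < squares Q \<Longrightarrow> z \<in> unit_square \<Longrightarrow> glued_lift F (G i z) = glued_point Q i z"
    and loc: "\<And>i z. i < squares P \<Longrightarrow> z \<in> unit_square \<Longrightarrow> \<exists>e>0. \<forall>w\<in>unit_square. dist w z < e \<longrightarrow>
      (\<exists>j z' w'. j < squares Q \<and> z' \<in> unit_square \<and> w' \<in> unit_square \<and>
        F i z = glued_point Q j z' \<and> F i w = glued_point Q j w' \<and> w' - z' = plane_map A (w - z))"
    and \<sigma>: "\<sigma> permutes {..<squares P}" "squares P = squares Q"
    and F0: "\<And>i. i < squares P \<Longrightarrow> F i 0 = glued_point Q (\<sigma> i) 0"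
    and comm: "\<And>i. i < squares P \<Longrightarrow> commutator Q (\<sigma> i) = \<sigma> (commutator P i)"
  shows "affine_homeo A (origami_surface P) (origami_surface Q) (glued_lift F)"
proof (rule locally_affine_imp_affine_homeo[OF P Q])
  interpret P: square_gluing P by fact
  interpret Q: square_gluing Q by fact
  have lF: "glued_lift F (glued_point P i z) = F i z" if "i < squares P" "z \<in> unit_square" for i z
    using P.glued_lift[of F, OF FE that] .
  have lG: "glued_lift G (glued_point Q i z) = G i z" if "i < squares Q" "z \<in> unit_square" for i z
    using Q.glued_lift[of G, OF GE that] .
  show "locally_affine A P Q (glued_lift F)"
    unfolding locally_affine_def using loc by (simp add: lF)
  show "bij_betw (glued_lift F) (topspace (glued_surface P)) (topspace (glued_surface Q))"
    by (rule bij_betw_byWitness[of _ "glued_lift G"])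
      (auto simp: P.topspace_glued_surface Q.topspace_glued_surface lF lG FG GF,
       (use F G P.topspace_glued_surface Q.topspace_glued_surface in auto))
  have z: "0 \<in> unit_square" by (simp add: unit_square_iff)
  have s: "\<sigma> i < squares P \<longleftrightarrow> i < squares P" for i using permutes_in_image[OF \<sigma>(1), of i] by simp
  \<comment> \<open>Singularities are the vertices moved by the commutator, and
    \<open>\<sigma>\<close> intertwines the two commutators.\<close>
  have m: "commutator Q (\<sigma> i) \<noteq> \<sigma> i \<longleftrightarrow> commutator P i \<noteq> i" if "i < squares P" for i
    using comm[OF that] inj_eq[OF permutes_inj[OF \<sigma>(1)]] by simp
  show "glued_lift F ` singular_vertices P = singular_vertices Q"
  proof
    show "glued_lift F ` singular_vertices P \<subseteq> singular_vertices Q"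
    proof
      fix x assume "x \<in> glued_lift F ` singular_vertices P"
      then obtain i where "i < squares P" "commutator P i \<noteq> i" "x = glued_lift F (glued_point P i 0)"
        unfolding P.singular_vertices_eq by blast
      then have "x = glued_point Q (\<sigma> i) 0" "\<sigma> i < squares Q" "commutator Q (\<sigma> i) \<noteq> \<sigma> i"
        using lF z F0 m s \<sigma>(2) by auto
      then show "x \<in> singular_vertices Q" unfolding Q.singular_vertices_eq by blast
    qed
    show "singular_vertices Q \<subseteq> glued_lift F ` singular_vertices P"
    proof
      fix x assume "x \<in> singular_vertices Q"
      then obtain j where j: "j < squares Q" "commutator Q j \<noteq> j" "x = glued_point Q j 0"
        unfolding Q.singular_vertices_eq by blast
      obtain i where i: "j = \<sigma> i" using permutes_surj[OF \<sigma>(1)] by (metis surjD)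
      then have "i < squares P" using j s \<sigma>(2) by simp
      then have "x = glued_lift F (glued_point P i 0)" "commutator P i \<noteq> i"
        using j i lF z F0 m by auto
      then show "x \<in> glued_lift F ` singular_vertices P"
        unfolding P.singular_vertices_eq using \<open>i < squares P\<close> by blast
    qed
  qed
qed

section \<open>The shear and the quarter turn\<close>

definition mat2 :: "'a::zero \<Rightarrow> 'a \<Rightarrow> 'a \<Rightarrow> 'a \<Rightarrow> 'a ^ 2 ^ 2" where
  "mat2 a b c d = vector [vector [a, b], vector [c, d]]"

lemma mat2_nth [simp]:
  "mat2 a b c d $ 1 $ 1 = a" "mat2 a b c d $ 1 $ 2 = b" "mat2 a b c d $ 2 $ 1 = c" "mat2 a b c d $ 2 $ 2 = d"
  by (simp_all add: mat2_def)

lemma mat2_eq_iff: "A = B \<longleftrightarrow> A $ 1 $ 1 = B $ 1 $ 1 \<and> A $ 1 $ 2 = B $ 1 $ 2 \<and> A $ 2 $ 1 = B $ 2 $ 1 \<and> A $ 2 $ 2 = B $ 2 $ 2"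
  for A B :: "'a ^ 2 ^ 2"
  by (simp add: vec_eq_iff forall_2)

definition affinely_equivalent :: "real ^ 2 ^ 2 \<Rightarrow> origami_data \<Rightarrow> origami_data \<Rightarrow> bool" where
  "affinely_equivalent A P Q \<longleftrightarrow> (\<exists>f. affine_homeo A (origami_surface P) (origami_surface Q) f)"

text \<open>After the shear has been cut into unit squares again, the upper edge of square
  \<open>i\<close> is that of its former left neighbour; hence the factor
  \<open>inv (right Q)\<close>.\<close>

definition sheared :: "origami_data \<Rightarrow> origami_data" where
  "sheared Q = \<lparr>squares = squares Q, right = right Q, up = up Q \<circ> inv (right Q)\<rparr>"

text \<open>A counterclockwise quarter turn makes the old right direction point up and the old up
  direction point left.\<close>

definition rotated :: "origami_data \<Rightarrow> origami_data" where
  "rotated Q = \<lparr>squares = squares Q, right = inv (up Q), up = right Q\<rparr>"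

lemma sheared_simps [simp]: "squares (sheared Q) = squares Q" "right (sheared Q) = right Q"
  "up (sheared Q) = up Q \<circ> inv (right Q)"
  by (simp_all add: sheared_def)

lemma rotated_simps [simp]: "squares (rotated Q) = squares Q" "right (rotated Q) = inv (up Q)"
  "up (rotated Q) = right Q"
  by (simp_all add: rotated_def)

context square_gluing
begin

lemma sheared_gluing: "square_gluing (sheared Q)"
  by unfold_locales
    (auto simp: o_assoc intro!: permutes_compose permutes_inv right_permutes up_permutes)

lemma rotated_gluing: "square_gluing (rotated Q)"
  by unfold_locales (auto intro!: permutes_inv right_permutes up_permutes)

lemma inv_comp_inv_right: "inv (up Q \<circ> inv (right Q)) = right Q \<circ> inv (up Q)"
  using permutes_bij[OF right_permutes] permutes_bij[OF up_permutes]
  by (subst o_inv_distrib) (auto intro: bij_imp_bij_inv simp: inv_inv_eq)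

lemma affinely_equivalent_sheared: "affinely_equivalent (mat2 1 1 0 1) Q (sheared Q)"
proof -
  let ?Q = "sheared Q"
  interpret S: square_gluing ?Q by (rule sheared_gluing)
  \<comment> \<open>The sheared square is a parallelogram, cut along the image of the antidiagonal
    \<open>Re z + Im z = 1\<close>; the part beyond the cut is moved into the next square.
    \<open>G\<close> undoes this by cutting along \<open>Re z = Im z\<close>.\<close>
  define F where "F i z = (if Re z + Im z \<le> 1 then glued_point ?Q i (Complex (Re z + Im z) (Im z))
      else glued_point ?Q (right Q i) (Complex (Re z + Im z - 1) (Im z)))" for i z
  define G where "G i z = (if Im z \<le> Re z then glued_point Q i (Complex (Re z - Im z) (Im z))
      else glued_point Q (inv (right Q) i) (Complex (Re z - Im z + 1) (Im z)))" for i z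
  have F1: "F i z = glued_point ?Q i (Complex (Re z + Im z) (Im z))" if "Re z + Im z \<le> 1" for i z
    using that by (simp add: F_def)
  \<comment> \<open>On the cut both formulas hold, because the right edge is glued to the left edge
    of the next square. Each formula is thus available on a closed triangle.\<close>
  have F2: "F i z = glued_point ?Q (right Q i) (Complex (Re z + Im z - 1) (Im z))"
    if "Re z + Im z \<ge> 1" "i < squares Q" "z \<in> unit_square" for i z
    using that S.glued_point_right[of i "Complex (Re z + Im z) (Im z)"] by (auto simp: F_def unit_square_iff)
  have G1: "G i z = glued_point Q i (Complex (Re z - Im z) (Im z))" if "Im z \<le> Re z" for i z
    using that by (simp add: G_def)
  have G2: "G i z = glued_point Q (inv (right Q) i) (Complex (Re z - Im z + 1) (Im z))"
    if "Im z \<ge> Re z" "i < squares Q" "z \<in> unit_square" for i z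
    using that glued_point_right[of "inv (right Q) i" "Complex (Re z - Im z + 1) (Im z)"]
    by (auto simp: G_def unit_square_iff)
  have FE: "F i z = F j w" if e: "((i, z), (j, w)) \<in> edge_pairs Q" for i z j w
  proof -
    consider (r) y where "z = Complex 1 y" "j = right Q i" "w = Complex 0 y" "i < squares Q" "0 \<le> y" "y \<le> 1"
      | (u) x where "z = Complex x 1" "j = up Q i" "w = Complex x 0" "i < squares Q" "0 \<le> x" "x \<le> 1"
      using e by (auto simp: edge_pairs_def)
    then show ?thesis
    proof cases
      case r
      then show ?thesis using F2[of z i] F1[of w j] by (simp add: unit_square_iff)
    next
      case u
      then show ?thesis using F2[of z i] F1[of w j] S.glued_point_up[of "right Q i" "Complex x 1"]
        by (simp add: unit_square_iff)
    qed
  qed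
  have GE: "G i z = G j w" if e: "((i, z), (j, w)) \<in> edge_pairs ?Q" for i z j w
  proof -
    consider (r) y where "z = Complex 1 y" "j = right Q i" "w = Complex 0 y" "i < squares Q" "0 \<le> y" "y \<le> 1"
      | (u) x where "z = Complex x 1" "j = up Q (inv (right Q) i)" "w = Complex x 0" "i < squares Q" "0 \<le> x" "x \<le> 1"
      using e by (auto simp: edge_pairs_def)
    then show ?thesis
    proof cases
      case r
      then show ?thesis using G1[of z i] G2[of w j] by (simp add: unit_square_iff)
    next
      case u
      then show ?thesis using G2[of z i] G1[of w j] glued_point_up[of "inv (right Q) i" "Complex x 1"]
        by (simp add: unit_square_iff)
    qed
  qed
  have "affine_homeo (mat2 1 1 0 1) (origami_surface Q) (origami_surface ?Q) (glued_lift F)"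
  proof (rule affine_homeo_lift[where G = G and \<sigma> = id])
    show "square_gluing Q" "square_gluing ?Q" by unfold_locales
    show "F i z \<in> topspace (glued_surface ?Q)" if "i < squares Q" "z \<in> unit_square" for i z
      using that by (auto simp: F_def unit_square_iff intro!: S.glued_point_in_topspace)
    show "G i z \<in> topspace (glued_surface Q)" if "i < squares ?Q" "z \<in> unit_square" for i z
      using that by (auto simp: G_def unit_square_iff intro!: glued_point_in_topspace)
    show "glued_lift G (F i z) = glued_point Q i z" if i: "i < squares Q" "z \<in> unit_square" for i z
    proof (cases "Re z + Im z \<le> 1")
      case True
      then have "glued_lift G (F i z) = G i (Complex (Re z + Im z) (Im z))"
        unfolding F1[OF True] using i by (intro S.glued_lift GE) (auto simp: unit_square_iff)
      then show ?thesis using G1[of "Complex (Re z + Im z) (Im z)" i] i by (simp add: unit_square_iff)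
    next
      case False
      then have "glued_lift G (F i z) = G (right Q i) (Complex (Re z + Im z - 1) (Im z))"
        unfolding F2[OF less_imp_le[OF False[unfolded not_le]] i] using i
        by (intro S.glued_lift GE) (auto simp: unit_square_iff)
      then show ?thesis using G2[of "Complex (Re z + Im z - 1) (Im z)" "right Q i"] i False
        by (simp add: unit_square_iff)
    qed
    show "glued_lift F (G i z) = glued_point ?Q i z" if i: "i < squares ?Q" "z \<in> unit_square" for i z
    proof (cases "Im z \<le> Re z")
      case True
      then have "glued_lift F (G i z) = F i (Complex (Re z - Im z) (Im z))"
        unfolding G1[OF True] using i by (intro glued_lift FE) (auto simp: unit_square_iff)
      then show ?thesis using F1[of "Complex (Re z - Im z) (Im z)" i] i by (simp add: unit_square_iff)
    next
      case False
      then have "glued_lift F (G i z) = F (inv (right Q) i) (Complex (Re z - Im z + 1) (Im z))"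
        unfolding G2[OF less_imp_le[OF False[unfolded not_le]] i[unfolded sheared_simps]] using i
        by (intro glued_lift FE) (auto simp: unit_square_iff)
      then show ?thesis using F2[of "Complex (Re z - Im z + 1) (Im z)" "inv (right Q) i"] i False
        by (simp add: unit_square_iff)
    qed
    \<comment> \<open>\<open>Re w + Im w\<close> changes by at most twice the distance, so half the
      distance of \<open>Re z + Im z\<close> from 1 keeps \<open>w\<close> on the side of
      \<open>z\<close>. If \<open>z\<close> is on the cut, both formulas apply to it and any radius
      will do.\<close>
    show "\<exists>e>0. \<forall>w\<in>unit_square. dist w z < e \<longrightarrow> (\<exists>j z' w'. j < squares ?Q \<and> z' \<in> unit_square \<and>
        w' \<in> unit_square \<and> F i z = glued_point ?Q j z' \<and> F i w = glued_point ?Q j w' \<and>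
        w' - z' = plane_map (mat2 1 1 0 1) (w - z))" if i: "i < squares Q" "z \<in> unit_square" for i z
    proof (intro exI[of _ "if Re z + Im z = 1 then 1 else \<bar>1 - (Re z + Im z)\<bar> / 2"] conjI ballI impI)
      fix w assume w: "w \<in> unit_square" "dist w z < (if Re z + Im z = 1 then 1 else \<bar>1 - (Re z + Im z)\<bar> / 2)"
      have "\<bar>(Re w + Im w) - (Re z + Im z)\<bar> \<le> 2 * dist w z"
        using abs_Re_le_cmod[of "w - z"] abs_Im_le_cmod[of "w - z"] by (simp add: dist_norm)
      then consider "Re z + Im z \<le> 1" "Re w + Im w \<le> 1" | "Re z + Im z \<ge> 1" "Re w + Im w \<ge> 1"
        using w(2) by (fastforce split: if_splits)
      then show "\<exists>j z' w'. j < squares ?Q \<and> z' \<in> unit_square \<and>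
        w' \<in> unit_square \<and> F i z = glued_point ?Q j z' \<and> F i w = glued_point ?Q j w' \<and>
        w' - z' = plane_map (mat2 1 1 0 1) (w - z)"
      proof cases
        case 1
        then show ?thesis using i w(1) F1
          by (intro exI[of _ i] exI[of _ "Complex (Re z + Im z) (Im z)"] exI[of _ "Complex (Re w + Im w) (Im w)"])
            (auto simp: unit_square_iff plane_map_def complex_eq_iff)
      next
        case 2
        then show ?thesis using i w(1) F2
          by (intro exI[of _ "right Q i"] exI[of _ "Complex (Re z + Im z - 1) (Im z)"]
              exI[of _ "Complex (Re w + Im w - 1) (Im w)"])
            (auto simp: unit_square_iff plane_map_def complex_eq_iff)
      qed
    qed auto
    show "F i 0 = glued_point ?Q (id i) 0" for i by (simp add: F_def zero_complex.code)
    show "commutator ?Q (id i) = id (commutator Q i)" for i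
      by (simp add: commutator_def inv_comp_inv_right)
  qed (use FE GE in \<open>auto simp: permutes_id\<close>)
  then show ?thesis unfolding affinely_equivalent_def by blast
qed

lemma affinely_equivalent_rotated: "affinely_equivalent (mat2 0 (- 1) 1 0) Q (rotated Q)"
proof -
  let ?Q = "rotated Q"
  interpret S: square_gluing ?Q by (rule rotated_gluing)
  define F where "F i z = glued_point ?Q i (Complex (1 - Im z) (Re z))" for i z
  define G where "G i z = glued_point Q i (Complex (Im z) (1 - Re z))" for i z
  have FE: "F i z = F j w" if e: "((i, z), (j, w)) \<in> edge_pairs Q" for i z j w
  proof -
    consider (r) y where "z = Complex 1 y" "j = right Q i" "w = Complex 0 y" "i < squares Q" "0 \<le> y" "y \<le> 1"
      | (u) x where "z = Complex x 1" "j = up Q i" "w = Complex x 0" "i < squares Q" "0 \<le> x" "x \<le> 1"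
      using e by (auto simp: edge_pairs_def)
    then show ?thesis
    proof cases
      case r
      then show ?thesis using S.glued_point_up[of i "Complex (1 - y) 1"] by (simp add: F_def unit_square_iff)
    next
      case u
      then show ?thesis using S.glued_point_right[of "up Q i" "Complex 1 x"] by (simp add: F_def unit_square_iff)
    qed
  qed
  have GE: "G i z = G j w" if e: "((i, z), (j, w)) \<in> edge_pairs ?Q" for i z j w
  proof -
    consider (r) y where "z = Complex 1 y" "j = inv (up Q) i" "w = Complex 0 y" "i < squares Q" "0 \<le> y" "y \<le> 1"
      | (u) x where "z = Complex x 1" "j = right Q i" "w = Complex x 0" "i < squares Q" "0 \<le> x" "x \<le> 1"
      using e by (auto simp: edge_pairs_def)
    then show ?thesis
    proof cases
      case r
      then show ?thesis using glued_point_up[of "inv (up Q) i" "Complex y 1"] by (simp add: G_def unit_square_iff)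
    next
      case u
      then show ?thesis using glued_point_right[of i "Complex 1 (1 - x)"] by (simp add: G_def unit_square_iff)
    qed
  qed
  \<comment> \<open>The turn carries the lower left corner of square \<open>i\<close> to the lower
    right corner of the new square \<open>i\<close>. This is the lower left corner of its new right
    neighbour \<open>inv (up Q) i\<close>, whence the choice of \<open>\<sigma>\<close>.\<close>
  have "affine_homeo (mat2 0 (- 1) 1 0) (origami_surface Q) (origami_surface ?Q) (glued_lift F)"
  proof (rule affine_homeo_lift[where G = G and \<sigma> = "inv (up Q)"])
    show "square_gluing Q" "square_gluing ?Q" by unfold_locales
    show "F i z \<in> topspace (glued_surface ?Q)" if "i < squares Q" "z \<in> unit_square" for i z
      using that by (auto simp: F_def unit_square_iff intro!: S.glued_point_in_topspace)
    show "G i z \<in> topspace (glued_surface Q)" if "i < squares ?Q" "z \<in> unit_square" for i z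
      using that by (auto simp: G_def unit_square_iff intro!: glued_point_in_topspace)
    show "glued_lift G (F i z) = glued_point Q i z" if i: "i < squares Q" "z \<in> unit_square" for i z
    proof -
      have "glued_lift G (F i z) = G i (Complex (1 - Im z) (Re z))"
        unfolding F_def using i by (intro S.glued_lift GE) (auto simp: unit_square_iff)
      then show ?thesis by (simp add: G_def)
    qed
    show "glued_lift F (G i z) = glued_point ?Q i z" if i: "i < squares ?Q" "z \<in> unit_square" for i z
    proof -
      have "glued_lift F (G i z) = F i (Complex (Im z) (1 - Re z))"
        unfolding G_def using i by (intro glued_lift FE) (auto simp: unit_square_iff)
      then show ?thesis by (simp add: F_def)
    qed
    show "\<exists>e>0. \<forall>w\<in>unit_square. dist w z < e \<longrightarrow> (\<exists>j z' w'. j < squares ?Q \<and> z' \<in> unit_square \<and>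
        w' \<in> unit_square \<and> F i z = glued_point ?Q j z' \<and> F i w = glued_point ?Q j w' \<and>
        w' - z' = plane_map (mat2 0 (- 1) 1 0) (w - z))" if i: "i < squares Q" "z \<in> unit_square" for i z
    proof (intro exI[of _ "1::real"] conjI ballI impI)
      fix w assume w: "w \<in> unit_square"
      then show "\<exists>j z' w'. j < squares ?Q \<and> z' \<in> unit_square \<and>
        w' \<in> unit_square \<and> F i z = glued_point ?Q j z' \<and> F i w = glued_point ?Q j w' \<and>
        w' - z' = plane_map (mat2 0 (- 1) 1 0) (w - z)"
        using i by (intro exI[of _ i] exI[of _ "Complex (1 - Im z) (Re z)"] exI[of _ "Complex (1 - Im w) (Re w)"])
          (auto simp: F_def unit_square_iff plane_map_def complex_eq_iff)
    qed simp
    show "F i 0 = glued_point ?Q (inv (up Q) i) 0" if "i < squares Q" for i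
      using S.glued_point_right[of i "Complex 1 0"] that by (simp add: F_def unit_square_iff zero_complex.code)
    show "commutator ?Q (inv (up Q) i) = inv (up Q) (commutator Q i)" for i
      by (simp add: commutator_def inv_inv_eq permutes_bij[OF up_permutes])
    show "inv (up Q) permutes {..<squares Q}" by (rule permutes_inv[OF up_permutes])
  qed (use FE GE in auto)
  then show ?thesis unfolding affinely_equivalent_def by blast
qed

lemma affinely_equivalent_refl: "affinely_equivalent (mat 1) Q Q"
proof -
  have "locally_affine (mat 1) Q Q id"
    unfolding locally_affine_def
  proof (intro allI impI ballI exI[of _ "1::real"] conjI)
    fix i z w assume "i < squares Q" "z \<in> unit_square" "w \<in> unit_square"
    then show "\<exists>j z' w'. j < squares Q \<and> z' \<in> unit_square \<and> w' \<in> unit_square \<and>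
        id (glued_point Q i z) = glued_point Q j z' \<and> id (glued_point Q i w) = glued_point Q j w' \<and>
        w' - z' = plane_map (mat 1) (w - z)"
      by (intro exI[of _ i] exI[of _ z] exI[of _ w]) simp
  qed simp
  then have "affine_homeo (mat 1) (origami_surface Q) (origami_surface Q) id"
    by (intro locally_affine_imp_affine_homeo) (auto intro: square_gluing_axioms)
  then show ?thesis unfolding affinely_equivalent_def by blast
qed

end

section \<open>Composition and inversion of affine homeomorphisms\<close>

lemma translation_atlasD:
  assumes "translation_atlas (regular_part S) (atlas S)"
  shows "(U, \<phi>) \<in> atlas S \<Longrightarrow> openin (regular_part S) U"
    and "x \<in> topspace (regular_part S) \<Longrightarrow> \<exists>U \<phi>. (U, \<phi>) \<in> atlas S \<and> x \<in> U"
  using assms unfolding translation_atlas_def by blast+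

lemma affine_homeoD:
  assumes "affine_homeo A S T f" "(U, \<phi>) \<in> atlas S" "(V, \<psi>) \<in> atlas T" "x \<in> U" "f x \<in> V"
  shows "\<exists>b W. openin (regular_part S) W \<and> x \<in> W \<and> W \<subseteq> U \<and> f ` W \<subseteq> V \<and>
           (\<forall>y\<in>W. \<psi> (f y) = plane_map A (\<phi> y) + b)"
  using assms unfolding affine_homeo_def by fast

lemma affine_homeo_compose:
  assumes f: "affine_homeo A S T f" and g: "affine_homeo B T R g"
    and S: "translation_atlas (regular_part S) (atlas S)" and T: "translation_atlas (regular_part T) (atlas T)"
  shows "affine_homeo (B ** A) S R (g \<circ> f)"
  unfolding affine_homeo_def
proof (intro conjI ballI impI; (clarify)?)
  have homf: "homeomorphic_map (regular_part S) (regular_part T) f" using f by (simp add: affine_homeo_def)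
  then show "homeomorphic_map (regular_part S) (regular_part R) (g \<circ> f)"
    using g by (auto simp: affine_homeo_def intro: homeomorphic_map_compose)
  fix U \<phi> V \<psi> x assume U: "(U, \<phi>) \<in> atlas S" and V: "(V, \<psi>) \<in> atlas R" and x: "x \<in> U" "(g \<circ> f) x \<in> V"
  have "x \<in> topspace (regular_part S)" using translation_atlasD(1)[OF S U] x openin_subset by blast
  then have "f x \<in> topspace (regular_part T)" using homeomorphic_imp_surjective_map[OF homf] by blast
  then obtain X \<tau> where X: "(X, \<tau>) \<in> atlas T" "f x \<in> X" using translation_atlasD(2)[OF T] by blast
  obtain b1 W1 where 1: "openin (regular_part S) W1" "x \<in> W1" "W1 \<subseteq> U" "f ` W1 \<subseteq> X"
    "\<forall>y\<in>W1. \<tau> (f y) = plane_map A (\<phi> y) + b1" using affine_homeoD[OF f U X(1) x(1) X(2)] by blast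
  obtain b2 W2 where 2: "openin (regular_part T) W2" "f x \<in> W2" "W2 \<subseteq> X" "g ` W2 \<subseteq> V"
    "\<forall>y\<in>W2. \<psi> (g y) = plane_map B (\<tau> y) + b2" using affine_homeoD[OF g X(1) V X(2)] x by auto
  let ?W = "W1 \<inter> {y \<in> topspace (regular_part S). f y \<in> W2}"
  have "openin (regular_part S) ?W"
    using 1 2 homeomorphic_imp_continuous_map[OF homf] by (intro openin_Int) (auto simp: continuous_map_def)
  moreover have "\<forall>y\<in>?W. \<psi> ((g \<circ> f) y) = plane_map (B ** A) (\<phi> y) + (plane_map B b1 + b2)"
    using 1 2 by (simp add: plane_map_mult plane_map_add)
  ultimately show "\<exists>b W. openin (regular_part S) W \<and> x \<in> W \<and> W \<subseteq> U \<and> (g \<circ> f) ` W \<subseteq> V \<and>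
           (\<forall>y\<in>W. \<psi> ((g \<circ> f) y) = plane_map (B ** A) (\<phi> y) + b)"
    using 1 2 \<open>x \<in> topspace (regular_part S)\<close>
    by (intro exI[of _ "plane_map B b1 + b2"] exI[of _ ?W] conjI) auto
qed

lemma affine_homeo_inverse:
  assumes f: "affine_homeo A S T f" and B: "B ** A = mat 1"
    and S: "translation_atlas (regular_part S) (atlas S)" and T: "translation_atlas (regular_part T) (atlas T)"
  shows "\<exists>g. affine_homeo B T S g"
proof -
  have homf: "homeomorphic_map (regular_part S) (regular_part T) f" using f by (simp add: affine_homeo_def)
  then obtain g where "homeomorphic_maps (regular_part S) (regular_part T) f g"
    by (auto simp: homeomorphic_map_maps)
  then have homg: "homeomorphic_map (regular_part T) (regular_part S) g"
    and gf: "\<And>x. x \<in> topspace (regular_part S) \<Longrightarrow> g (f x) = x"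
    and fg: "\<And>x. x \<in> topspace (regular_part T) \<Longrightarrow> f (g x) = x" by (auto simp: homeomorphic_maps_map)
  have "\<exists>b W. openin (regular_part T) W \<and> y \<in> W \<and> W \<subseteq> V \<and> g ` W \<subseteq> U \<and>
           (\<forall>y\<in>W. \<phi> (g y) = plane_map B (\<psi> y) + b)"
    if U: "(U, \<phi>) \<in> atlas S" and V: "(V, \<psi>) \<in> atlas T" and y: "y \<in> V" "g y \<in> U" for U \<phi> V \<psi> y
  proof -
    have yT: "y \<in> topspace (regular_part T)" using translation_atlasD(1)[OF T V] y openin_subset by blast
    then obtain b W where W: "openin (regular_part S) W" "g y \<in> W" "W \<subseteq> U" "f ` W \<subseteq> V"
      "\<forall>x\<in>W. \<psi> (f x) = plane_map A (\<phi> x) + b" using affine_homeoD[OF f U V y(2)] y fg by auto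
    have Ws: "W \<subseteq> topspace (regular_part S)" using W openin_subset by blast
    have "openin (regular_part T) (f ` W)" using homf W homeomorphic_map_openness[OF homf Ws] by simp
    moreover have "y \<in> f ` W" using W fg yT by force
    moreover have "g ` f ` W \<subseteq> U" using W gf Ws by force
    moreover have "\<phi> (g z) = plane_map B (\<psi> z) + (- plane_map B b)" if z: "z \<in> f ` W" for z
    proof -
      obtain x where x: "x \<in> W" "z = f x" using z by blast
      then have "plane_map B (\<psi> z) = plane_map (B ** A) (\<phi> x) + plane_map B b"
        using W by (simp add: plane_map_add plane_map_mult)
      then show ?thesis using x gf Ws B by auto
    qed
    ultimately show ?thesis using W by blast
  qed
  then show ?thesis using homg by (intro exI[of _ g]) (auto simp: affine_homeo_def)
qed

section \<open>Cone charts\<close>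

text \<open>The points near \<open>p\<close> form \<open>4k\<close> quadrants, numbered counterclockwise; the quadrant \<open>j\<close>
  lies in the square \<open>quad_square j\<close> at its point \<open>quad_corner j\<close> and consists of the directions
  with argument in \<open>[j \<pi>/2, (j + 1) \<pi>/2]\<close>.\<close>

definition in_quadrant :: "nat \<Rightarrow> complex \<Rightarrow> bool" where
  "in_quadrant j w \<longleftrightarrow> (if j mod 4 \<in> {0, 3} then Re w \<ge> 0 else Re w \<le> 0) \<and>
     (if j mod 4 \<in> {0, 1} then Im w \<ge> 0 else Im w \<le> 0)"

text \<open>Here \<open>t\<close> is the representative in the half-open square. If it lies on a
  left edge, the quadrants pointing left (1 and 2 modulo 4) belong to squares that have the point on
  their right edge; likewise for lower edges.\<close>

definition quad_corner :: "complex \<Rightarrow> nat \<Rightarrow> complex" where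
  "quad_corner t j = Complex (if Re t = 0 \<and> j mod 4 \<in> {1, 2} then 1 else Re t)
     (if Im t = 0 \<and> j mod 4 \<in> {2, 3} then 1 else Im t)"

text \<open>Treats all points of the surface alike: away from the corners a full turn leads back to
  the same square, and the cone order is 1.\<close>

definition corner_step :: "origami_data \<Rightarrow> complex \<Rightarrow> nat \<Rightarrow> nat" where
  "corner_step Q t = (if t = 0 then commutator Q else id)"

text \<open>While turning around a corner, the square obtained by \<open>edge_shift\<close> stays
  the same except from quadrant 2 to quadrant 3 modulo 4, where the commutator is applied: the
  convention at the corner (1, 1) is to go up first. This is why the exponent is
  \<open>(j + 1) div 4\<close> and not \<open>j div 4\<close>.\<close>

definition quad_square :: "origami_data \<Rightarrow> nat \<Rightarrow> complex \<Rightarrow> nat \<Rightarrow> nat" where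
  "quad_square Q i t j = inv (edge_shift Q (quad_corner t j)) ((corner_step Q t ^^ ((j + 1) div 4)) i)"

definition cone_order :: "origami_data \<Rightarrow> nat \<Rightarrow> complex \<Rightarrow> nat" where
  "cone_order Q i t = (if t = 0 then card (orbit (commutator Q) i) else 1)"

lemma mod_4_cases: obtains "j mod 4 = (0::nat)" | "j mod 4 = 1" | "j mod 4 = 2" | "j mod 4 = 3"
  by linarith

lemma Suc_div_4: "(j + 1) div 4 = (if j mod 4 = 3 then Suc (j div 4) else j div (4::nat))"
  by (auto simp: div_Suc mod_Suc)

lemma in_quadrant_Suc: "in_quadrant (Suc j) (\<i> * w) \<longleftrightarrow> in_quadrant j w"
proof -
  have "Suc j mod 4 = (if j mod 4 = 3 then 0 else Suc (j mod 4))" by (simp add: mod_Suc)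
  then show ?thesis by (cases j rule: mod_4_cases) (auto simp: in_quadrant_def)
qed

lemma in_quadrant_power: "in_quadrant j (\<i> ^ j * w) \<longleftrightarrow> 0 \<le> Re w \<and> 0 \<le> Im w"
proof (induction j)
  case (Suc j)
  then show ?case using in_quadrant_Suc[of j "\<i> ^ j * w"] by (simp add: mult.assoc)
qed (simp add: in_quadrant_def)

lemma cis_quarter: "cis (real j * pi / 2) = \<i> ^ j"
  using Complex.DeMoivre[of "pi / 2" j] by simp

lemma cis_quarter_shift: "cis a = \<i> ^ j * cis (a - real j * pi / 2)"
  by (simp flip: cis_quarter add: cis_mult)

lemma in_quadrant_cis:
  assumes "real j * pi / 2 \<le> a" "a \<le> real (j + 1) * pi / 2" "r \<ge> 0"
  shows "in_quadrant j (of_real r * cis a)"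
proof -
  let ?b = "a - real j * pi / 2"
  have b: "0 \<le> ?b" "?b \<le> pi / 2" using assms by (simp_all add: algebra_simps)
  have "of_real r * cis a = \<i> ^ j * (of_real r * cis ?b)" by (subst cis_quarter_shift[of a j]) simp
  moreover have "0 \<le> cos ?b" "0 \<le> sin ?b" using b by (auto intro!: cos_ge_zero sin_ge_zero)
  ultimately show ?thesis using assms(3) by (simp only: in_quadrant_power) simp
qed

lemma in_quadrant_polar:
  assumes "in_quadrant j w"
  shows "\<exists>a. real j * pi / 2 \<le> a \<and> a \<le> real (j + 1) * pi / 2 \<and> w = of_real (cmod w) * cis a"
proof (cases "w = 0")
  case True
  then show ?thesis by (intro exI[of _ "real j * pi / 2"]) (simp add: field_simps)
next
  case False
  define v where "v = w / \<i> ^ j"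
  have w: "w = \<i> ^ j * v" by (simp add: v_def)
  then have v: "0 \<le> Re v" "0 \<le> Im v" "v \<noteq> 0" "cmod v = cmod w"
    using assms False in_quadrant_power[of j v] by (auto simp: norm_mult norm_power)
  let ?b = "Arg v"
  have b: "0 \<le> ?b" "?b \<le> pi" using v Arg_less_0 Arg_bounded[of v] by auto
  have vb: "v = of_real (cmod v) * cis ?b" by (metis rcis_cmod_Arg rcis_def)
  have "?b \<le> pi / 2"
  proof (rule ccontr)
    assume "\<not> ?b \<le> pi / 2"
    then have "sin (?b - pi / 2) > 0" using b by (intro sin_gt_zero) auto
    then have "cos ?b < 0" by (simp add: sin_diff)
    moreover have "Re v = cmod v * cos ?b" by (subst vb) simp
    ultimately show False using v by (simp add: zero_le_mult_iff)
  qed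
  then show ?thesis using v(4) w b vb cis_quarter_shift[of "?b + real j * pi / 2" j]
    by (intro exI[of _ "?b + real j * pi / 2"]) (auto simp: algebra_simps)
qed

lemma funpow_orbit_card:
  assumes "permutation f"
  shows "(f ^^ card (orbit f x)) x = x" "card (orbit f x) > 0"
    "orbit f x = {(f ^^ m) x | m. m < card (orbit f x)}" "inj_on (\<lambda>m. (f ^^ m) x) {..<card (orbit f x)}"
proof -
  have x: "x \<in> orbit f x" by (rule permutation_self_in_orbit[OF assms])
  let ?d = "funpow_dist1 f x x"
  have o: "orbit f x = (\<lambda>m. (f ^^ m) x) ` {0..<?d}" by (rule orbit_conv_funpow_dist1[OF x])
  have i: "inj_on (\<lambda>m. (f ^^ m) x) {0..<?d}" by (rule inj_on_funpow_dist1[OF x])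
  have d: "card (orbit f x) = ?d" unfolding o card_image[OF i] by simp
  show "(f ^^ card (orbit f x)) x = x" unfolding d by (rule funpow_dist1_prop[OF x])
  show "card (orbit f x) > 0" unfolding d by simp
  show "orbit f x = {(f ^^ m) x | m. m < card (orbit f x)}" unfolding d by (subst o) auto
  show "inj_on (\<lambda>m. (f ^^ m) x) {..<card (orbit f x)}" using i unfolding d by (simp add: lessThan_atLeast0)
qed

section \<open>Quadrants around a point\<close>

locale cone_setup = square_gluing +
  fixes i0 :: nat and t :: complex
  assumes i0: "i0 < squares Q" and t: "0 \<le> Re t" "Re t < 1" "0 \<le> Im t" "Im t < 1"
begin

abbreviation "p \<equiv> glued_point Q i0 t"
abbreviation "k \<equiv> cone_order Q i0 t"
abbreviation "c \<equiv> corner_step Q t"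
abbreviation "sq \<equiv> quad_square Q i0 t"
abbreviation "cr \<equiv> quad_corner t"

lemma t_sq: "t \<in> unit_square" and torus_t: "torus_rep t = t"
  using t by (auto simp: unit_square_iff torus_rep_def complex_eq_iff)

lemma gap: "0 < boundary_gap t" "boundary_gap t \<le> 1" "Re t \<noteq> 0 \<Longrightarrow> boundary_gap t \<le> Re t"
    "boundary_gap t \<le> 1 - Re t" "Im t \<noteq> 0 \<Longrightarrow> boundary_gap t \<le> Im t" "boundary_gap t \<le> 1 - Im t"
  using boundary_gap_pos[OF t_sq] boundary_gap_le_one[OF t_sq] boundary_gap_Re[OF t_sq] boundary_gap_Re'[OF t_sq]
    boundary_gap_Im[OF t_sq] boundary_gap_Im'[OF t_sq] t by auto

lemma k_pos: "k > 0"
  using funpow_orbit_card(2)[OF permutation_commutator] by (simp add: cone_order_def)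

lemma c_power_k: "(c ^^ k) i0 = i0"
  using funpow_orbit_card(1)[OF permutation_commutator] by (simp add: cone_order_def corner_step_def)

lemma c_less: "(c ^^ m) i0 < squares Q"
  by (induction m) (auto simp: i0 corner_step_def)

lemma glued_c: "glued_point Q ((c ^^ m) i0) t = p"
  by (induction m) (use c_less in \<open>auto simp: corner_step_def glued_point_commutator\<close>)

lemma c_inj: "(c ^^ Suc m) i0 = (c ^^ Suc m') i0 \<Longrightarrow> (c ^^ m) i0 = (c ^^ m') i0"
  using permutes_inj[OF commutator_permutes] by (auto simp: corner_step_def inj_eq)

lemma cr_sq: "cr j \<in> unit_square" and torus_cr: "torus_rep (cr j) = t"
  using t by (auto simp: quad_corner_def unit_square_iff torus_rep_def complex_eq_iff)

lemma edge_shift_sq: "edge_shift Q (cr j) (sq j) = (c ^^ ((j + 1) div 4)) i0"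
  unfolding quad_square_def by (rule permutes_inverses(1)[OF edge_shift_permutes])

lemma sq_less: "sq j < squares Q"
  using edge_shift_sq[of j] c_less by (metis edge_shift_less)

lemma quadrant_center: "glued_point Q (sq j) (cr j) = p"
  using glued_point_edge_shift[OF sq_less cr_sq, of j j] by (simp only: edge_shift_sq torus_cr glued_c)

lemma quadrant_mem: "(sq j, cr j) \<in> p"
  using mem_glued_point_iff[OF i0 t_sq] sq_less cr_sq quadrant_center by simp

lemma sq_periodic: "sq (j + 4 * k) = sq j" and cr_periodic: "cr (j + 4 * k) = cr j"
proof -
  have m: "(j + 4 * k) mod 4 = j mod 4" by simp
  show cr: "cr (j + 4 * k) = cr j" unfolding quad_corner_def m ..
  have "(j + 4 * k + 1) div 4 = (j + 1) div 4 + k" by simp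
  then have "(c ^^ ((j + 4 * k + 1) div 4)) i0 = (c ^^ ((j + 1) div 4)) i0"
    by (simp only: funpow_add o_apply c_power_k)
  then show "sq (j + 4 * k) = sq j" unfolding quad_square_def cr by simp
qed

lemma quadrant_in_square:
  assumes "in_quadrant j w" "cmod w < boundary_gap t"
  shows "cr j + w \<in> unit_square"
proof -
  have "\<bar>Re w\<bar> < boundary_gap t" "\<bar>Im w\<bar> < boundary_gap t"
    using abs_Re_le_cmod[of w] abs_Im_le_cmod[of w] assms(2) by auto
  moreover have "0 \<le> Re (cr j + w) \<and> Re (cr j + w) \<le> 1" if "\<bar>Re w\<bar> < boundary_gap t"
    using that gap(2-4) assms(1) t(1,2)
    by (cases "Re t = 0"; cases j rule: mod_4_cases) (simp_all add: in_quadrant_def quad_corner_def)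
  moreover have "0 \<le> Im (cr j + w) \<and> Im (cr j + w) \<le> 1" if "\<bar>Im w\<bar> < boundary_gap t"
    using that gap(2,5,6) assms(1) t(3,4)
    by (cases "Im t = 0"; cases j rule: mod_4_cases) (simp_all add: in_quadrant_def quad_corner_def)
  ultimately show ?thesis by (simp add: unit_square_iff)
qed

text \<open>A nonzero vector in two consecutive quadrants lies on their common ray. Its direction
  depends on \<open>j\<close> modulo 4, and in each of the four cases the two squares meet along the
  edge in that direction or coincide.\<close>

lemma adjacent_quadrants:
  assumes q: "in_quadrant j w" "in_quadrant (Suc j) w" and w: "cmod w < boundary_gap t"
  shows "glued_point Q (sq j) (cr j + w) = glued_point Q (sq (Suc j)) (cr (Suc j) + w)"
proof (cases "w = 0")
  case False
  have b: "\<bar>Re w\<bar> < boundary_gap t" "\<bar>Im w\<bar> < boundary_gap t"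
    using abs_Re_le_cmod[of w] abs_Im_le_cmod[of w] w by auto
  note in_sq = quadrant_in_square[OF q(1) w] quadrant_in_square[OF q(2) w]
  have s: "Suc j mod 4 = (if j mod 4 = 3 then 0 else Suc (j mod 4))" by (simp add: mod_Suc)
  have eq: "edge_shift Q (cr j + w) (sq j) = edge_shift Q (cr (Suc j) + w) (sq (Suc j))
      \<and> torus_rep (cr j + w) = torus_rep (cr (Suc j) + w)"
  proof (cases j rule: mod_4_cases)
    case 1
    have w: "Re w = 0" "Im w > 0" using q False 1 s by (auto simp: in_quadrant_def complex_eq_iff)
    have d: "(Suc j + 1) div 4 = (j + 1) div 4" using 1 by presburger
    have "Im t + Im w < 1" using b gap(6) by linarith
    then show ?thesis using edge_shift_sq[of j] edge_shift_sq[of "Suc j"] w 1 s t unfolding d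
      by (auto simp: edge_shift_def quad_corner_def torus_rep_def)
  next
    case 2
    have w: "Re w < 0" "Im w = 0" using q False 2 s by (auto simp: in_quadrant_def complex_eq_iff)
    have d: "(Suc j + 1) div 4 = (j + 1) div 4" using 2 by presburger
    have r: "right Q a = b \<longleftrightarrow> a = inv (right Q) b" for a b by auto
    show ?thesis using edge_shift_sq[of j] edge_shift_sq[of "Suc j"] w 2 s t unfolding d
      by (cases "Re t = 0"; cases "Im t = 0") (auto simp: edge_shift_def quad_corner_def torus_rep_def r)
  next
    case 3
    have w: "Re w = 0" "Im w < 0" using q False 3 s by (auto simp: in_quadrant_def complex_eq_iff)
    have d: "(Suc j + 1) div 4 = Suc ((j + 1) div 4)" using 3 by presburger
    \<comment> \<open>The exponent of the commutator jumps only here. The jump compensates the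
      difference between the two routes to the corner (1, 1).\<close>
    have e: "edge_shift Q (cr (Suc j)) (sq (Suc j)) = c (edge_shift Q (cr j) (sq j))"
      unfolding edge_shift_sq d by simp
    show ?thesis using e w 3 s t
      by (auto simp: edge_shift_def quad_corner_def torus_rep_def corner_step_def commutator_right_up
          complex_eq_iff dest!: injD[OF permutes_inj[OF up_permutes]] split: if_splits)
  next
    case 4
    have w: "Re w > 0" "Im w = 0" using q False 4 s by (auto simp: in_quadrant_def complex_eq_iff)
    have d: "(Suc j + 1) div 4 = (j + 1) div 4" using 4 by presburger
    have "Re t + Re w < 1" using b gap(4) by linarith
    then show ?thesis using edge_shift_sq[of j] edge_shift_sq[of "Suc j"] w 4 s t unfolding d
      by (auto simp: edge_shift_def quad_corner_def torus_rep_def)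
  qed
  then show ?thesis
    using glued_point_edge_shift[OF sq_less in_sq(1)] glued_point_edge_shift[OF sq_less in_sq(2)] by simp
qed (simp add: quadrant_center)

lemma quadrants_cover:
  assumes iz: "(i, z) \<in> p" and zw: "z + w \<in> unit_square" and w: "cmod w < boundary_gap t"
  shows "\<exists>j<4 * k. in_quadrant j w \<and> sq j = i \<and> cr j = z"
proof -
  have iz': "i < squares Q" "z \<in> unit_square" "glued_point Q i z = p"
    using iz mem_glued_point_iff[OF i0 t_sq] by simp_all
  then have z: "i < squares Q" "z \<in> unit_square" "torus_rep z = t" "normal_form Q i z = normal_form Q i0 t"
    using torus_rep_eq_if_glued[OF i0 t_sq iz] torus_t glued_point_eq_iff[OF iz'(1,2) i0 t_sq] by simp_all
  have e0: "edge_shift Q t i0 = i0" using t by (simp add: edge_shift_def)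
  \<comment> \<open>\<open>a\<close> and \<open>b\<close> say whether the quadrant points left and
    down. If the centre is on an edge, this is read off from the side on which \<open>z\<close>
    lies, otherwise from the sign of \<open>w\<close>; \<open>q\<close> is the quadrant number
    modulo 4.\<close>
  define a b where "a \<longleftrightarrow> (if Re t = 0 then Re z = 1 else Re w < 0)"
    and "b \<longleftrightarrow> (if Im t = 0 then Im z = 1 else Im w < 0)"
  have zt: "Re z = (if Re t = 0 \<and> a then 1 else Re t)" "Im z = (if Im t = 0 \<and> b then 1 else Im t)"
    using z(3) t by (auto simp: a_def b_def torus_rep_def split: if_splits)
  have sg: "if a then Re w \<le> 0 else 0 \<le> Re w" "if b then Im w \<le> 0 else 0 \<le> Im w"
    using zw zt unfolding a_def b_def by (auto simp: unit_square_iff split: if_splits)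
  define q :: nat where "q = (if a then (if b then 2 else 1) else (if b then 3 else 0))"
  have q: "q < 4" by (simp add: q_def)
  have inq: "in_quadrant j w" "cr j = z" if "j mod 4 = q" for j
    using that sg zt by (auto simp: in_quadrant_def quad_corner_def q_def complex_eq_iff split: if_splits)
  have sqj: "sq j = i" if "cr j = z" "(c ^^ ((j + 1) div 4)) i0 = edge_shift Q z i" for j
    using that inj_edge_shift[of z] by (simp add: quad_square_def inv_f_f)
  obtain m where m: "m < k" "(c ^^ m) i0 = edge_shift Q z i"
  proof (cases "t = 0")
    case True
    then have "edge_shift Q z i \<in> orbit (commutator Q) i0"
      using z(3,4) torus_t e0 orbit_eq_iff by (simp add: normal_form_def)
    then obtain m where "m < card (orbit (commutator Q) i0)" "(commutator Q ^^ m) i0 = edge_shift Q z i"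
      using funpow_orbit_card(3)[OF permutation_commutator, of i0] by (smt (verit) mem_Collect_eq)
    then show thesis using that[of m] True by (simp add: cone_order_def corner_step_def)
  next
    case False
    then have "edge_shift Q z i = i0" using z(3,4) torus_t e0 by (simp add: normal_form_def)
    then show thesis using that[of 0] k_pos by simp
  qed
  show ?thesis
  proof (cases "q = 3")
    case True
    \<comment> \<open>Quadrants congruent to 3 already carry the next power of the commutator, so
      the index is lowered by one, cyclically modulo \<open>k\<close>.\<close>
    define m' where "m' = (if m = 0 then k - 1 else m - 1)"
    have e: "m' + 1 = (if m = 0 then k else m)" using k_pos by (simp add: m'_def)
    have m': "m' < k" "(c ^^ (m' + 1)) i0 = edge_shift Q z i"
      using m k_pos c_power_k unfolding e by (auto simp: m'_def)
    have "(4 * m' + 3) mod 4 = q" "(4 * m' + 3 + 1) div 4 = m' + 1" using True by simp_all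
    then show ?thesis using m' inq[of "4 * m' + 3"] sqj[of "4 * m' + 3"] by (intro exI[of _ "4 * m' + 3"]) simp
  next
    case False
    then have "(4 * m + q) mod 4 = q" "(4 * m + q + 1) div 4 = m" using q by simp_all
    then show ?thesis using m q inq[of "4 * m + q"] sqj[of "4 * m + q"] by (intro exI[of _ "4 * m + q"]) simp
  qed
qed

text \<open>Half-open quadrants, without the terminal ray, so that a nonzero vector determines its
  quadrant modulo 4.\<close>

definition strict_quadrant :: "nat \<Rightarrow> complex \<Rightarrow> bool" where
  "strict_quadrant j w \<longleftrightarrow> in_quadrant j w \<and> w \<noteq> 0 \<and> \<not> in_quadrant (Suc j) w"

lemma strict_quadrant_mod:
  assumes "strict_quadrant j w" "strict_quadrant l w"
  shows "j mod 4 = l mod 4"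
proof -
  have s: "Suc j mod 4 = (if j mod 4 = 3 then 0 else Suc (j mod 4))" for j by (simp add: mod_Suc)
  show ?thesis using assms
    by (cases j rule: mod_4_cases; cases l rule: mod_4_cases)
      (auto simp: strict_quadrant_def in_quadrant_def s complex_eq_iff)
qed

text \<open>The direction determines the quadrant modulo 4, which is enough when the cone order is
  1. At a corner, a short nonzero displacement never reaches another corner, so the normal form
  recovers the square and with it a power of the commutator applied to \<open>i0\<close>; below the
  orbit length these powers are distinct.\<close>

lemma quadrants_disjoint:
  assumes j: "j < 4 * k" "l < 4 * k" and q: "strict_quadrant j w" "strict_quadrant l w"
    and w: "cmod w < boundary_gap t"
    and eq: "glued_point Q (sq j) (cr j + w) = glued_point Q (sq l) (cr l + w)"
  shows "j = l"
proof (cases "t = 0")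
  case False
  then show ?thesis using j strict_quadrant_mod[OF q] by (simp add: cone_order_def)
next
  case True
  have m: "j mod 4 = l mod 4" by (rule strict_quadrant_mod[OF q])
  have iq: "in_quadrant j w" "in_quadrant l w" "w \<noteq> 0" using q by (auto simp: strict_quadrant_def)
  have cr: "cr j = cr l" using m by (simp add: quad_corner_def)
  let ?v = "cr j + w"
  have v: "?v \<in> unit_square" by (rule quadrant_in_square[OF iq(1) w])
  have b: "\<bar>Re w\<bar> < 1" "\<bar>Im w\<bar> < 1"
    using abs_Re_le_cmod[of w] abs_Im_le_cmod[of w] w gap(2) by auto
  have "torus_rep ?v \<noteq> 0"
  proof
    assume "torus_rep ?v = 0"
    then have "Re ?v \<in> {0, 1}" "Im ?v \<in> {0, 1}" by (auto simp: torus_rep_def complex_eq_iff split: if_splits)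
    moreover have "Re (cr j) \<in> {0, 1}" "Im (cr j) \<in> {0, 1}" by (auto simp: quad_corner_def True)
    ultimately have "Re w = 0" "Im w = 0" using b by auto
    then show False using iq(3) by (simp add: complex_eq_iff)
  qed
  moreover have "normal_form Q (sq j) ?v = normal_form Q (sq l) ?v"
    using eq glued_point_eq_iff[OF sq_less v sq_less v, of j l] cr by simp
  ultimately have "edge_shift Q ?v (sq j) = edge_shift Q ?v (sq l)" by (simp add: normal_form_def)
  then have "sq j = sq l" using inj_edge_shift by (auto dest: injD)
  then have e: "(c ^^ ((j + 1) div 4)) i0 = (c ^^ ((l + 1) div 4)) i0"
    using edge_shift_sq[of j] edge_shift_sq[of l] cr by simp
  have eq': "(c ^^ (j div 4)) i0 = (c ^^ (l div 4)) i0"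
  proof (cases "j mod 4 = 3")
    case True
    then have "l mod 4 = 3" using m by (simp only:)
    have "(j + 1) div 4 = Suc (j div 4)" by (subst Suc_div_4) (simp add: True)
    moreover have "(l + 1) div 4 = Suc (l div 4)" by (subst Suc_div_4) (simp add: \<open>l mod 4 = 3\<close>)
    ultimately have "(c ^^ Suc (j div 4)) i0 = (c ^^ Suc (l div 4)) i0" using e by (simp only:)
    then show ?thesis by (rule c_inj)
  next
    case False
    then have "l mod 4 \<noteq> 3" using m by (simp only: not_False_eq_True)
    have "(j + 1) div 4 = j div 4" by (subst Suc_div_4) (simp add: False)
    moreover have "(l + 1) div 4 = l div 4" by (subst Suc_div_4) (simp add: \<open>l mod 4 \<noteq> 3\<close>)
    ultimately show ?thesis using e by (simp only:)
  qed
  have inj: "inj_on (\<lambda>m. (c ^^ m) i0) {..<k}"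
    using funpow_orbit_card(4)[OF permutation_commutator, of i0] True
    by (simp add: cone_order_def corner_step_def)
  have "j div 4 = l div 4" by (rule inj_onD[OF inj eq']) (use j in auto)
  then have "4 * (j div 4) + j mod 4 = 4 * (l div 4) + l mod 4" using m by (simp only:)
  then show ?thesis by (simp only: mult_div_mod_eq)
qed

end

lemma torus_rep_eq_imp:
  assumes "torus_rep v = torus_rep w"
  shows "Re v - Re w \<in> {-1, 0, 1}" "Im v - Im w \<in> {-1, 0, 1}"
  using assms by (auto simp: torus_rep_def split: if_splits)

text \<open>The difference \<open>x - y\<close> is an integer of modulus less than 1. In the
  application \<open>a\<close> and \<open>b\<close> are coordinates of two representatives of one
  point, \<open>x\<close> and \<open>y\<close> small displacements from them.\<close>

lemma half_unit_cancel:
  assumes "(a + x) - (b + y) \<in> {-1, 0, 1::real}" "a - b \<in> {-1, 0, 1}" "\<bar>x\<bar> < 1 / 2" "\<bar>y\<bar> < 1 / 2"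
  shows "x = y"
  using assms by (elim insertE emptyE) linarith+

lemma cis_quarter_inj:
  assumes "cis a = cis b" "0 \<le> a" "a < pi / 2" "0 \<le> b" "b < pi / 2"
  shows "a = b"
  using assms cos_inj_pi[of a b] by (simp add: complex_eq_iff)

section \<open>Sectors of the disc and the cone chart\<close>

context cone_setup
begin

text \<open>Taking \<open>k\<close>-th powers multiplies arguments by \<open>k\<close>, so that
  \<open>4 * k\<close> sectors of angle \<open>pi / (2 * k)\<close> are laid onto the
  \<open>4 * k\<close> quadrants around \<open>p\<close>.\<close>

definition sector :: "nat \<Rightarrow> complex set" where
  "sector j = {of_real r * cis a | r a. 0 \<le> r \<and> r \<le> 1 \<and>
     real j * pi / (2 * real k) \<le> a \<and> a \<le> real (j + 1) * pi / (2 * real k)}"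

definition sector_map :: "nat \<Rightarrow> complex \<Rightarrow> (nat \<times> complex) set" where
  "sector_map j x = glued_point Q (sq j) (cr j + x ^ k)"

lemma closed_sector: "closed (sector j)"
proof -
  have "sector j = (\<lambda>(r, a). of_real r * cis a) `
      ({0..1} \<times> {real j * pi / (2 * real k)..real (j + 1) * pi / (2 * real k)})"
    unfolding sector_def by force
  moreover have "compact \<dots>"
    by (intro compact_continuous_image compact_Times compact_Icc)
      (auto simp: case_prod_unfold cis_conv_exp intro!: continuous_intros)
  ultimately show ?thesis using compact_imp_closed by metis
qed

lemma sector_power:
  assumes "x \<in> sector j"
  shows "in_quadrant j (x ^ k)"
proof -
  obtain r a where x: "x = of_real r * cis a" "0 \<le> r" "real j * pi / (2 * real k) \<le> a"
    "a \<le> real (j + 1) * pi / (2 * real k)" using assms unfolding sector_def by blast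
  have "x ^ k = of_real (r ^ k) * cis (real k * a)" by (simp add: x power_mult_distrib Complex.DeMoivre)
  moreover have "real j * pi / 2 \<le> real k * a" "real k * a \<le> real (j + 1) * pi / 2"
    using x k_pos by (simp_all add: field_simps)
  ultimately show ?thesis using x by (simp only: in_quadrant_cis zero_le_power)
qed

lemma sector_map_center: "sector_map j 0 = p"
  using k_pos by (simp add: sector_map_def quadrant_center zero_power)

lemma sector_of_quadrant:
  assumes "in_quadrant j w" "cmod w < 1"
  shows "\<exists>x\<in>sector j. x ^ k = w \<and> cmod x ^ k = cmod w"
proof -
  obtain b where b: "real j * pi / 2 \<le> b" "b \<le> real (j + 1) * pi / 2" "w = of_real (cmod w) * cis b"
    using in_quadrant_polar[OF assms(1)] by blast
  define r where "r = root k (cmod w)"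
  have r: "r ^ k = cmod w" "0 \<le> r" "r \<le> 1"
    using k_pos assms(2) by (auto simp: r_def real_root_pow_pos2 real_root_le_1_iff)
  let ?x = "of_real r * cis (b / real k)"
  have "?x \<in> sector j"
    unfolding sector_def using r b k_pos
    by (intro CollectI, rule_tac exI[of _ r], rule_tac exI[of _ "b / real k"]) (simp add: field_simps)
  moreover have "?x ^ k = of_real (r ^ k) * cis b"
    using k_pos by (simp add: power_mult_distrib Complex.DeMoivre)
  moreover have "cmod ?x ^ k = cmod w" using r by (simp add: norm_mult)
  ultimately show ?thesis using b(3) r(1) by (intro bexI[of _ ?x]) auto
qed

text \<open>The argument in \<open>[0, 2 * pi)\<close> selects the sector \<open>l\<close>. Any
  other sector that contains \<open>x\<close> has it on its terminal ray, where the map agrees with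
  that of the following sector.\<close>

lemma sector_canonical:
  assumes "x \<noteq> 0"
  shows "\<exists>l<4 * k. \<exists>a. real l * pi / (2 * real k) \<le> a \<and> a < real (l + 1) * pi / (2 * real k) \<and>
    x = of_real (cmod x) * cis a \<and> strict_quadrant l (x ^ k) \<and>
    (cmod x \<le> 1 \<longrightarrow> x \<in> sector l) \<and>
    (\<forall>j<4 * k. x \<in> sector j \<longrightarrow> cmod (x ^ k) < boundary_gap t \<longrightarrow> sector_map j x = sector_map l x)"
proof -
  define a where "a = Arg2pi x"
  define l where "l = nat \<lfloor>2 * real k * a / pi\<rfloor>"
  have a: "0 \<le> a" "a < 2 * pi" "x = of_real (cmod x) * cis a"
    using Arg2pi[of x] by (auto simp: a_def is_Arg_def cis_conv_exp)
  have l: "real l \<le> 2 * real k * a / pi" "2 * real k * a / pi < real (l + 1)"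
  proof -
    have "real l = of_int \<lfloor>2 * real k * a / pi\<rfloor>" using a by (simp add: l_def)
    then show "real l \<le> 2 * real k * a / pi" "2 * real k * a / pi < real (l + 1)" by linarith+
  qed
  have la: "real l * pi / (2 * real k) \<le> a" "a < real (l + 1) * pi / (2 * real k)"
    using l k_pos by (simp_all add: field_simps)
  have "2 * real k * a / pi < 4 * real k" using a k_pos by (simp add: field_simps)
  then have "real l < real (4 * k)" using l by simp
  then have l4: "l < 4 * k" by (simp only: of_nat_less_iff)
  have xk: "x ^ k = of_real (cmod x ^ k) * cis (real k * a)"
    by (subst a(3)) (simp add: power_mult_distrib Complex.DeMoivre)
  have ka: "real l * pi / 2 \<le> real k * a" "real k * a < real (l + 1) * pi / 2"
    using la k_pos by (simp_all add: field_simps)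
  have strict: "strict_quadrant l (x ^ k)"
  proof -
    let ?b = "real k * a - real l * pi / 2"
    let ?v = "of_real (cmod x ^ k) * cis ?b"
    have b: "0 \<le> ?b" "?b < pi / 2" using ka by (simp_all add: algebra_simps)
    have v: "x ^ k = \<i> ^ l * ?v" unfolding xk by (subst cis_quarter_shift[of _ l]) simp
    have "cos ?b > 0" "sin ?b \<ge> 0" using b by (auto intro!: cos_gt_zero_pi sin_ge_zero)
    then have "Re ?v > 0" "Im ?v \<ge> 0" using assms by simp_all
    \<comment> \<open>Turned back by \<open>Suc l\<close> quarter turns the vector becomes
      \<open>- \<i> * ?v\<close>, whose imaginary part is minus the positive real part of
      \<open>?v\<close>.\<close>
    moreover have "\<not> in_quadrant (Suc l) (\<i> ^ l * ?v)"
    proof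
      assume "in_quadrant (Suc l) (\<i> ^ l * ?v)"
      moreover have "\<i> ^ Suc l * (- \<i> * ?v) = \<i> ^ l * (\<i> * (- \<i> * ?v))"
        by (simp only: power_Suc2 mult.assoc)
      moreover have "\<i> * (- \<i> * ?v) = ?v" by (simp add: complex_eq_iff)
      ultimately have "in_quadrant (Suc l) (\<i> ^ Suc l * (- \<i> * ?v))" by (simp only:)
      then have "0 \<le> Im (- \<i> * ?v)" by (simp only: in_quadrant_power)
      then show False using \<open>Re ?v > 0\<close> by simp
    qed
    ultimately show ?thesis unfolding strict_quadrant_def using assms v in_quadrant_power[of l ?v] by auto
  qed
  have "sector_map j x = sector_map l x" if j: "j < 4 * k" "x \<in> sector j" "cmod (x ^ k) < boundary_gap t" for j
  proof -
    obtain r b where b: "x = of_real r * cis b" "0 \<le> r" "real j * pi / (2 * real k) \<le> b"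
      "b \<le> real (j + 1) * pi / (2 * real k)" using j unfolding sector_def by blast
    have "r \<noteq> 0" using b(1) assms by auto
    moreover have "0 \<le> real j * pi / (2 * real k)" by simp
    ultimately have r: "r > 0" "0 \<le> b" using b(2,3) by linarith+
    have jl: "j' = l" if "real j' * pi / (2 * real k) \<le> a" "a < real (j' + 1) * pi / (2 * real k)" for j'
    proof -
      have "real j' < real (l + 1)" "real l < real (j' + 1)"
        using that la k_pos by (smt (verit) divide_less_cancel mult_less_cancel_right pi_gt_zero of_nat_0_less_iff)+
      then show ?thesis by linarith
    qed
    show ?thesis
    proof (cases "b < real (j + 1) * pi / (2 * real k)")
      case True
      have "real (j + 1) * pi / (2 * real k) \<le> real (4 * k) * pi / (2 * real k)"
        using j k_pos by (intro divide_right_mono mult_right_mono) (simp_all only: of_nat_le_iff, auto)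
      also have "\<dots> = 2 * pi" using k_pos by simp
      finally have "b < 2 * pi" using True by simp
      then have "a = b" unfolding a_def using b r by (intro Arg2pi_unique[of r]) (auto simp: cis_conv_exp)
      then show ?thesis using jl[of j] b True by simp
    next
      case False
      then have b': "b = real (Suc j) * pi / (2 * real k)" using b by simp
      have Sj: "x ^ k = of_real (r ^ k) * cis (real (Suc j) * pi / 2)"
        using k_pos by (simp add: b(1) b' power_mult_distrib Complex.DeMoivre)
      have iq: "in_quadrant (Suc j) (x ^ k)" unfolding Sj using r(1)
        by (intro in_quadrant_cis) (auto simp: field_simps)
      have ad: "sector_map j x = sector_map (Suc j) x"
        unfolding sector_map_def by (rule adjacent_quadrants[OF sector_power[OF j(2)] iq j(3)])
      \<comment> \<open>The terminal ray of the last sector is the positive real axis, where the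
        selected argument is 0 and not \<open>2 * pi\<close>; periodicity of the quadrants closes
        the circle.\<close>
      show ?thesis
      proof (cases "Suc j = 4 * k")
        case True
        then have "b = 2 * pi" using b' k_pos by simp
        then have "x = of_real r" using b by simp
        then have "a = 0" unfolding a_def using r by (simp add: Arg2pi_of_real)
        then have "0 = l" using k_pos by (intro jl) auto
        moreover have "sector_map (Suc j) x = sector_map 0 x"
          using sq_periodic[of 0] cr_periodic[of 0] by (simp add: sector_map_def True)
        ultimately show ?thesis using ad by simp
      next
        case False
        then have "real (Suc j) < real (4 * k)" using j by linarith
        then have "real (Suc j) * pi < real (4 * k) * pi" by (rule mult_strict_right_mono) simp
        then have "b < 2 * pi" unfolding b' using k_pos by (simp add: pos_divide_less_eq algebra_simps)
        then have "a = b" unfolding a_def using b r by (intro Arg2pi_unique[of r]) (auto simp: cis_conv_exp)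
        then have "Suc j = l" using k_pos b' by (intro jl) (simp_all add: field_simps)
        then show ?thesis using ad by simp
      qed
    qed
  qed
  moreover have "x \<in> sector l" if "cmod x \<le> 1"
    unfolding sector_def using a(3) la that by (intro CollectI exI[of _ "cmod x"] exI[of _ a]) auto
  ultimately show ?thesis using l4 la a(3) strict by blast
qed

text \<open>The sector maps agree on overlaps and are pasted along finitely many closed sectors. For
  injectivity, equal images have the same torus point, so the \<open>k\<close>-th powers agree
  because displacements below 1/2 are determined by it; then the sectors agree by
  \<open>quadrants_disjoint\<close>, and finally the arguments.\<close>

lemma cone_parametrization:
  assumes e: "0 < e" "e < 1 / 2" "e < boundary_gap t"
  shows "\<exists>\<Theta>. continuous_map (top_of_set (cball 0 e)) (glued_surface Q) \<Theta> \<and> inj_on \<Theta> (cball 0 e) \<and>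
    (\<forall>x\<in>cball 0 e. \<forall>j<4 * k. x \<in> sector j \<longrightarrow> \<Theta> x = sector_map j x)"
proof -
  have small: "cmod (x ^ k) < boundary_gap t" "cmod (x ^ k) < 1 / 2" "cmod x \<le> 1" if "x \<in> cball 0 e" for x
  proof -
    have "cmod x ^ k \<le> cmod x ^ 1" using that e k_pos by (intro power_decreasing) auto
    then show "cmod (x ^ k) < boundary_gap t" "cmod (x ^ k) < 1 / 2" using that e by (auto simp: norm_power)
    show "cmod x \<le> 1" using that e by simp
  qed
  have in_sq: "cr j + x ^ k \<in> unit_square" if "x \<in> cball 0 e" "x \<in> sector j" for x j
    using quadrant_in_square[OF sector_power[OF that(2)] small(1)[OF that(1)]] .
  obtain \<Theta> where cont: "continuous_map (top_of_set (cball 0 e)) (glued_surface Q) \<Theta>"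
    and \<Theta>: "\<And>x j. j \<in> {..<4 * k} \<Longrightarrow> x \<in> topspace (top_of_set (cball 0 e)) \<inter> sector j \<Longrightarrow> \<Theta> x = sector_map j x"
  proof (rule pasting_lemma_exists_closed[of "{..<4 * k}" "top_of_set (cball 0 e)" "\<lambda>j. cball 0 e \<inter> sector j"
        "glued_surface Q" sector_map])
    show "topspace (top_of_set (cball 0 e)) \<subseteq> (\<Union>j<4 * k. cball 0 e \<inter> sector j)"
    proof
      fix x :: complex assume "x \<in> topspace (top_of_set (cball 0 e))"
      then have x: "x \<in> cball 0 e" by simp
      show "x \<in> (\<Union>j<4 * k. cball 0 e \<inter> sector j)"
      proof (cases "x = 0")
        case True
        have "0 \<in> sector 0" unfolding sector_def by (force simp: k_pos)
        then show ?thesis using True x k_pos by force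
      next
        case False
        then show ?thesis using sector_canonical[OF False] small(3)[OF x] x by blast
      qed
    qed
    show "closedin (top_of_set (cball 0 e)) (cball 0 e \<inter> sector j)" for j
      using closed_sector by (simp add: closedin_closed_Int)
    show "continuous_map (subtopology (top_of_set (cball 0 e)) (cball 0 e \<inter> sector j)) (glued_surface Q) (sector_map j)" for j
    proof -
      have "continuous_map (top_of_set (cball 0 e \<inter> sector j)) (top_of_set unit_square) (\<lambda>x. cr j + x ^ k)"
        using in_sq by (auto intro!: continuous_intros)
      then have "continuous_map (top_of_set (cball 0 e \<inter> sector j)) (glued_surface Q)
          (glued_point Q (sq j) \<circ> (\<lambda>x. cr j + x ^ k))"
        by (rule continuous_map_compose[OF _ continuous_map_glued_point[OF sq_less]])
      then show ?thesis by (simp add: subtopology_subtopology sector_map_def[abs_def] o_def)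
    qed
    show "sector_map i x = sector_map j x" if "i \<in> {..<4 * k}" "j \<in> {..<4 * k}"
      "x \<in> topspace (top_of_set (cball 0 e)) \<inter> (cball 0 e \<inter> sector i) \<inter> (cball 0 e \<inter> sector j)" for i j x
    proof (cases "x = 0")
      case False
      have x: "x \<in> cball 0 e" "x \<in> sector i" "x \<in> sector j" "i < 4 * k" "j < 4 * k" using that by auto
      obtain l where "\<And>j. j < 4 * k \<Longrightarrow> x \<in> sector j \<Longrightarrow> sector_map j x = sector_map l x"
        using sector_canonical[OF False] small(1)[OF x(1)] by blast
      then show ?thesis using x by metis
    qed (simp add: sector_map_center)
  qed (use that in \<open>auto\<close>)
  have "inj_on \<Theta> (cball 0 e)"
  proof (rule inj_onI)
    fix x y assume xy: "x \<in> cball 0 e" "y \<in> cball 0 e" "\<Theta> x = \<Theta> y"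
    have loc: "\<exists>j<4 * k. \<Theta> v = glued_point Q (sq j) (cr j + v ^ k) \<and> cr j + v ^ k \<in> unit_square \<and>
       (v \<noteq> 0 \<longrightarrow> strict_quadrant j (v ^ k) \<and>
         (\<exists>a. real j * pi / (2 * real k) \<le> a \<and> a < real (j + 1) * pi / (2 * real k) \<and>
         v = of_real (cmod v) * cis a))" if v: "v \<in> cball 0 e" for v
    proof (cases "v = 0")
      case True
      have "0 \<in> sector 0" unfolding sector_def by (force simp: k_pos)
      then show ?thesis using \<Theta>[of 0 v] True k_pos v in_sq[OF v, of 0]
        by (intro exI[of _ 0]) (auto simp: sector_map_def)
    next
      case False
      obtain j a where j: "j < 4 * k" "real j * pi / (2 * real k) \<le> a" "a < real (j + 1) * pi / (2 * real k)"
        "v = of_real (cmod v) * cis a" "strict_quadrant j (v ^ k)" "v \<in> sector j"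
        using sector_canonical[OF False] small(3)[OF v] by blast
      then have "\<Theta> v = glued_point Q (sq j) (cr j + v ^ k)"
        using \<Theta>[of j v] v by (simp add: sector_map_def)
      then show ?thesis using j in_sq[OF v j(6)] by blast
    qed
    obtain j where j: "j < 4 * k" "\<Theta> x = glued_point Q (sq j) (cr j + x ^ k)" "cr j + x ^ k \<in> unit_square"
      "x \<noteq> 0 \<Longrightarrow> strict_quadrant j (x ^ k)"
      "x \<noteq> 0 \<Longrightarrow> \<exists>a. real j * pi / (2 * real k) \<le> a \<and> a < real (j + 1) * pi / (2 * real k) \<and>
         x = of_real (cmod x) * cis a" using loc[OF xy(1)] by blast
    obtain l where l: "l < 4 * k" "\<Theta> y = glued_point Q (sq l) (cr l + y ^ k)" "cr l + y ^ k \<in> unit_square"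
      "y \<noteq> 0 \<Longrightarrow> strict_quadrant l (y ^ k)"
      "y \<noteq> 0 \<Longrightarrow> \<exists>a. real l * pi / (2 * real k) \<le> a \<and> a < real (l + 1) * pi / (2 * real k) \<and>
         y = of_real (cmod y) * cis a" using loc[OF xy(2)] by blast
    have tr: "torus_rep (cr j + x ^ k) = torus_rep (cr l + y ^ k)" "torus_rep (cr j) = torus_rep (cr l)"
      using xy(3) j l glued_point_eq_iff[OF sq_less j(3) sq_less l(3)] by (simp_all add: normal_form_def torus_cr)
    have b: "\<bar>Re (x ^ k)\<bar> < 1 / 2" "\<bar>Im (x ^ k)\<bar> < 1 / 2" "\<bar>Re (y ^ k)\<bar> < 1 / 2" "\<bar>Im (y ^ k)\<bar> < 1 / 2"
      using small(2)[OF xy(1)] small(2)[OF xy(2)] abs_Re_le_cmod abs_Im_le_cmod by (meson order_le_less_trans)+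
    have "Re (x ^ k) = Re (y ^ k)" "Im (x ^ k) = Im (y ^ k)"
      by (rule half_unit_cancel[OF torus_rep_eq_imp(1)[OF tr(1), unfolded plus_complex.sel] torus_rep_eq_imp(1)[OF tr(2)] b(1,3)],
          rule half_unit_cancel[OF torus_rep_eq_imp(2)[OF tr(1), unfolded plus_complex.sel] torus_rep_eq_imp(2)[OF tr(2)] b(2,4)])
    then have pw: "x ^ k = y ^ k" by (simp add: complex_eq_iff)
    show "x = y"
    proof (cases "x = 0")
      case True
      then show ?thesis using pw k_pos by (simp add: zero_power)
    next
      case False
      then have y0: "y \<noteq> 0" using pw k_pos by (auto simp: zero_power)
      have "j = l" using quadrants_disjoint[OF j(1) l(1), of "x ^ k"] j l False y0 pw xy(3) small(1)[OF xy(1)] by simp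
      obtain a where a: "real j * pi / (2 * real k) \<le> a" "a < real (j + 1) * pi / (2 * real k)"
         "x = of_real (cmod x) * cis a" using j False by blast
      obtain b where b: "real j * pi / (2 * real k) \<le> b" "b < real (j + 1) * pi / (2 * real k)"
         "y = of_real (cmod y) * cis b" using l y0 \<open>j = l\<close> by blast
      have "cmod x ^ k = cmod y ^ k" using pw by (metis norm_power)
      then have n: "cmod x = cmod y" using power_eq_iff_eq_base[OF k_pos, of "cmod x" "cmod y"] by simp
      have "of_real (cmod x ^ k) * cis (real k * a) = x ^ k"
        by (subst (2) a(3)) (simp add: power_mult_distrib Complex.DeMoivre)
      also have "\<dots> = y ^ k" by (rule pw)
      also have "\<dots> = of_real (cmod y ^ k) * cis (real k * b)"
        by (subst b(3)) (simp add: power_mult_distrib Complex.DeMoivre)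
      finally have c: "cis (real k * a) = cis (real k * b)" using n False y0 by simp
      have "cis (real k * a - real j * pi / 2) = cis (real k * b - real j * pi / 2)"
        using c by (simp flip: cis_divide)
      moreover have "0 \<le> real k * a - real j * pi / 2" "real k * a - real j * pi / 2 < pi / 2"
        "0 \<le> real k * b - real j * pi / 2" "real k * b - real j * pi / 2 < pi / 2"
        using a b k_pos by (simp_all add: field_simps)
      ultimately have "real k * a - real j * pi / 2 = real k * b - real j * pi / 2"
        by (intro cis_quarter_inj) auto
      then have "a = b" using k_pos by simp
      then show ?thesis using a b n by metis
    qed
  qed
  then show ?thesis using cont \<Theta> by (intro exI[of _ \<Theta>]) auto
qed

text \<open>The inverse of the parametrization; the \<open>k\<close>-th power turns the disc of
  radius \<open>\<rho>\<close> into the star of radius \<open>\<rho> ^ k\<close>. This one chart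
  yields local planarity everywhere, a translation chart at points with \<open>k = 1\<close>, and
  the cone chart at singularities.\<close>

theorem cone_chart:
  "\<exists>\<rho>>0. \<exists>\<Psi>. \<rho> ^ k \<le> boundary_gap t \<and>
    homeomorphic_map (subtopology (glued_surface Q) (star Q p (\<rho> ^ k))) (top_of_set (ball 0 \<rho>)) \<Psi> \<and>
    \<Psi> p = (0::complex) \<and>
    (\<forall>(i, z)\<in>p. \<forall>w\<in>unit_square. dist w z < \<rho> ^ k \<longrightarrow> \<Psi> (glued_point Q i w) ^ k = w - z)"
proof -
  define e where "e = min (1 / 4) (boundary_gap t / 2)"
  have e: "0 < e" "e < 1 / 2" "e < boundary_gap t" using gap(1) by (auto simp: e_def)
  have ek: "e ^ k \<le> e"
    using power_decreasing[of 1 k e] e k_pos by simp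
  obtain \<Theta> where \<Theta>: "continuous_map (top_of_set (cball 0 e)) (glued_surface Q) \<Theta>" "inj_on \<Theta> (cball 0 e)"
    "\<And>x j. x \<in> cball 0 e \<Longrightarrow> j < 4 * k \<Longrightarrow> x \<in> sector j \<Longrightarrow> \<Theta> x = sector_map j x"
    using cone_parametrization[OF e] by blast
  have 0: "0 \<in> sector 0" unfolding sector_def by (force simp: k_pos)
  then have \<Theta>0: "\<Theta> 0 = p" using \<Theta>(3)[of 0 0] e k_pos by (simp add: sector_map_center)
  have lift: "\<exists>x\<in>ball 0 e. \<Theta> x = glued_point Q i w \<and> x ^ k = w - z"
    if iz: "(i, z) \<in> p" and w: "w \<in> unit_square" "dist w z < e ^ k" for i z w
  proof -
    have d: "cmod (w - z) < e ^ k" using w by (simp add: dist_norm)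
    then obtain j where j: "j < 4 * k" "in_quadrant j (w - z)" "sq j = i" "cr j = z"
      using quadrants_cover[OF iz, of "w - z"] w ek e by auto
    obtain x where x: "x \<in> sector j" "x ^ k = w - z" "cmod x ^ k = cmod (w - z)"
      using sector_of_quadrant[OF j(2)] d ek e by auto
    have "cmod x < e" using x(3) d e power_less_imp_less_base[of "cmod x" k e] by simp
    then show ?thesis using \<Theta>(3)[of x j] j x by (intro bexI[of _ x]) (auto simp: sector_map_def)
  qed
  have image: "\<Theta> ` ball 0 e = star Q p (e ^ k)"
  proof
    show "\<Theta> ` ball 0 e \<subseteq> star Q p (e ^ k)"
    proof
      fix y assume "y \<in> \<Theta> ` ball 0 e"
      then obtain x where x: "x \<in> ball 0 e" "y = \<Theta> x" by blast
      have "\<exists>j<4 * k. x \<in> sector j"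
      proof (cases "x = 0")
        case True
        then show ?thesis using 0 k_pos by (intro exI[of _ 0]) simp
      next
        case False
        then show ?thesis using sector_canonical[OF False] x e by auto
      qed
      then obtain j where j: "j < 4 * k" "x \<in> sector j" by blast
      then have y: "y = glued_point Q (sq j) (cr j + x ^ k)" using \<Theta>(3)[of x j] x by (simp add: sector_map_def)
      have "cmod x ^ k < e ^ k" using x k_pos by (intro power_strict_mono) auto
      then have n: "cmod (x ^ k) < e ^ k" by (simp add: norm_power)
      then have "cr j + x ^ k \<in> unit_square" using ek e by (intro quadrant_in_square sector_power j) simp
      then show "y \<in> star Q p (e ^ k)" unfolding star_def y using quadrant_mem[of j] n
        by (intro CollectI, rule_tac exI[of _ "sq j"], rule_tac exI[of _ "cr j"], rule_tac exI[of _ "cr j + x ^ k"])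
          (simp add: dist_norm)
    qed
    show "star Q p (e ^ k) \<subseteq> \<Theta> ` ball 0 e"
      unfolding star_def using lift by (auto, metis imageI)
  qed
  \<comment> \<open>Compactness of the closed ball makes the continuous injection a homeomorphism
    onto its image; the open ball follows by restriction.\<close>
  have hom: "homeomorphic_map (top_of_set (cball 0 e)) (subtopology (glued_surface Q) (\<Theta> ` cball 0 e)) \<Theta>"
    using \<Theta>(1,2) Hausdorff_glued_surface continuous_map_image_subset_topspace[OF \<Theta>(1)]
    by (intro continuous_imp_homeomorphic_map)
      (auto simp: continuous_map_in_subtopology Hausdorff_space_subtopology compact_space_subtopology)
  have "homeomorphic_map (subtopology (top_of_set (cball 0 e)) (ball 0 e))
     (subtopology (subtopology (glued_surface Q) (\<Theta> ` cball 0 e)) (\<Theta> ` ball 0 e)) \<Theta>"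
    by (rule homeomorphic_map_subtopologies[OF hom])
      (use continuous_map_image_subset_topspace[OF \<Theta>(1)] in auto)
  then have "homeomorphic_map (top_of_set (ball 0 e)) (subtopology (glued_surface Q) (star Q p (e ^ k))) \<Theta>"
    using image image_mono[OF ball_subset_cball, of \<Theta> 0 e] by (simp add: subtopology_subtopology Int_absorb1)
  then obtain \<Psi> where "homeomorphic_maps (top_of_set (ball 0 e)) (subtopology (glued_surface Q) (star Q p (e ^ k))) \<Theta> \<Psi>"
    unfolding homeomorphic_map_maps by blast
  then have \<Psi>: "homeomorphic_map (subtopology (glued_surface Q) (star Q p (e ^ k))) (top_of_set (ball 0 e)) \<Psi>"
    "\<And>x. x \<in> ball 0 e \<Longrightarrow> \<Psi> (\<Theta> x) = x"
    by (simp_all add: homeomorphic_maps_map)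
  have "\<Psi> (glued_point Q i w) ^ k = w - z"
    if "(i, z) \<in> p" "w \<in> unit_square" "dist w z < e ^ k" for i z w
    using lift[OF that] \<Psi>(2) by metis
  moreover have "\<Psi> p = 0" using \<Psi>(2)[of 0] \<Theta>0 e by simp
  ultimately show ?thesis using e ek \<Psi>(1) by (intro exI[of _ e] conjI exI[of _ \<Psi>]) auto
qed

end

section \<open>Square-tiled surfaces as translation surfaces\<close>

text \<open>Forward steps suffice to express transitivity, since permutations of a finite set have
  finite order.\<close>

definition transitive_gluing :: "origami_data \<Rightarrow> bool" where
  "transitive_gluing Q \<longleftrightarrow> 0 < squares Q \<and>
     (\<forall>i<squares Q. (0, i) \<in> {(j, k). j < squares Q \<and> (k = right Q j \<or> k = up Q j)}\<^sup>*)"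

context square_gluing
begin

lemma cone_setup_exists:
  assumes "x \<in> topspace (glued_surface Q)"
  shows "\<exists>i t. cone_setup Q i t \<and> x = glued_point Q i t"
proof -
  obtain i z where i: "i < squares Q" "z \<in> unit_square" "x = glued_point Q i z"
    using assms unfolding topspace_glued_surface by blast
  have "cone_setup Q (edge_shift Q z i) (torus_rep z)"
    using i by unfold_locales (auto simp: torus_rep_def unit_square_iff)
  then show ?thesis using glued_point_edge_shift[OF i(1,2)] i(3) by blast
qed

lemma locally_planar_glued_surface: "locally_planar (glued_surface Q)"
  unfolding locally_planar_def
proof
  fix x assume "x \<in> topspace (glued_surface Q)"
  then obtain i t where it: "cone_setup Q i t" "x = glued_point Q i t" using cone_setup_exists by blast
  interpret cone_setup Q i t by fact
  obtain \<rho> \<Psi> where \<rho>: "\<rho> > 0" "\<rho> ^ k \<le> boundary_gap t"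
    "homeomorphic_map (subtopology (glued_surface Q) (star Q p (\<rho> ^ k))) (top_of_set (ball 0 \<rho>)) (\<Psi> :: _ \<Rightarrow> complex)"
    using cone_chart by blast
  have "\<Psi> ` star Q p (\<rho> ^ k) = ball 0 \<rho>"
    using homeomorphic_imp_surjective_map[OF \<rho>(3)] star_subset_topspace[OF i0 t_sq] by (simp add: Int_absorb1)
  moreover have "x \<in> star Q p (\<rho> ^ k)" using center_in_star[OF i0 t_sq] \<rho>(1) it(2) by simp
  ultimately show "\<exists>U \<phi>. openin (glued_surface Q) U \<and> x \<in> U \<and> open (\<phi> ` U) \<and>
      homeomorphic_map (subtopology (glued_surface Q) U) (top_of_set (\<phi> ` U)) (\<phi> :: _ \<Rightarrow> complex)"
    using openin_star[OF i0 t_sq \<rho>(2)] \<rho>(3)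
    by (intro exI[of _ "star Q p (\<rho> ^ k)"] exI[of _ \<Psi>]) simp
qed

text \<open>Outside the singular set the cone order is 1. The cone chart is then a translation in
  every square around the point and belongs to the maximal atlas.\<close>

lemma atlas_covers:
  assumes x: "x \<in> topspace (regular_part (origami_surface Q))"
  shows "\<exists>U \<phi>. (U, \<phi>) \<in> origami_atlas Q \<and> x \<in> U"
proof -
  have x': "x \<in> topspace (glued_surface Q)" "x \<notin> singular_vertices Q" using x by (auto simp: topspace_regular_part)
  then obtain i t where it: "cone_setup Q i t" "x = glued_point Q i t" using cone_setup_exists by blast
  interpret cone_setup Q i t by fact
  have k1: "k = 1"
  proof (cases "t = 0")
    case True
    then have "commutator Q i = i" using x'(2) i0 it(2) unfolding singular_vertices_eq by blast
    then show ?thesis using orbit_eq_singleton_iff[of "commutator Q" i] True by (simp add: cone_order_def)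
  qed (simp add: cone_order_def)
  obtain \<rho> \<Psi> where \<rho>: "\<rho> > 0" "\<rho> \<le> boundary_gap t"
    "homeomorphic_map (subtopology (glued_surface Q) (star Q p \<rho>)) (top_of_set (ball 0 \<rho>)) (\<Psi> :: _ \<Rightarrow> complex)"
    "\<And>i z w. (i, z) \<in> p \<Longrightarrow> w \<in> unit_square \<Longrightarrow> dist w z < \<rho> \<Longrightarrow> \<Psi> (glued_point Q i w) = w - z"
    using cone_chart unfolding k1 power_one_right by blast
  have "\<Psi> ` star Q p \<rho> = ball 0 \<rho>"
    using homeomorphic_imp_surjective_map[OF \<rho>(3)] star_subset_topspace[OF i0 t_sq] by (simp add: Int_absorb1)
  moreover have "star Q p \<rho> \<inter> singular_vertices Q = {}"
    using star_meets_singular[OF i0 t_sq \<rho>(2)] x'(2) it(2) by blast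
  moreover have "\<exists>c. \<exists>e>0. \<forall>w\<in>unit_square. dist w z < e \<longrightarrow> \<Psi> (glued_point Q j w) = w + c"
    if j: "j < squares Q" "z \<in> unit_square" "glued_point Q j z \<in> star Q p \<rho>" for j z
  proof -
    obtain y where y: "(j, y) \<in> p" "dist z y < \<rho>"
      using j glued_point_in_star_iff[OF i0 t_sq \<rho>(2) j(1,2)] by blast
    show ?thesis
    proof (intro exI[of _ "- y"] exI[of _ "\<rho> - dist z y"] conjI ballI impI)
      fix w assume "w \<in> unit_square" "dist w z < \<rho> - dist z y"
      then show "\<Psi> (glued_point Q j w) = w + - y"
        using \<rho>(4)[OF y(1), of w] dist_triangle[of w y z] by simp
    qed (use y in simp)
  qed
  ultimately have "(star Q p \<rho>, \<Psi>) \<in> origami_atlas Q"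
    unfolding origami_atlas_def using openin_star[OF i0 t_sq \<rho>(2)] \<rho>(3) by simp
  then show ?thesis using center_in_star[OF i0 t_sq \<rho>(1)] it(2) by blast
qed

lemma translation_atlas_origami:
  "translation_atlas (regular_part (origami_surface Q)) (atlas (origami_surface Q))"
  unfolding translation_atlas_def
proof (intro conjI)
  have at: "atlas (origami_surface Q) = origami_atlas Q" by (simp add: origami_surface_def)
  have sub: "openin (regular_part (origami_surface Q)) U \<and>
      subtopology (regular_part (origami_surface Q)) U = subtopology (glued_surface Q) U"
    if "(U, \<phi>) \<in> origami_atlas Q" for U \<phi>
  proof -
    have U: "openin (glued_surface Q) U" "U \<inter> singular_vertices Q = {}" using that by (auto simp: origami_atlas_def)
    then have "(topspace (glued_surface Q) - singular_vertices Q) \<inter> U = U" using openin_subset by blast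
    then show ?thesis using openin_regular_part[OF U]
      by (simp add: regular_part_def origami_surface_def subtopology_subtopology)
  qed
  show "(\<Union>(U, \<phi>)\<in>atlas (origami_surface Q). U) = topspace (regular_part (origami_surface Q))"
  proof
    show "(\<Union>(U, \<phi>)\<in>atlas (origami_surface Q). U) \<subseteq> topspace (regular_part (origami_surface Q))"
      unfolding at using sub openin_subset by fast
    show "topspace (regular_part (origami_surface Q)) \<subseteq> (\<Union>(U, \<phi>)\<in>atlas (origami_surface Q). U)"
      unfolding at using atlas_covers by fast
  qed
  have "openin (regular_part (origami_surface Q)) U \<and> open (\<phi> ` U) \<and>
      homeomorphic_map (subtopology (regular_part (origami_surface Q)) U) (top_of_set (\<phi> ` U)) \<phi>"
    if U: "(U, \<phi>) \<in> origami_atlas Q" for U \<phi>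
    using sub[OF U] U unfolding origami_atlas_def by auto
  then show "\<forall>(U, \<phi>)\<in>atlas (origami_surface Q). openin (regular_part (origami_surface Q)) U \<and> open (\<phi> ` U) \<and>
      homeomorphic_map (subtopology (regular_part (origami_surface Q)) U) (top_of_set (\<phi> ` U)) \<phi>"
    unfolding at by blast
  have T: "\<exists>c W. openin (regular_part (origami_surface Q)) W \<and> x \<in> W \<and> W \<subseteq> U \<inter> V \<and> (\<forall>y\<in>W. \<psi> y = \<phi> y + c)"
    if U: "(U, \<phi>) \<in> origami_atlas Q" and V: "(V, \<psi>) \<in> origami_atlas Q" and x: "x \<in> U \<inter> V" for U \<phi> V \<psi> x
  proof -
    have "x \<in> topspace (glued_surface Q)" using U x openin_subset unfolding origami_atlas_def by blast
    then obtain i z where i: "i < squares Q" "z \<in> unit_square" "x = glued_point Q i z"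
      unfolding topspace_glued_surface by blast
    obtain d where d: "d > 0" "d \<le> boundary_gap z" "\<And>j y w. (j, y) \<in> glued_point Q i z \<Longrightarrow> w \<in> unit_square \<Longrightarrow>
      dist w y < d \<Longrightarrow> glued_point Q j w \<in> U \<and> \<phi> (glued_point Q j w) = \<phi> (glued_point Q i z) + (w - y)"
      using atlas_star[OF U i(1,2)] x i by blast
    obtain e where e: "e > 0" "e \<le> boundary_gap z" "\<And>j y w. (j, y) \<in> glued_point Q i z \<Longrightarrow> w \<in> unit_square \<Longrightarrow>
      dist w y < e \<Longrightarrow> glued_point Q j w \<in> V \<and> \<psi> (glued_point Q j w) = \<psi> (glued_point Q i z) + (w - y)"
      using atlas_star[OF V i(1,2)] x i by blast
    let ?W = "star Q x (min d e)"
    have W: "y \<in> U \<inter> V \<and> \<psi> y = \<phi> y + (\<psi> x - \<phi> x)" if y: "y \<in> ?W" for y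
    proof -
      obtain j v w where j: "y = glued_point Q j w" "(j, v) \<in> glued_point Q i z" "w \<in> unit_square" "dist w v < min d e"
        using y i(3) unfolding star_def by blast
      then show ?thesis using d(3)[OF j(2,3)] e(3)[OF j(2,3)] i(3) by simp
    qed
    moreover have "openin (regular_part (origami_surface Q)) ?W"
    proof (rule openin_regular_part)
      show "openin (glued_surface Q) ?W" using openin_star[OF i(1,2)] d i by simp
      show "?W \<inter> singular_vertices Q = {}" using W U unfolding origami_atlas_def by blast
    qed
    moreover have "x \<in> ?W" using center_in_star[OF i(1,2)] d e i by simp
    ultimately show ?thesis by blast
  qed
  show "\<forall>(U, \<phi>)\<in>atlas (origami_surface Q). \<forall>(V, \<psi>)\<in>atlas (origami_surface Q). \<forall>x\<in>U \<inter> V.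
        \<exists>c W. openin (regular_part (origami_surface Q)) W \<and> x \<in> W \<and> W \<subseteq> U \<inter> V \<and> (\<forall>y\<in>W. \<psi> y = \<phi> y + c)"
    unfolding at by clarify (rule T, auto)
qed

text \<open>Both a chart of the atlas and the power \<open>\<Psi> ^ k\<close> of the cone chart vary
  by the displacement inside the squares, so near each point they differ by a constant.\<close>

lemma cone_point_vertex:
  assumes i0: "i0 < squares Q"
  shows "cone_point (origami_surface Q) (glued_point Q i0 0) (card (orbit (commutator Q) i0))"
proof -
  interpret cone_setup Q i0 0 using i0 by unfold_locales auto
  have k: "k = card (orbit (commutator Q) i0)" by (simp add: cone_order_def)
  obtain \<rho> \<Psi> where \<rho>: "\<rho> > 0" "\<rho> ^ k \<le> boundary_gap 0"
    "homeomorphic_map (subtopology (glued_surface Q) (star Q p (\<rho> ^ k))) (top_of_set (ball 0 \<rho>)) (\<Psi> :: _ \<Rightarrow> complex)"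
    "\<Psi> p = 0" "\<And>i z w. (i, z) \<in> p \<Longrightarrow> w \<in> unit_square \<Longrightarrow> dist w z < \<rho> ^ k \<Longrightarrow> \<Psi> (glued_point Q i w) ^ k = w - z"
    using cone_chart by blast
  let ?U = "star Q p (\<rho> ^ k)"
  have loc: "\<exists>c W. openin (regular_part (origami_surface Q)) W \<and> x \<in> W \<and> W \<subseteq> ?U \<inter> V \<and> (\<forall>y\<in>W. \<phi> y = \<Psi> y ^ k + c)"
    if V: "(V, \<phi>) \<in> origami_atlas Q" and x: "x \<in> (?U - {p}) \<inter> V" for V \<phi> x
  proof -
    have Vo: "openin (glued_surface Q) V" "V \<inter> singular_vertices Q = {}" using V by (auto simp: origami_atlas_def)
    then obtain i1 z1 where i1: "i1 < squares Q" "z1 \<in> unit_square" "x = glued_point Q i1 z1"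
      using x openin_subset[OF Vo(1)] unfolding topspace_glued_surface by blast
    obtain d where d: "d > 0" "\<And>j y w. (j, y) \<in> x \<Longrightarrow> w \<in> unit_square \<Longrightarrow>
      dist w y < d \<Longrightarrow> glued_point Q j w \<in> V \<and> \<phi> (glued_point Q j w) = \<phi> x + (w - y)"
      using atlas_star[OF V i1(1,2)] x i1(3) by blast
    have "\<exists>e>0. e \<le> boundary_gap z1 \<and> (\<forall>(i, z)\<in>glued_point Q i1 z1. \<forall>w\<in>unit_square. dist w z < e \<longrightarrow>
      glued_point Q i w \<in> ?U \<inter> V \<and> \<phi> (glued_point Q i w) = \<Psi> (glued_point Q i w) ^ k + (\<phi> x - \<Psi> x ^ k))"
    proof (rule uniform_radius[OF i1(1,2)])
      fix i z assume iz: "(i, z) \<in> glued_point Q i1 z1"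
      then have iz': "i < squares Q" "z \<in> unit_square" "glued_point Q i z = x" "(i, z) \<in> x"
        using i1 by (auto simp: mem_glued_point_iff)
      obtain y where y: "(i, y) \<in> p" "dist z y < \<rho> ^ k"
        using x glued_point_in_star_iff[OF i0 t_sq \<rho>(2) iz'(1,2)] iz' by auto
      show "\<exists>e>0. \<forall>w\<in>unit_square. dist w z < e \<longrightarrow>
        glued_point Q i w \<in> ?U \<inter> V \<and> \<phi> (glued_point Q i w) = \<Psi> (glued_point Q i w) ^ k + (\<phi> x - \<Psi> x ^ k)"
      proof (intro exI[of _ "min d (\<rho> ^ k - dist z y)"] conjI ballI impI)
        fix w assume w: "w \<in> unit_square" "dist w z < min d (\<rho> ^ k - dist z y)"
        then have wy: "dist w y < \<rho> ^ k" using dist_triangle[of w y z] by simp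
        have 1: "glued_point Q i w \<in> V" "\<phi> (glued_point Q i w) = \<phi> x + (w - z)" using d(2)[OF iz'(4) w(1)] w(2) by auto
        have 2: "\<Psi> (glued_point Q i w) ^ k = w - y" "\<Psi> x ^ k = z - y"
          using \<rho>(5)[OF y(1) w(1) wy] \<rho>(5)[OF y(1) iz'(2) y(2)] iz'(3) by auto
        have "glued_point Q i w \<in> ?U" using glued_point_in_star_iff[OF i0 t_sq \<rho>(2) iz'(1) w(1)] y wy by blast
        then show "glued_point Q i w \<in> ?U \<inter> V"
          "\<phi> (glued_point Q i w) = \<Psi> (glued_point Q i w) ^ k + (\<phi> x - \<Psi> x ^ k)" using 1 2 by simp_all
      qed (use d y in simp)
    qed
    then obtain e where e: "e > 0" "e \<le> boundary_gap z1" "\<And>i z w. (i, z) \<in> x \<Longrightarrow> w \<in> unit_square \<Longrightarrow> dist w z < e \<Longrightarrow>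
      glued_point Q i w \<in> ?U \<inter> V \<and> \<phi> (glued_point Q i w) = \<Psi> (glued_point Q i w) ^ k + (\<phi> x - \<Psi> x ^ k)"
      using i1(3) by blast
    have W: "y \<in> ?U \<inter> V \<and> \<phi> y = \<Psi> y ^ k + (\<phi> x - \<Psi> x ^ k)" if "y \<in> star Q x e" for y
      using that e(3) unfolding star_def by blast
    moreover have "openin (regular_part (origami_surface Q)) (star Q x e)"
    proof (rule openin_regular_part)
      show "openin (glued_surface Q) (star Q x e)" using openin_star[OF i1(1,2) e(2)] i1(3) by simp
      show "star Q x e \<inter> singular_vertices Q = {}" using W Vo by blast
    qed
    moreover have "x \<in> star Q x e" using center_in_star[OF i1(1,2) e(1)] i1(3) by simp
    ultimately show ?thesis by blast
  qed
  have k1: "k \<ge> 1" using k_pos by simp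
  have comp: "completion (origami_surface Q) = glued_surface Q" "singularities (origami_surface Q) = singular_vertices Q"
    "atlas (origami_surface Q) = origami_atlas Q" by (simp_all add: origami_surface_def)
  have "cone_point (origami_surface Q) p k"
    unfolding cone_point_def comp
  proof (intro conjI k1 exI[of _ ?U] exI[of _ \<Psi>] exI[of _ \<rho>])
    show "p \<in> ?U" using center_in_star[OF i0 t_sq] \<rho>(1) by simp
    show "\<forall>(V, \<phi>)\<in>origami_atlas Q. \<forall>x\<in>(?U - {p}) \<inter> V.
      \<exists>c W. openin (regular_part (origami_surface Q)) W \<and> x \<in> W \<and> W \<subseteq> ?U \<inter> V \<and> (\<forall>y\<in>W. \<phi> y = \<Psi> y ^ k + c)"
      using loc by blast
  qed (use \<rho> openin_star[OF i0 t_sq \<rho>(2)] star_meets_singular[OF i0 t_sq \<rho>(2)] in auto)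
  then show ?thesis by (simp only: k)
qed

text \<open>A square without some of its corners is star-shaped about its centre, and neighbouring
  squares are joined through midpoints of edges, which are never removed. The general
  \<open>S\<close> serves both the regular part and, with \<open>S = {}\<close>, the closed
  surface.\<close>

lemma connected_minus_vertices:
  assumes tr: "transitive_gluing Q" and S: "S \<subseteq> vertices Q"
  shows "connected_space (subtopology (glued_surface Q) (topspace (glued_surface Q) - S))"
proof -
  let ?X = "subtopology (glued_surface Q) (topspace (glued_surface Q) - S)"
  have topX: "topspace ?X = topspace (glued_surface Q) - S" by auto
  define D where "D i = {z \<in> unit_square. glued_point Q i z \<notin> S}" for i
  have ncorner: "z \<in> D i" if z: "z \<in> unit_square" "z \<notin> {0, 1, \<i>, 1 + \<i>}" "i < squares Q" for i z
  proof -
    have "glued_point Q i z \<noteq> glued_point Q j 0" if "j < squares Q" for j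
      using mem_glued_vertex_iff[OF that, of i z] self_mem_glued_point[OF z(3,1)] z(2) by auto
    then show ?thesis using S z(1) unfolding D_def vertices_eq by blast
  qed
  let ?a = "Complex (1/2) (1/2)"
  have conn: "connectedin ?X (glued_point Q i ` D i)" if i: "i < squares Q" for i
  proof -
    have "starlike (D i)"
      unfolding starlike_def
    proof (intro bexI[of _ ?a] ballI)
      show "?a \<in> D i" by (rule ncorner) (use i in \<open>auto simp: unit_square_iff complex_eq_iff\<close>)
      fix z assume z: "z \<in> D i"
      show "closed_segment ?a z \<subseteq> D i"
      proof
        fix w assume "w \<in> closed_segment ?a z"
        then obtain s where s: "0 \<le> s" "s \<le> 1" "w = (1 - s) *\<^sub>R ?a + s *\<^sub>R z" unfolding closed_segment_def by blast
        have zs: "z \<in> unit_square" using z by (simp add: D_def)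
        show "w \<in> D i"
        proof (cases "s = 1")
          case True
          then show ?thesis using s z by simp
        next
          case False
          then have "s < 1" using s by simp
          moreover have "0 \<le> s * Re z" "s * Re z \<le> s" "0 \<le> s * Im z" "s * Im z \<le> s"
            using zs s by (auto simp: unit_square_iff mult_left_le)
          ultimately have "0 < Re w" "Re w < 1" "0 < Im w" "Im w < 1"
            unfolding s(3) by (simp_all add: diff_divide_distrib)
          then show ?thesis by (intro ncorner i) (auto simp: unit_square_iff)
        qed
      qed
    qed
    then have "connectedin (top_of_set (D i)) (D i)"
      by (simp add: connectedin_subtopology starlike_imp_connected)
    moreover have "continuous_map (top_of_set (D i)) ?X (glued_point Q i)"
    proof -
      have "continuous_map (subtopology (top_of_set unit_square) (D i)) (glued_surface Q) (glued_point Q i)"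
        by (rule continuous_map_from_subtopology[OF continuous_map_glued_point[OF i]])
      moreover have "unit_square \<inter> D i = D i" by (auto simp: D_def)
      ultimately show ?thesis using i
        by (auto simp: continuous_map_in_subtopology subtopology_subtopology D_def)
    qed
    ultimately show ?thesis using connectedin_continuous_map_image by blast
  qed
  have cc: "connected_component_of ?X (glued_point Q i z) (glued_point Q i w)"
    if "i < squares Q" "z \<in> D i" "w \<in> D i" for i z w
    using conn[OF that(1)] that unfolding connected_component_of_def by blast
  have ha: "?a \<in> D i" if "i < squares Q" for i
    by (rule ncorner) (use that in \<open>auto simp: unit_square_iff complex_eq_iff\<close>)
  have nb: "connected_component_of ?X (glued_point Q i ?a) (glued_point Q j ?a)"
    if i: "i < squares Q" "j = right Q i \<or> j = up Q i" for i j
  proof -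
    have j: "j < squares Q" using i by auto
    define z w where "z = (if j = right Q i then Complex 1 (1/2) else Complex (1/2) 1)"
      and "w = (if j = right Q i then Complex 0 (1/2) else Complex (1/2) 0)"
    have zw: "z \<in> unit_square" "w \<in> unit_square" by (auto simp: z_def w_def unit_square_iff)
    have zD: "z \<in> D i" "w \<in> D j"
      by (rule ncorner; use i j zw in \<open>auto simp: z_def w_def complex_eq_iff\<close>)+
    have eq: "glued_point Q i z = glued_point Q j w"
      using i zw glued_point_right[of i z] glued_point_up[of i z] by (auto simp: z_def w_def)
    show ?thesis
      by (rule connected_component_of_trans[OF cc[OF i(1) ha[OF i(1)] zD(1), unfolded eq] cc[OF j zD(2) ha[OF j]]])
  qed
  have centers: "connected_component_of ?X (glued_point Q 0 ?a) (glued_point Q i ?a)" if i: "i < squares Q" for i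
  proof -
    have "(0, i) \<in> {(j, k). j < squares Q \<and> (k = right Q j \<or> k = up Q j)}\<^sup>*" "0 < squares Q"
      using tr i by (auto simp: transitive_gluing_def)
    then show ?thesis
    proof (induction rule: rtrancl_induct)
      case base
      then show ?case using cc[of 0 ?a ?a] ha by simp
    next
      case (step j k)
      then have "connected_component_of ?X (glued_point Q j ?a) (glued_point Q k ?a)" using nb[of j k] by simp
      with step.IH[OF step.prems] show ?case by (rule connected_component_of_trans)
    qed
  qed
  have all: "connected_component_of ?X (glued_point Q 0 ?a) x" if x: "x \<in> topspace ?X" for x
  proof -
    have "x \<in> topspace (glued_surface Q)" and xS: "x \<notin> S" using x by auto
    then obtain i z where "i < squares Q" "z \<in> unit_square" "x = glued_point Q i z"
      unfolding topspace_glued_surface by blast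
    with xS have i: "i < squares Q" "z \<in> D i" "x = glued_point Q i z" by (simp_all add: D_def)
    show ?thesis unfolding i(3)
      by (rule connected_component_of_trans[OF centers[OF i(1)] cc[OF i(1) ha[OF i(1)] i(2)]])
  qed
  then show ?thesis
    unfolding connected_space_iff_connected_component
    by (meson connected_component_of_sym connected_component_of_trans)
qed

lemma translation_surface_origami:
  assumes tr: "transitive_gluing Q"
  shows "translation_surface (origami_surface Q)"
proof -
  have sv: "singular_vertices Q \<subseteq> vertices Q" by (auto simp: singular_vertices_def)
  have "connected_space (regular_part (origami_surface Q))"
    using connected_minus_vertices[OF tr sv] by (simp add: regular_part_def origami_surface_def)
  moreover have "topspace (regular_part (origami_surface Q)) \<noteq> {}"
  proof -
    have "0 < squares Q" using tr by (simp add: transitive_gluing_def)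
    moreover have u: "Complex (1/2) (1/2) \<in> unit_square" by (simp add: unit_square_iff)
    moreover have "glued_point Q 0 (Complex (1/2) (1/2)) \<notin> singular_vertices Q"
      using singular_glued_point[OF \<open>0 < squares Q\<close> u] by (auto simp: complex_eq_iff)
    ultimately show ?thesis unfolding topspace_regular_part using glued_point_in_topspace by blast
  qed
  moreover have "\<exists>k. cone_point (origami_surface Q) p k" if "p \<in> singular_vertices Q" for p
    using that cone_point_vertex unfolding singular_vertices_eq by blast
  ultimately show ?thesis
    unfolding translation_surface_def
    using compact_glued_surface Hausdorff_glued_surface locally_planar_glued_surface singular_vertices_subset
      finite_singular_vertices translation_atlas_origami
    by (simp add: origami_surface_def)
qed

lemma origami_if_transitive:
  assumes tr: "transitive_gluing Q"
  shows "origami Q"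
  using connected_minus_vertices[OF tr, of "{}"] tr right_permutes up_permutes
  by (simp add: origami_def transitive_gluing_def)

end

section \<open>The genus\<close>

text \<open>Since boundary and interior have disjoint images, the open cell is the full preimage of
  its image. A closed map restricted to such a preimage remains closed onto the image, and a
  continuous closed bijection is a homeomorphism.\<close>

lemma closed_cell_homeomorphic_map:
  assumes cont: "continuous_map (top_of_set (closed_cell k)) X \<Phi>" and X: "Hausdorff_space X"
    and inj: "inj_on \<Phi> (closed_cell k \<inter> ball 0 1)"
    and bd: "\<Phi> ` (closed_cell k \<inter> sphere 0 1) \<inter> \<Phi> ` (closed_cell k \<inter> ball 0 1) = {}"
  shows "homeomorphic_map (top_of_set (closed_cell k \<inter> ball 0 1))
    (subtopology X (\<Phi> ` (closed_cell k \<inter> ball 0 1))) \<Phi>"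
proof -
  let ?O = "closed_cell k \<inter> ball 0 1"
  have "closed_cell k = cball 0 1 \<inter> ({z. k = 0 \<longrightarrow> z = 0} \<inter> {z. k = 1 \<longrightarrow> Im z = 0})"
    by (auto simp: closed_cell_def)
  moreover have "closed {z :: complex. k = 0 \<longrightarrow> z = 0}" by (cases "k = 0") auto
  moreover have "closed {z :: complex. k = 1 \<longrightarrow> Im z = 0}"
    by (cases "k = 1") (auto intro!: closed_Collect_eq continuous_intros)
  ultimately have "compact (closed_cell k)" by (metis closed_Int compact_Int_closed compact_cball)
  then have cl: "closed_map (top_of_set (closed_cell k)) X \<Phi>"
    using cont X by (intro continuous_imp_closed_map) (auto simp: compact_space_subtopology)
  have "closed_cell k \<subseteq> ball 0 1 \<union> sphere 0 1" by (auto simp: closed_cell_def)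
  then have split: "closed_cell k = ?O \<union> (closed_cell k \<inter> sphere 0 1)" by blast
  have "{x \<in> topspace (top_of_set (closed_cell k)). \<Phi> x \<in> \<Phi> ` ?O} = ?O"
    using split bd by auto
  then have "closed_map (subtopology (top_of_set (closed_cell k)) ?O) (subtopology X (\<Phi> ` ?O)) \<Phi>"
    by (rule closed_map_restriction[OF cl])
  moreover have "continuous_map (subtopology (top_of_set (closed_cell k)) ?O) (subtopology X (\<Phi> ` ?O)) \<Phi>"
    using cont by (auto simp: continuous_map_in_subtopology continuous_map_from_subtopology)
  moreover have "topspace (subtopology X (\<Phi> ` ?O)) = \<Phi> ` ?O"
    using continuous_map_image_subset_topspace[OF cont] by auto
  ultimately show ?thesis using inj
    by (intro bijective_closed_imp_homeomorphic_map) (auto simp: subtopology_subtopology Int_absorb1)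
qed

text \<open>Compact convex sets with interior points are homeomorphic; invariance of domain, applied
  in both directions, shows that interiors correspond.\<close>

lemma disc_square_homeomorphism:
  "\<exists>h :: complex \<Rightarrow> complex. continuous_on (cball 0 1) h \<and> inj_on h (cball 0 1) \<and> h ` cball 0 1 = unit_square \<and>
     h ` ball 0 1 = interior unit_square"
proof -
  have int: "interior unit_square = box 0 (Complex 1 1)" by (simp add: unit_square_eq_cbox)
  have "Complex (1/2) (1/2) \<in> box 0 (Complex 1 1)" by (simp add: mem_box Basis_complex_def inner_complex_def)
  then have "interior unit_square \<noteq> {}" using int by blast
  then have "cball (0::complex) 1 homeomorphic unit_square"
    by (intro homeomorphic_convex_compact[OF _ _ _ _ ] ) (simp_all add: unit_square_eq_cbox)
  then obtain h g where hg: "homeomorphism (cball (0::complex) 1) unit_square h g" unfolding homeomorphic_def by blast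
  have h: "continuous_on (cball 0 1) h" "h ` cball 0 1 = unit_square" "inj_on h (cball 0 1)"
    and g: "continuous_on unit_square g" "g ` unit_square = cball 0 1" "inj_on g unit_square"
    "\<And>x. x \<in> cball 0 1 \<Longrightarrow> g (h x) = x" "\<And>x. x \<in> unit_square \<Longrightarrow> h (g x) = x"
    using hg unfolding homeomorphism_def by (auto intro: inj_on_inverseI)
  have "open (h ` ball 0 1)"
    using h by (intro invariance_of_domain) (auto intro: continuous_on_subset inj_on_subset)
  then have 1: "h ` ball 0 1 \<subseteq> interior unit_square"
    using h(2) by (intro interior_maximal) auto
  have "open (g ` interior unit_square)"
    by (rule invariance_of_domain[OF continuous_on_subset[OF g(1) interior_subset] open_interior
          inj_on_subset[OF g(3) interior_subset]])
  then have "g ` interior unit_square \<subseteq> interior (cball 0 1)"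
    using g(2) interior_subset by (intro interior_maximal) auto
  then have "interior unit_square \<subseteq> h ` ball 0 1" using g(5) interior_subset by (force simp: image_iff)
  then show ?thesis using h 1 by blast
qed

text \<open>The half-open square is divided into its lower left corner (0), lower edge (1), left
  edge (2) and interior (3). Every glued point has a representative in exactly one of these
  shapes.\<close>

definition cell_shape :: "nat \<Rightarrow> complex set" where
  "cell_shape s = {z. (if s = 1 \<or> s = 3 then 0 < Re z \<and> Re z < 1 else Re z = 0) \<and>
     (if s = 2 \<or> s = 3 then 0 < Im z \<and> Im z < 1 else Im z = 0)}"

definition cell_dim :: "nat \<Rightarrow> nat" where
  "cell_dim s = (if s = 0 then 0 else if s = 3 then 2 else 1)"

definition glued_cell :: "origami_data \<Rightarrow> nat \<Rightarrow> nat \<Rightarrow> (nat \<times> complex) set set" where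
  "glued_cell Q s i = glued_point Q i ` cell_shape s"

lemma cell_map_exists:
  assumes "s < 4"
  shows "\<exists>h. continuous_on (closed_cell (cell_dim s)) h \<and> h ` closed_cell (cell_dim s) \<subseteq> unit_square \<and>
    inj_on h (closed_cell (cell_dim s) \<inter> ball 0 1) \<and> h ` (closed_cell (cell_dim s) \<inter> ball 0 1) = cell_shape s \<and>
    (\<forall>z\<in>closed_cell (cell_dim s) \<inter> sphere 0 1. \<exists>s'<4. cell_dim s' < cell_dim s \<and> torus_rep (h z) \<in> cell_shape s')"
proof -
  consider "s = 0" | "s = 1" | "s = 2" | "s = 3" using assms by linarith
  then show ?thesis
  proof cases
    case 1
    have c: "closed_cell (cell_dim s) = {0}" by (auto simp: closed_cell_def cell_dim_def 1)
    have cs: "cell_shape s = {0}" by (auto simp: cell_shape_def 1 complex_eq_iff)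
    show ?thesis unfolding c cs by (intro exI[of _ "\<lambda>z. z"]) (simp add: unit_square_iff)
  next
    case 2
    let ?h = "\<lambda>z. Complex ((1 + Re z) / 2) 0"
    have c: "closed_cell (cell_dim s) = {z. Im z = 0 \<and> \<bar>Re z\<bar> \<le> 1}"
      by (auto simp: closed_cell_def cell_dim_def 2 cmod_eq_Re)
    have img: "z \<in> ?h ` (closed_cell (cell_dim s) \<inter> ball 0 1)" if "z \<in> cell_shape s" for z
      using that unfolding c by (intro image_eqI[of _ _ "Complex (2 * Re z - 1) 0"])
        (auto simp: cell_shape_def 2 complex_eq_iff cmod_eq_Re)
    have "torus_rep (?h z) \<in> cell_shape 0" if "z \<in> closed_cell (cell_dim s) \<inter> sphere 0 1" for z
    proof -
      have "Re z = 1 \<or> Re z = -1" using that unfolding c by (auto simp: cmod_eq_Re)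
      then show ?thesis by (auto simp: cell_shape_def torus_rep_def)
    qed
    moreover have "?h ` (closed_cell (cell_dim s) \<inter> ball 0 1) \<subseteq> cell_shape s"
      unfolding c by (auto simp: cell_shape_def 2 cmod_eq_Re)
    moreover have "continuous_on (closed_cell (cell_dim s)) ?h"
      by (auto simp: Complex_eq intro!: continuous_intros)
    moreover have "?h ` closed_cell (cell_dim s) \<subseteq> unit_square" unfolding c by (auto simp: unit_square_iff)
    moreover have "inj_on ?h (closed_cell (cell_dim s) \<inter> ball 0 1)"
      unfolding c by (auto simp: inj_on_def complex_eq_iff)
    ultimately show ?thesis using img 2
      by (intro exI[of _ ?h] conjI ballI exI[of _ 0]) (auto simp: cell_dim_def)
  next
    case 3
    let ?h = "\<lambda>z. Complex 0 ((1 + Re z) / 2)"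
    have c: "closed_cell (cell_dim s) = {z. Im z = 0 \<and> \<bar>Re z\<bar> \<le> 1}"
      by (auto simp: closed_cell_def cell_dim_def 3 cmod_eq_Re)
    have img: "z \<in> ?h ` (closed_cell (cell_dim s) \<inter> ball 0 1)" if "z \<in> cell_shape s" for z
      using that unfolding c by (intro image_eqI[of _ _ "Complex (2 * Im z - 1) 0"])
        (auto simp: cell_shape_def 3 complex_eq_iff cmod_eq_Re)
    have "torus_rep (?h z) \<in> cell_shape 0" if "z \<in> closed_cell (cell_dim s) \<inter> sphere 0 1" for z
    proof -
      have "Re z = 1 \<or> Re z = -1" using that unfolding c by (auto simp: cmod_eq_Re)
      then show ?thesis by (auto simp: cell_shape_def torus_rep_def)
    qed
    moreover have "?h ` (closed_cell (cell_dim s) \<inter> ball 0 1) \<subseteq> cell_shape s"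
      unfolding c by (auto simp: cell_shape_def 3 cmod_eq_Re)
    moreover have "continuous_on (closed_cell (cell_dim s)) ?h"
      by (auto simp: Complex_eq intro!: continuous_intros)
    moreover have "?h ` closed_cell (cell_dim s) \<subseteq> unit_square" unfolding c by (auto simp: unit_square_iff)
    moreover have "inj_on ?h (closed_cell (cell_dim s) \<inter> ball 0 1)"
      unfolding c by (auto simp: inj_on_def complex_eq_iff)
    ultimately show ?thesis using img 3
      by (intro exI[of _ ?h] conjI ballI exI[of _ 0]) (auto simp: cell_dim_def)
  next
    case 4
    obtain h :: "complex \<Rightarrow> complex" where h: "continuous_on (cball 0 1) h" "inj_on h (cball 0 1)"
      "h ` cball 0 1 = unit_square" "h ` ball 0 1 = interior unit_square" using disc_square_homeomorphism by blast
    have c: "closed_cell (cell_dim s) = cball 0 1" by (auto simp: closed_cell_def cell_dim_def 4)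
    have int: "interior unit_square = cell_shape s"
      by (auto simp: unit_square_eq_cbox mem_box Basis_complex_def inner_complex_def cell_shape_def 4)
    have "\<exists>s'<4. cell_dim s' < cell_dim s \<and> torus_rep (h z) \<in> cell_shape s'" if z: "z \<in> sphere 0 1" for z
    proof -
      have "h z \<notin> h ` ball 0 1"
      proof
        assume "h z \<in> h ` ball 0 1"
        then obtain y where "y \<in> ball 0 1" "h z = h y" by blast
        then show False using z inj_onD[OF h(2), of z y] by auto
      qed
      then have "h z \<notin> cell_shape s" "h z \<in> unit_square" using h z int by auto
      then have "torus_rep (h z) \<in> cell_shape 0 \<or> torus_rep (h z) \<in> cell_shape 1 \<or> torus_rep (h z) \<in> cell_shape 2"
        by (auto simp: cell_shape_def 4 torus_rep_def unit_square_iff)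
      then obtain s' :: nat where "s' < 3" "torus_rep (h z) \<in> cell_shape s'"
        by (elim disjE) (rule_tac that; assumption?; simp)+
      moreover have "cell_dim s' < cell_dim s" if "s' < 3" for s' using that by (simp add: cell_dim_def 4)
      ultimately show ?thesis by (intro exI[of _ s'] conjI) simp_all
    qed
    then show ?thesis unfolding c using h int
      by (intro exI[of _ h]) (auto simp: Int_absorb1 intro: inj_on_subset)
  qed
qed

section \<open>The cell decomposition by squares and the Euler characteristic\<close>

context square_gluing
begin

lemma cell_shape_unit: "z \<in> cell_shape s \<Longrightarrow> z \<in> unit_square \<and> torus_rep z = z"
  by (auto simp: cell_shape_def unit_square_iff torus_rep_def complex_eq_iff split: if_splits)

lemma cell_shape_unique: "z \<in> cell_shape s \<Longrightarrow> z \<in> cell_shape s' \<Longrightarrow> s < 4 \<Longrightarrow> s' < 4 \<Longrightarrow> s = s'"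
  by (auto simp: cell_shape_def split: if_splits)

lemma glued_cell_point_eq:
  assumes "i < squares Q" "j < squares Q" "z \<in> cell_shape s" "w \<in> cell_shape s'" "s < 4" "s' < 4"
    "glued_point Q i z = glued_point Q j w"
  shows "s = s' \<and> z = w \<and> (s \<noteq> 0 \<longrightarrow> i = j)"
proof -
  note z = cell_shape_unit[OF assms(3)] and w = cell_shape_unit[OF assms(4)]
  have nf: "normal_form Q i z = normal_form Q j w"
    using assms z w glued_point_eq_iff by simp
  then have "z = w" using z w by (simp add: normal_form_def)
  moreover have s: "s = s'" using assms \<open>z = w\<close> cell_shape_unique by blast
  moreover have "i = j" if "s \<noteq> 0"
  proof -
    have "z \<noteq> 0" using assms(3,5) that by (auto simp: cell_shape_def split: if_splits)
    moreover have "edge_shift Q z l = l" for l using z edge_shift_torus_rep[of Q z l] by simp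
    ultimately show ?thesis using nf z \<open>z = w\<close> by (simp add: normal_form_def)
  qed
  ultimately show ?thesis by blast
qed

lemma cell_shape_nonempty: "s < 4 \<Longrightarrow> \<exists>z. z \<in> cell_shape s"
  by (rule exI[of _ "Complex (if s = 1 \<or> s = 3 then 1/2 else 0) (if s = 2 \<or> s = 3 then 1/2 else 0)"])
    (auto simp: cell_shape_def)

lemma glued_cell_0: "glued_cell Q 0 i = {glued_point Q i 0}"
proof -
  have "cell_shape 0 = {0}" by (auto simp: cell_shape_def complex_eq_iff)
  then show ?thesis by (simp add: glued_cell_def)
qed

lemma glued_cells_disjoint:
  assumes "i < squares Q" "j < squares Q" "s < 4" "s' < 4" "x \<in> glued_cell Q s i" "x \<in> glued_cell Q s' j"
  shows "s = s' \<and> glued_cell Q s i = glued_cell Q s' j"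
proof -
  obtain z w where z: "z \<in> cell_shape s" "x = glued_point Q i z" and w: "w \<in> cell_shape s'" "x = glued_point Q j w"
    using assms(5,6) unfolding glued_cell_def by blast
  have e: "s = s' \<and> z = w \<and> (s \<noteq> 0 \<longrightarrow> i = j)" using glued_cell_point_eq[OF assms(1,2) z(1) w(1) assms(3,4)] z w by simp
  show ?thesis
  proof (cases "s = 0")
    case True
    then show ?thesis using e assms(5,6) by (auto simp: glued_cell_0)
  qed (use e in auto)
qed

lemma mem_glued_cell:
  assumes "i < squares Q" "z \<in> unit_square" "torus_rep z \<in> cell_shape s"
  shows "glued_point Q i z \<in> glued_cell Q s (edge_shift Q z i)"
  using glued_point_edge_shift[OF assms(1,2)] assms(3) by (auto simp: glued_cell_def)

text \<open>With \<open>N\<close> squares there are \<open>2 * N\<close> edges and \<open>N\<close>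
  faces, so the Euler characteristic is the number of vertices minus \<open>N\<close>.\<close>

lemma has_genus_glued_surface:
  assumes "int (card (vertices Q)) - int (squares Q) = 2 - 2 * int g"
  shows "has_genus (glued_surface Q) g"
proof -
  define cells where "cells s = glued_cell Q s ` {..<squares Q}" for s
  define C where "C = (\<Union>s<4. cells s)"
  \<comment> \<open>The dimension has to be a function of the cell as a set of points. The choice is
    harmless because nonempty cells of different shapes are disjoint.\<close>
  define dm where "dm e = cell_dim (SOME s. s < 4 \<and> e \<in> cells s)" for e
  have ne: "glued_cell Q s i \<noteq> {}" if "s < 4" for s i
    using cell_shape_nonempty[OF that] by (auto simp: glued_cell_def)
  have cells_disj: "s = s'" if "e \<in> cells s" "e \<in> cells s'" "s < 4" "s' < 4" for e s s'
  proof -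
    obtain i j where ij: "i < squares Q" "j < squares Q" "e = glued_cell Q s i" "e = glued_cell Q s' j"
      using \<open>e \<in> cells s\<close> \<open>e \<in> cells s'\<close> unfolding cells_def by blast
    then obtain x where "x \<in> e" using ne[OF \<open>s < 4\<close>] by blast
    then show ?thesis using glued_cells_disjoint[OF ij(1,2) that(3,4)] ij by blast
  qed
  have dm: "dm e = cell_dim s" if "e \<in> cells s" "s < 4" for e s
  proof -
    have "(SOME s. s < 4 \<and> e \<in> cells s) = s"
      by (rule some_equality) (use that cells_disj in auto)
    then show ?thesis by (simp add: dm_def)
  qed
  have CD: "cell_decomposition (glued_surface Q) C dm"
    unfolding cell_decomposition_def
  proof (intro conjI ballI)
    show "finite C" by (simp add: C_def cells_def)
    show "disjoint C"
      unfolding pairwise_def disjnt_iff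
    proof (intro ballI impI allI notI)
      fix e e' x assume "e \<in> C" "e' \<in> C" "e \<noteq> e'" "x \<in> e \<and> x \<in> e'"
      then show False unfolding C_def cells_def using glued_cells_disjoint by fast
    qed
    show "\<Union>C = topspace (glued_surface Q)"
    proof
      show "\<Union>C \<subseteq> topspace (glued_surface Q)"
        unfolding C_def cells_def glued_cell_def using cell_shape_unit glued_point_in_topspace by blast
      show "topspace (glued_surface Q) \<subseteq> \<Union>C"
      proof
        fix x assume "x \<in> topspace (glued_surface Q)"
        then obtain i z where i: "i < squares Q" "z \<in> unit_square" "x = glued_point Q i z"
          unfolding topspace_glued_surface by blast
        define s :: nat where "s = (if Re (torus_rep z) = 0 then (if Im (torus_rep z) = 0 then 0 else 2)
           else (if Im (torus_rep z) = 0 then 1 else 3))"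
        have "torus_rep z \<in> cell_shape s" "s < 4"
          using i(2) by (auto simp: s_def cell_shape_def torus_rep_def unit_square_iff)
        then have "x \<in> glued_cell Q s (edge_shift Q z i)" using mem_glued_cell i by simp
        moreover have "edge_shift Q z i < squares Q" using i by simp
        ultimately show "x \<in> \<Union>C" using \<open>s < 4\<close> unfolding C_def cells_def by blast
      qed
    qed
    fix e assume "e \<in> C"
    then obtain s i where s: "s < 4" "e \<in> cells s" and i: "i < squares Q" "e = glued_cell Q s i"
      unfolding C_def cells_def by blast
    have de: "dm e = cell_dim s" by (rule dm[OF s(2,1)])
    show "dm e \<le> 2" by (simp add: de cell_dim_def)
    let ?D = "closed_cell (cell_dim s)"
    obtain h where h: "continuous_on ?D h" "h ` ?D \<subseteq> unit_square" "inj_on h (?D \<inter> ball 0 1)"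
      "h ` (?D \<inter> ball 0 1) = cell_shape s"
      "\<And>z. z \<in> ?D \<inter> sphere 0 1 \<Longrightarrow> \<exists>s'<4. cell_dim s' < cell_dim s \<and> torus_rep (h z) \<in> cell_shape s'"
      using cell_map_exists[OF s(1)] by (elim exE conjE) (rule that; blast)
    let ?\<Phi> = "glued_point Q i \<circ> h"
    have cont: "continuous_map (top_of_set ?D) (glued_surface Q) ?\<Phi>"
      by (rule continuous_map_compose[OF _ continuous_map_glued_point[OF i(1)]]) (use h in auto)
    have img: "?\<Phi> ` (?D \<inter> ball 0 1) = e" using h(4) i(2) by (simp only: glued_cell_def image_comp[symmetric])
    have inj: "inj_on ?\<Phi> (?D \<inter> ball 0 1)"
    proof (rule comp_inj_on[OF h(3)])
      show "inj_on (glued_point Q i) (h ` (?D \<inter> ball 0 1))"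
        unfolding h(4) using glued_cell_point_eq[OF i(1) i(1) _ _ s(1) s(1)] by (auto intro!: inj_onI)
    qed
    have bd: "\<exists>e'\<in>C. dm e' < dm e \<and> ?\<Phi> z \<in> e'" if z: "z \<in> ?D \<inter> sphere 0 1" for z
    proof -
      obtain s' where s': "s' < 4" "cell_dim s' < cell_dim s" "torus_rep (h z) \<in> cell_shape s'" using h(5)[OF z] by blast
      have "h z \<in> unit_square" using h(2) z by blast
      then have "?\<Phi> z \<in> glued_cell Q s' (edge_shift Q (h z) i)" using mem_glued_cell[OF i(1) _ s'(3)] by simp
      moreover have m: "glued_cell Q s' (edge_shift Q (h z) i) \<in> cells s'" using i(1) by (simp add: cells_def)
      moreover have "dm (glued_cell Q s' (edge_shift Q (h z) i)) < dm e" using dm[OF m s'(1)] de s'(2) by simp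
      ultimately show ?thesis using s'(1) unfolding C_def by blast
    qed
    have "?\<Phi> ` (?D \<inter> sphere 0 1) \<inter> ?\<Phi> ` (?D \<inter> ball 0 1) = {}"
    proof -
      have False if z: "z \<in> ?D \<inter> sphere 0 1" and "?\<Phi> z \<in> e" for z
      proof -
        obtain e' where e': "e' \<in> C" "dm e' < dm e" "?\<Phi> z \<in> e'" using bd[OF z] by blast
        then obtain s' j where "s' < 4" "j < squares Q" "e' = glued_cell Q s' j" unfolding C_def cells_def by blast
        then have "e' = e" using glued_cells_disjoint[OF i(1) _ s(1), of j s'] e' \<open>?\<Phi> z \<in> e\<close> i(2) by blast
        then show False using e' by simp
      qed
      then show ?thesis unfolding img by blast
    qed
    then have "homeomorphic_map (top_of_set (?D \<inter> ball 0 1)) (subtopology (glued_surface Q) e) ?\<Phi>"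
      using closed_cell_homeomorphic_map[OF cont Hausdorff_glued_surface inj] img by simp
    moreover have "?\<Phi> ` (?D \<inter> sphere 0 1) \<subseteq> \<Union>{e' \<in> C. dm e' < dm e}" using bd by blast
    ultimately show "\<exists>\<Phi>. continuous_map (top_of_set (closed_cell (dm e))) (glued_surface Q) \<Phi> \<and>
             homeomorphic_map (top_of_set (closed_cell (dm e) \<inter> ball 0 1)) (subtopology (glued_surface Q) e) \<Phi> \<and>
             \<Phi> ` (closed_cell (dm e) \<inter> sphere 0 1) \<subseteq> \<Union>{e' \<in> C. dm e' < dm e}"
      unfolding de using cont by blast
  qed
  have fin: "finite (cells s)" for s by (simp add: cells_def)
  have card0: "card (cells 0) = card (vertices Q)"
  proof -
    have "cells 0 = (\<lambda>v. {v}) ` vertices Q" unfolding cells_def glued_cell_0 vertices_eq by auto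
    then show ?thesis by (simp add: card_image)
  qed
  have cards: "card (cells s) = squares Q" if s: "s < 4" "s \<noteq> 0" for s
  proof -
    have "inj_on (glued_cell Q s) {..<squares Q}"
    proof (rule inj_onI)
      fix i j assume ij: "i \<in> {..<squares Q}" "j \<in> {..<squares Q}" "glued_cell Q s i = glued_cell Q s j"
      obtain z where z: "z \<in> cell_shape s" using cell_shape_nonempty[OF s(1)] by blast
      then obtain w where "w \<in> cell_shape s" "glued_point Q i z = glued_point Q j w"
        using ij(3) unfolding glued_cell_def by blast
      then show "i = j" using glued_cell_point_eq[of i j z s w s] ij z s by simp
    qed
    then show ?thesis by (simp add: cells_def card_image)
  qed
  have "(\<Sum>e\<in>C. (- 1 :: int) ^ dm e) = (\<Sum>s<4. \<Sum>e\<in>cells s. (- 1) ^ dm e)"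
    unfolding C_def using cells_disj fin by (intro sum.UNION_disjoint) auto
  also have "\<dots> = (\<Sum>s<4. \<Sum>e\<in>cells s. (- 1) ^ cell_dim s)"
    by (intro sum.cong refl) (simp add: dm)
  also have "\<dots> = (\<Sum>s<4. int (card (cells s)) * (- 1) ^ cell_dim s)" by simp
  also have "\<dots> = int (card (vertices Q)) - int (squares Q)"
    by (simp add: eval_nat_numeral lessThan_Suc cell_dim_def card0 cards)
  finally show ?thesis using CD assms unfolding has_genus_def by metis
qed

text \<open>Each square is counted at its lower left vertex. A vertex consists of four corners for
  each square of its commutator orbit, which explains \<open>card v div 4\<close>; vertices of angle
  \<open>2 * pi\<close> contribute 0.\<close>

lemma card_vertices:
  "int (card (vertices Q)) = int (squares Q) -
     (\<Sum>v\<in>singular_vertices Q. int (card v div 4) - 1)"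
proof -
  let ?f = "\<lambda>i. glued_point Q i 0"
  have V: "vertices Q = ?f ` {..<squares Q}" by (auto simp: vertices_eq)
  have fib: "card {i \<in> {..<squares Q}. ?f i = v} = card v div 4" if v: "v \<in> vertices Q" for v
  proof -
    obtain j where j: "j < squares Q" "v = ?f j" using v unfolding vertices_eq by blast
    have "{i \<in> {..<squares Q}. ?f i = v} = orbit (commutator Q) j"
      using j glued_vertex_eq_iff commutator_orbit_subset[OF j(1)] by auto
    then show ?thesis using card_glued_vertex[OF j(1)] j(2) by simp
  qed
  have "int (squares Q) = (\<Sum>i<squares Q. 1)" by simp
  also have "\<dots> = (\<Sum>v\<in>vertices Q. \<Sum>i\<in>{i \<in> {..<squares Q}. ?f i = v}. 1)"
    by (rule sum.group[symmetric]) (auto simp: V)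
  also have "\<dots> = (\<Sum>v\<in>vertices Q. int (card v div 4))" by (intro sum.cong refl) (simp add: fib[simplified])
  finally have "int (squares Q) - int (card (vertices Q)) = (\<Sum>v\<in>vertices Q. int (card v div 4) - 1)"
    by (simp add: sum_subtractf)
  also have "\<dots> = (\<Sum>v\<in>singular_vertices Q. int (card v div 4) - 1)"
  proof (rule sum.mono_neutral_right)
    show "finite (vertices Q)" unfolding V by simp
    show "singular_vertices Q \<subseteq> vertices Q" by (auto simp: singular_vertices_def)
    show "\<forall>v\<in>vertices Q - singular_vertices Q. int (card v div 4) - 1 = 0"
    proof
      fix v assume v: "v \<in> vertices Q - singular_vertices Q"
      then obtain i where i: "i < squares Q" "v = ?f i" unfolding vertices_eq by blast
      then have "commutator Q i = i" using v unfolding singular_vertices_eq by blast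
      then have "orbit (commutator Q) i = {i}" by (simp add: orbit_eq_singleton_iff)
      then show "int (card v div 4) - 1 = 0" using card_glued_vertex[OF i(1)] i(2) by simp
    qed
  qed
  finally show ?thesis by linarith
qed

text \<open>A commutator cycle of length \<open>\<alpha> i + 1\<close> gives a cone point of that
  order. By the vertex count the lengths minus one add up to the number of squares minus the number
  of vertices, so the Euler characteristic is \<open>2 - 2 * g\<close>.\<close>

theorem origami_in_stratum:
  assumes tr: "transitive_gluing Q" and g: "g \<ge> 1" and sum: "(\<Sum>i=1..n. \<alpha> i) = 2 * g - 2"
    and Z: "bij_betw Z {1..n} {orbit (commutator Q) i | i. i < squares Q \<and> commutator Q i \<noteq> i}"
    and card: "\<And>i. i \<in> {1..n} \<Longrightarrow> card (Z i) = \<alpha> i + 1"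
  shows "origami_surface Q \<in> stratum g n \<alpha>"
proof -
  let ?O = "{orbit (commutator Q) i | i. i < squares Q \<and> commutator Q i \<noteq> i}"
  let ?v = "\<lambda>S. glued_point Q (SOME i. i \<in> S) 0"
  have v: "?v (orbit (commutator Q) i) = glued_point Q i 0" if "i < squares Q" for i
  proof -
    have "(SOME j. j \<in> orbit (commutator Q) i) \<in> orbit (commutator Q) i"
      using permutation_self_in_orbit[OF permutation_commutator] by (rule someI)
    then show ?thesis using glued_point_orbit[OF _ that] by blast
  qed
  have "bij_betw ?v ?O (singular_vertices Q)"
    unfolding bij_betw_def
  proof
    show "inj_on ?v ?O"
    proof (rule inj_onI)
      fix S T assume "S \<in> ?O" "T \<in> ?O" and eq: "?v S = ?v T"
      then obtain i j where ij: "i < squares Q" "j < squares Q" "S = orbit (commutator Q) i" "T = orbit (commutator Q) j"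
        by blast
      then have "glued_point Q i 0 = glued_point Q j 0" using eq v by simp
      then have "i \<in> orbit (commutator Q) j" using glued_vertex_eq_iff ij(1,2) by blast
      then show "S = T" unfolding ij by (simp only: orbit_eq_iff)
    qed
    show "?v ` ?O = singular_vertices Q"
      unfolding singular_vertices_eq using v by (auto simp: image_iff)
  qed
  then have bij: "bij_betw (?v \<circ> Z) {1..n} (singular_vertices Q)" using Z bij_betw_trans by blast
  have pt: "cone_point (origami_surface Q) ((?v \<circ> Z) i) (\<alpha> i + 1) \<and> card ((?v \<circ> Z) i) div 4 = \<alpha> i + 1"
    if i: "i \<in> {1..n}" for i
  proof -
    have "Z i \<in> ?O" using bij_betw_apply[OF Z i] .
    then obtain j where j: "j < squares Q" "Z i = orbit (commutator Q) j" by blast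
    then have "(?v \<circ> Z) i = glued_point Q j 0" using v by simp
    then show ?thesis using cone_point_vertex[OF j(1)] card_glued_vertex[OF j(1)] card[OF i] j(2) by simp
  qed
  have "(\<Sum>v\<in>singular_vertices Q. int (card v div 4) - 1) = (\<Sum>i=1..n. int (card ((?v \<circ> Z) i) div 4) - 1)"
    by (rule sum.reindex_bij_betw[OF bij, symmetric])
  also have "\<dots> = (\<Sum>i=1..n. int (\<alpha> i))" by (intro sum.cong refl) (use pt in simp)
  also have "\<dots> = int (2 * g - 2)" by (simp flip: sum of_nat_sum)
  finally have "has_genus (glued_surface Q) g"
    using card_vertices g by (intro has_genus_glued_surface) simp
  then show ?thesis
    unfolding stratum_def using translation_surface_origami[OF tr] bij pt
    by (auto simp: origami_surface_def)
qed

end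

section \<open>The projection to the torus\<close>

text \<open>The torus is realised as a product of two unit circles, so that translations of the
  torus become multiplications.\<close>

definition torus_exp :: "complex \<Rightarrow> complex \<times> complex" where
  "torus_exp z = (cis (2 * pi * Re z), cis (2 * pi * Im z))"

definition torus_mult :: "complex \<times> complex \<Rightarrow> complex \<times> complex \<Rightarrow> complex \<times> complex" where
  "torus_mult a b = (fst a * fst b, snd a * snd b)"

definition torus_proj :: "(nat \<times> complex) set \<Rightarrow> complex \<times> complex" where
  "torus_proj = glued_lift (\<lambda>i. torus_exp)"

lemma torus_exp_add: "torus_exp (z + w) = torus_mult (torus_exp z) (torus_exp w)"
  by (simp add: torus_exp_def torus_mult_def cis_mult algebra_simps)

lemma torus_exp_0 [simp]: "torus_exp 0 = (1, 1)"
  by (simp add: torus_exp_def)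

lemma torus_mult_one [simp]: "torus_mult (1, 1) a = a" "torus_mult a (1, 1) = a"
  by (simp_all add: torus_mult_def)

lemma torus_mult_assoc: "torus_mult (torus_mult a b) c = torus_mult a (torus_mult b c)"
  by (simp_all add: torus_mult_def ac_simps)

lemma torus_exp_eq_one_iff: "torus_exp z = (1, 1) \<longleftrightarrow> Re z \<in> \<int> \<and> Im z \<in> \<int>"
proof -
  have "cis (2 * pi * x) = 1 \<longleftrightarrow> x \<in> \<int>" for x
  proof -
    have "cis (2 * pi * x) = 1 \<longleftrightarrow> cos (2 * pi * x) = 1 \<and> sin (2 * pi * x) = 0"
      by (simp add: complex_eq_iff)
    also have "\<dots> \<longleftrightarrow> cos (2 * pi * x) = 1"
      by (auto dest: cos_one_sin_zero)
    also have "\<dots> \<longleftrightarrow> (\<exists>n::int. 2 * pi * x = of_int n * 2 * pi)"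
      using cos_one_2pi_int[of "2 * pi * x"] by simp
    also have "\<dots> \<longleftrightarrow> x \<in> \<int>" by (auto simp: Ints_def)
    finally show ?thesis .
  qed
  then show ?thesis by (simp add: torus_exp_def)
qed

lemma torus_exp_neg: "torus_mult (torus_exp (- z)) (torus_exp z) = (1, 1)"
  by (simp flip: torus_exp_add)

lemma torus_exp_eq_iff: "torus_exp z = torus_exp w \<longleftrightarrow> Re z - Re w \<in> \<int> \<and> Im z - Im w \<in> \<int>"
proof -
  have "torus_exp z = torus_exp w \<longleftrightarrow> torus_exp (z - w) = (1, 1)"
  proof
    assume "torus_exp z = torus_exp w"
    then show "torus_exp (z - w) = (1, 1)"
      using torus_exp_add[of "- w" z] torus_exp_neg[of w] by simp
  next
    assume "torus_exp (z - w) = (1, 1)"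
    then show "torus_exp z = torus_exp w" using torus_exp_add[of "z - w" w] by simp
  qed
  then show ?thesis by (simp add: torus_exp_eq_one_iff)
qed

lemma continuous_on_torus_exp: "continuous_on S torus_exp"
  unfolding torus_exp_def cis_conv_exp by (intro continuous_intros)

lemma locally_constant_imp_constant:
  assumes X: "connected_space X" and loc: "\<And>x. x \<in> topspace X \<Longrightarrow> \<exists>W. openin X W \<and> x \<in> W \<and> (\<forall>y\<in>W. f y = f x)"
    and xy: "x \<in> topspace X" "y \<in> topspace X"
  shows "f x = f y"
proof -
  let ?A = "{z \<in> topspace X. f z = f x}" and ?B = "{z \<in> topspace X. f z \<noteq> f x}"
  have op: "openin X {z \<in> topspace X. P (f z)}" for P
  proof (subst openin_subopen, intro ballI)
    fix z assume z: "z \<in> {z \<in> topspace X. P (f z)}"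
    then obtain W where W: "openin X W" "z \<in> W" "\<forall>y\<in>W. f y = f z" using loc by blast
    have "P (f y)" if "y \<in> W" for y using W(3)[rule_format, OF that] z by simp
    then show "\<exists>T. openin X T \<and> z \<in> T \<and> T \<subseteq> {z \<in> topspace X. P (f z)}"
      using W(1,2) openin_subset[OF W(1)] by blast
  qed
  have "openin X ?A" "openin X ?B" using op[of "\<lambda>v. v = f x"] op[of "\<lambda>v. v \<noteq> f x"] by simp_all
  moreover have "topspace X \<subseteq> ?A \<union> ?B" "?A \<inter> ?B = {}" "?A \<noteq> {}" using xy by auto
  ultimately have *: "\<exists>A B. openin X A \<and> openin X B \<and> topspace X \<subseteq> A \<union> B \<and> A \<inter> B = {} \<and> A \<noteq> {} \<and> B \<noteq> {}"
    if "?B \<noteq> {}" using that by (rule_tac exI[of _ ?A], rule_tac exI[of _ ?B]) simp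
  have "?B = {}"
  proof (rule ccontr)
    assume "?B \<noteq> {}"
    from *[OF this] show False using X[unfolded connected_space_def] by (rule rev_notE)
  qed
  then have "y \<notin> ?B" by (simp only: empty_iff not_False_eq_True)
  then show ?thesis using xy(2) by simp
qed

context square_gluing
begin

lemma torus_proj_glued_point:
  assumes "i < squares Q" "z \<in> unit_square"
  shows "torus_proj (glued_point Q i z) = torus_exp z"
  unfolding torus_proj_def
  by (rule glued_lift[OF _ assms]) (auto simp: edge_pairs_def torus_exp_def)

lemma torus_proj_singular:
  assumes "x \<in> singular_vertices Q"
  shows "torus_proj x = (1, 1)"
  using assms torus_proj_glued_point[of _ 0] unfolding singular_vertices_eq by (auto simp: unit_square_iff)

lemma continuous_torus_proj: "continuous_map (glued_surface Q) euclidean torus_proj"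
  unfolding continuous_map_def
proof (intro conjI allI impI)
  fix V :: "(complex \<times> complex) set" assume V: "openin euclidean V"
  show "openin (glued_surface Q) {x \<in> topspace (glued_surface Q). torus_proj x \<in> V}"
    unfolding openin_glued_surface_iff
  proof (intro conjI allI impI ballI)
    fix i z assume i: "i < squares Q" "z \<in> unit_square" "glued_point Q i z \<in> {x \<in> topspace (glued_surface Q). torus_proj x \<in> V}"
    have "open (torus_exp -` V)" using continuous_on_torus_exp V
      by (metis continuous_on_open_vimage open_UNIV open_openin Int_UNIV_right)
    moreover have "z \<in> torus_exp -` V" using i torus_proj_glued_point by auto
    ultimately obtain e where "e > 0" "ball z e \<subseteq> torus_exp -` V" using open_contains_ball by blast
    then show "\<exists>e>0. \<forall>w\<in>unit_square. dist w z < e \<longrightarrow> glued_point Q i w \<in> {x \<in> topspace (glued_surface Q). torus_proj x \<in> V}"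
      using i(1) torus_proj_glued_point by (intro exI[of _ e]) (auto simp: dist_commute subset_iff)
  qed auto
qed auto

lemma torus_proj_chart:
  assumes U: "(U, \<phi>) \<in> origami_atlas Q" and x: "x \<in> U"
  shows "\<exists>W. openin (regular_part (origami_surface Q)) W \<and> x \<in> W \<and> W \<subseteq> U \<and>
    (\<forall>y\<in>W. torus_proj y = torus_mult (torus_exp (\<phi> y - \<phi> x)) (torus_proj x))"
proof -
  have Uo: "openin (glued_surface Q) U" "U \<inter> singular_vertices Q = {}" using U by (auto simp: origami_atlas_def)
  obtain i z where i: "i < squares Q" "z \<in> unit_square" "x = glued_point Q i z"
    using openin_subset[OF Uo(1)] x unfolding topspace_glued_surface by blast
  obtain e where e: "e > 0" "e \<le> boundary_gap z" "\<And>j y w. (j, y) \<in> x \<Longrightarrow> w \<in> unit_square \<Longrightarrow>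
      dist w y < e \<Longrightarrow> glued_point Q j w \<in> U \<and> \<phi> (glued_point Q j w) = \<phi> x + (w - y)"
    using atlas_star[OF U i(1,2)] x i(3) by blast
  have W: "y \<in> U \<and> torus_proj y = torus_mult (torus_exp (\<phi> y - \<phi> x)) (torus_proj x)" if y: "y \<in> star Q x e" for y
  proof -
    obtain j v w where j: "y = glued_point Q j w" "(j, v) \<in> x" "w \<in> unit_square" "dist w v < e"
      using y unfolding star_def by blast
    have v: "j < squares Q" "v \<in> unit_square" "glued_point Q j v = x" using j(2) i by (auto simp: mem_glued_point_iff)
    have "torus_proj y = torus_exp (w - v + v)" using j v torus_proj_glued_point by simp
    also have "\<dots> = torus_mult (torus_exp (w - v)) (torus_proj x)"
      unfolding torus_exp_add using v torus_proj_glued_point by metis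
    finally show ?thesis using e(3)[OF j(2-4)] j(1) by simp
  qed
  then have "star Q x e \<inter> singular_vertices Q = {}" using Uo by blast
  then have "openin (regular_part (origami_surface Q)) (star Q x e)"
    using openin_regular_part openin_star[OF i(1,2) e(2)] i(3) by simp
  then show ?thesis using W center_in_star[OF i(1,2) e(1)] i(3) by (intro exI[of _ "star Q x e"]) blast
qed

lemma finite_torus_fibre:
  assumes z: "0 < Re z" "Re z < 1" "0 < Im z" "Im z < 1"
  shows "{x \<in> topspace (glued_surface Q). torus_proj x = torus_exp z} = (\<lambda>i. glued_point Q i z) ` {..<squares Q}"
    and "inj_on (\<lambda>i. glued_point Q i z) {..<squares Q}"
    and "(\<lambda>i. glued_point Q i z) ` {..<squares Q} \<subseteq> topspace (regular_part (origami_surface Q))"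
proof -
  have zs: "z \<in> unit_square" using z by (simp add: unit_square_iff)
  have uniq: "w = z" if "w \<in> unit_square" "torus_exp w = torus_exp z" for w
  proof -
    have "Re w - Re z \<in> \<int>" "Im w - Im z \<in> \<int>" using that(2) by (auto simp: torus_exp_eq_iff)
    moreover have "\<bar>Re w - Re z\<bar> < 1" "\<bar>Im w - Im z\<bar> < 1" using that(1) z by (auto simp: unit_square_iff)
    ultimately have "Re w - Re z = 0" "Im w - Im z = 0" using Ints_nonzero_abs_less1 by blast+
    then show ?thesis by (simp add: complex_eq_iff)
  qed
  show "{x \<in> topspace (glued_surface Q). torus_proj x = torus_exp z} = (\<lambda>i. glued_point Q i z) ` {..<squares Q}"
  proof (rule equalityI; rule subsetI)
    fix x assume "x \<in> {x \<in> topspace (glued_surface Q). torus_proj x = torus_exp z}"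
    then have x: "x \<in> topspace (glued_surface Q)" "torus_proj x = torus_exp z" by simp_all
    then obtain i w where i: "i < squares Q" "w \<in> unit_square" "x = glued_point Q i w"
      unfolding topspace_glued_surface by blast
    then have "w = z" using x(2) torus_proj_glued_point uniq by simp
    then show "x \<in> (\<lambda>i. glued_point Q i z) ` {..<squares Q}" using i by simp
  next
    fix x assume "x \<in> (\<lambda>i. glued_point Q i z) ` {..<squares Q}"
    then show "x \<in> {x \<in> topspace (glued_surface Q). torus_proj x = torus_exp z}"
      using zs torus_proj_glued_point by auto
  qed
  have tz: "torus_rep z = z" using z by (simp add: torus_rep_def)
  moreover have "edge_shift Q z l = l" for l using edge_shift_torus_rep[of Q z l] tz by simp
  moreover have "z \<noteq> 0" using z by auto
  ultimately show "inj_on (\<lambda>i. glued_point Q i z) {..<squares Q}"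
    using zs by (auto intro!: inj_onI simp: glued_point_eq_iff normal_form_def)
  have "glued_point Q i z \<notin> singular_vertices Q" if "i < squares Q" for i
    using singular_glued_point[OF that zs] z by auto
  then show "(\<lambda>i. glued_point Q i z) ` {..<squares Q} \<subseteq> topspace (regular_part (origami_surface Q))"
    using zs by (auto simp: topspace_regular_part)
qed

text \<open>Two points symmetric about 1/2 at distance \<open>frac a\<close>. They provide a generic
  point of the torus whose translate by a given vector is generic too.\<close>

lemma interval_shift_exists: "\<exists>x y. 0 < x \<and> x < 1 \<and> 0 < y \<and> y < 1 \<and> y - x - a \<in> \<int>" for a :: real
proof (rule exI[of _ "(1 - frac a) / 2"], rule exI[of _ "(1 + frac a) / 2"], intro conjI)
  have "(1 + frac a) / 2 - (1 - frac a) / 2 - a = - of_int \<lfloor>a\<rfloor>" by (simp add: frac_def field_simps)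
  then show "(1 + frac a) / 2 - (1 - frac a) / 2 - a \<in> \<int>" by simp
qed (use frac_ge_0[of a] frac_lt_1[of a] in \<open>simp_all del: frac_ge_0 frac_lt_1\<close>)

text \<open>A translation commutes with the projections to the torus up to a translation of the torus,
  and the generic fibre has as many points as there are squares.\<close>

lemma translation_imp_squares_le:
  assumes P: "square_gluing P" and trP: "transitive_gluing P"
    and f: "affine_homeo (mat 1) (origami_surface P) (origami_surface Q) f"
  shows "squares P \<le> squares Q"
proof -
  interpret P: square_gluing P by fact
  let ?X = "regular_part (origami_surface P)"
  have hom: "homeomorphic_map ?X (regular_part (origami_surface Q)) f" using f by (simp add: affine_homeo_def)
  have conn: "connected_space ?X" using P.translation_surface_origami[OF trP] by (simp add: translation_surface_def)
  define D where "D x = torus_proj (f x)" for x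
  \<comment> \<open>The quotient of the torus points of \<open>f x\<close> and \<open>x\<close>, as
    conjugation inverts unit complex numbers. A translation moves both by the same vector, so the
    quotient is locally constant.\<close>
  define q where "q x = (fst (D x) * cnj (fst (torus_proj x)), snd (D x) * cnj (snd (torus_proj x)))" for x
  have cis_unit: "cis a * cnj (cis a) = 1" "cnj (cis a) * cis a = 1" for a by (simp_all add: cis_cnj cis_mult)
  have cancel: "(cis a * d) * cnj (cis a * t) = d * cnj t" for a d t
  proof -
    have "(cis a * d) * cnj (cis a * t) = (cis a * cnj (cis a)) * (d * cnj t)" by (simp only: complex_cnj_mult ac_simps)
    then show ?thesis by (simp only: cis_unit mult_1)
  qed
  have fx: "f x \<in> topspace (regular_part (origami_surface Q))" if "x \<in> topspace ?X" for x
    using homeomorphic_imp_surjective_map[OF hom] that by blast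
  have loc: "\<exists>W. openin ?X W \<and> x \<in> W \<and> (\<forall>y\<in>W. q y = q x)" if x: "x \<in> topspace ?X" for x
  proof -
    obtain U \<phi> where U: "(U, \<phi>) \<in> origami_atlas P" "x \<in> U" using P.atlas_covers[OF x] by blast
    obtain V \<psi> where V: "(V, \<psi>) \<in> origami_atlas Q" "f x \<in> V" using atlas_covers[OF fx[OF x]] by blast
    obtain b W where W: "openin ?X W" "x \<in> W" "W \<subseteq> U" "f ` W \<subseteq> V" "\<forall>y\<in>W. \<psi> (f y) = \<phi> y + b"
      using affine_homeoD[OF f, of U \<phi> V \<psi> x] U V by (auto simp: origami_surface_def)
    obtain W1 where W1: "openin ?X W1" "x \<in> W1" "W1 \<subseteq> U"
      "\<forall>y\<in>W1. torus_proj y = torus_mult (torus_exp (\<phi> y - \<phi> x)) (torus_proj x)"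
      using P.torus_proj_chart[OF U] by blast
    obtain W2 where W2: "openin (regular_part (origami_surface Q)) W2" "f x \<in> W2" "W2 \<subseteq> V"
      "\<forall>y\<in>W2. torus_proj y = torus_mult (torus_exp (\<psi> y - \<psi> (f x))) (torus_proj (f x))"
      using torus_proj_chart[OF V] by blast
    let ?W = "W \<inter> W1 \<inter> {y \<in> topspace ?X. f y \<in> W2}"
    have oW: "openin ?X ?W"
      using W(1) W1(1) W2(1) homeomorphic_imp_continuous_map[OF hom] by (intro openin_Int) (auto simp: continuous_map_def)
    have qW: "q y = q x" if "y \<in> ?W" for y
    proof -
      have y: "y \<in> W" "y \<in> W1" "f y \<in> W2" using that by auto
      have "\<psi> (f y) - \<psi> (f x) = \<phi> y - \<phi> x" using W(5)[rule_format, OF y(1)] W(5)[rule_format, OF W(2)] by simp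
      then have "torus_proj y = torus_mult (torus_exp (\<phi> y - \<phi> x)) (torus_proj x)"
        "D y = torus_mult (torus_exp (\<phi> y - \<phi> x)) (D x)"
        using W1(4)[rule_format, OF y(2)] W2(4)[rule_format, OF y(3)] by (simp_all only: D_def)
      then show ?thesis
        by (simp only: q_def torus_mult_def torus_exp_def fst_conv snd_conv cancel)
    qed
    have xW: "x \<in> ?W" using x W(2) W1(2) W2(2) by simp
    show ?thesis
    proof (rule exI[of _ ?W], rule conjI[OF oW], rule conjI[OF xW], rule ballI)
      show "q y = q x" if "y \<in> ?W" for y by (rule qW[OF that])
    qed
  qed
  have N: "0 < squares P" using trP by (simp add: transitive_gluing_def)
  have gp: "glued_point P i z \<in> topspace ?X" if "i < squares P" "0 < Re z" "Re z < 1" "0 < Im z" "Im z < 1" for i z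
    using P.finite_torus_fibre(3)[OF that(2-5)] that(1) by blast
  let ?a = "Complex (1/2) (1/2)"
  have a: "glued_point P 0 ?a \<in> topspace ?X" by (rule gp) (use N in auto)
  obtain j v where j: "j < squares Q" "v \<in> unit_square" "f (glued_point P 0 ?a) = glued_point Q j v"
    using fx[OF a] unfolding topspace_regular_part topspace_glued_surface by blast
  have Dv: "D (glued_point P 0 ?a) = torus_exp v" using j torus_proj_glued_point by (simp add: D_def)
  have key: "D x = torus_mult (torus_exp (v - ?a)) (torus_proj x)"
    if x: "x \<in> topspace ?X" "torus_proj x = torus_exp w" for x w
  proof -
    have "q x = q (glued_point P 0 ?a)" by (rule locally_constant_imp_constant[OF conn loc x(1) a])
    moreover have "torus_proj (glued_point P 0 ?a) = torus_exp ?a"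
      using P.torus_proj_glued_point[OF N] by (simp add: unit_square_iff)
    ultimately have q: "fst (D x) * cnj (cis (2 * pi * Re w)) = cis (2 * pi * Re v) * cnj (cis (2 * pi * Re ?a))"
      "snd (D x) * cnj (cis (2 * pi * Im w)) = cis (2 * pi * Im v) * cnj (cis (2 * pi * Im ?a))"
      by (simp_all add: q_def Dv torus_exp_def x(2))
    have "fst (D x) = fst (D x) * cnj (cis (2 * pi * Re w)) * cis (2 * pi * Re w)"
      "snd (D x) = snd (D x) * cnj (cis (2 * pi * Im w)) * cis (2 * pi * Im w)" by (simp_all only: mult.assoc cis_unit mult_1_right)
    then have "fst (D x) = cis (2 * pi * Re v) * cnj (cis (2 * pi * Re ?a)) * cis (2 * pi * Re w)"
      "snd (D x) = cis (2 * pi * Im v) * cnj (cis (2 * pi * Im ?a)) * cis (2 * pi * Im w)" by (simp_all only: q)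
    \<comment> \<open>The base point has both coordinates 1/2, whose image on the circle is
      \<open>cis pi\<close>.\<close>
    moreover have "cis (r - pi) = - cis r" for r by (simp add: complex_eq_iff)
    ultimately show ?thesis
      unfolding x(2) by (intro prod_eqI) (simp_all add: torus_mult_def torus_exp_def cis_cnj cis_mult algebra_simps)
  qed
  \<comment> \<open>All coordinates of \<open>z\<close> and of its translate \<open>w\<close> must
    be strictly between 0 and 1: over such points each square contributes exactly one point to the
    fibre.\<close>
  obtain x1 y1 where 1: "0 < x1" "x1 < 1" "0 < y1" "y1 < 1" "y1 - x1 - Re (v - ?a) \<in> \<int>"
    using interval_shift_exists by blast
  obtain x2 y2 where 2: "0 < x2" "x2 < 1" "0 < y2" "y2 < 1" "y2 - x2 - Im (v - ?a) \<in> \<int>"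
    using interval_shift_exists by blast
  define z w where "z = Complex x1 x2" and "w = Complex y1 y2"
  have zw: "0 < Re z" "Re z < 1" "0 < Im z" "Im z < 1" "0 < Re w" "Re w < 1" "0 < Im w" "Im w < 1"
    using 1 2 by (auto simp: z_def w_def)
  have e: "torus_mult (torus_exp (v - ?a)) (torus_exp z) = torus_exp w"
  proof -
    have e: "Re w - Re (v - ?a + z) = y1 - x1 - Re (v - ?a)" "Im w - Im (v - ?a + z) = y2 - x2 - Im (v - ?a)"
      by (simp_all add: z_def w_def)
    have "torus_exp w = torus_exp (v - ?a + z)" unfolding torus_exp_eq_iff e using 1(5) 2(5) by (rule conjI)
    then show ?thesis by (simp only: torus_exp_add)
  qed
  let ?F = "(\<lambda>i. glued_point P i z) ` {..<squares P}" and ?G = "(\<lambda>i. glued_point Q i w) ` {..<squares Q}"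
  have "f ` ?F \<subseteq> ?G"
  proof
    fix y assume "y \<in> f ` ?F"
    then obtain i where i: "i < squares P" "y = f (glued_point P i z)" by blast
    have x: "glued_point P i z \<in> topspace ?X" by (rule gp[OF i(1) zw(1-4)])
    have "torus_proj (glued_point P i z) = torus_exp z"
      using P.torus_proj_glued_point[OF i(1)] zw by (simp add: unit_square_iff)
    then have "torus_proj y = torus_exp w" using key[OF x] e i(2) by (simp add: D_def)
    moreover have "y \<in> topspace (glued_surface Q)" using fx[OF x] i(2) by (simp add: topspace_regular_part)
    ultimately show "y \<in> ?G" using finite_torus_fibre(1)[OF zw(5-8)] by blast
  qed
  moreover have "inj_on f ?F"
    using homeomorphic_imp_injective_map[OF hom] P.finite_torus_fibre(3)[OF zw(1-4)] inj_on_subset by blast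
  ultimately have "card ?F \<le> card ?G" by (intro card_inj_on_le) auto
  moreover have "card ?F = squares P" using card_image[OF P.finite_torus_fibre(2)[OF zw(1-4)]] by simp
  moreover have "card ?G = squares Q" using card_image[OF finite_torus_fibre(2)[OF zw(5-8)]] by simp
  ultimately show ?thesis by simp
qed

end

lemma translation_equivalent_imp_squares_eq:
  assumes "square_gluing P" "transitive_gluing P" "square_gluing Q" "transitive_gluing Q"
    and eq: "translation_equivalent (origami_surface P) (origami_surface Q)"
  shows "squares P = squares Q"
proof -
  interpret P: square_gluing P by fact
  interpret Q: square_gluing Q by fact
  obtain f where f: "affine_homeo (mat 1) (origami_surface P) (origami_surface Q) f"
    using eq unfolding translation_equivalent_def by blast
  obtain g where "affine_homeo (mat 1) (origami_surface Q) (origami_surface P) g"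
    using affine_homeo_inverse[OF f _ P.translation_atlas_origami Q.translation_atlas_origami, of "mat 1"] by auto
  then show ?thesis
    using Q.translation_imp_squares_le[OF assms(1,2) f] P.translation_imp_squares_le[OF assms(3,4)] by force
qed

section \<open>Saddle connections and the Veech group\<close>

text \<open>The image of a saddle connection under an affine homeomorphism leaves every compact subset of
  the regular part near its ends, so that it tends to singularities, which lie over \<open>0\<close> in the torus.\<close>

lemma affine_image_of_saddle_connection:
  assumes P: "square_gluing P" and Q: "square_gluing Q"
    and f: "affine_homeo A (origami_surface P) (origami_surface Q) f"
    and \<gamma>: "saddle_connection (origami_surface P) \<gamma> v"
  shows "torus_exp (plane_map A v) = (1, 1)"
proof -
  interpret P: square_gluing P by fact
  interpret Q: square_gluing Q by fact
  let ?X = "glued_surface P" and ?Y = "glued_surface Q"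
  let ?RX = "regular_part (origami_surface P)" and ?RY = "regular_part (origami_surface Q)"
  let ?I = "{0<..<1::real}"
  have RX: "?RX = subtopology ?X (topspace ?X - singular_vertices P)"
    and RY: "?RY = subtopology ?Y (topspace ?Y - singular_vertices Q)"
    by (simp_all add: regular_part_def origami_surface_def)
  have hom: "homeomorphic_map ?RX ?RY f" using f by (simp add: affine_homeo_def)
  then obtain g where g: "homeomorphic_maps ?RX ?RY f g" unfolding homeomorphic_map_maps by blast
  have contg: "continuous_map ?RY ?RX g" and gf: "\<And>x. x \<in> topspace ?RX \<Longrightarrow> g (f x) = x"
    using g by (auto simp: homeomorphic_maps_def)
  have contf: "continuous_map ?RX ?RY f" by (rule homeomorphic_imp_continuous_map[OF hom])
  have \<gamma>c: "continuous_map (top_of_set {0..1}) ?X \<gamma>"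
    and \<gamma>0: "\<gamma> 0 \<in> singular_vertices P" "\<gamma> 1 \<in> singular_vertices P"
    and \<gamma>r: "\<And>t. t \<in> ?I \<Longrightarrow> \<gamma> t \<notin> singular_vertices P"
    and \<gamma>l0: "\<forall>(U, \<phi>)\<in>origami_atlas P. \<forall>t\<in>?I. \<gamma> t \<in> U \<longrightarrow>
        (\<exists>c. \<exists>\<epsilon>>0. \<forall>s\<in>?I. \<bar>s - t\<bar> < \<epsilon> \<longrightarrow> \<gamma> s \<in> U \<and> \<phi> (\<gamma> s) = c + of_real s * v)"
    using \<gamma> unfolding saddle_connection_def origami_surface_def by simp_all
  have \<gamma>l: "\<exists>c. \<exists>\<epsilon>>0. \<forall>s\<in>?I. \<bar>s - t\<bar> < \<epsilon> \<longrightarrow> \<gamma> s \<in> U \<and> \<phi> (\<gamma> s) = c + of_real s * v"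
    if "(U, \<phi>) \<in> origami_atlas P" "t \<in> ?I" "\<gamma> t \<in> U" for U \<phi> t
    using bspec[OF \<gamma>l0 that(1), unfolded prod.case, rule_format, OF that(2,3)] .
  have \<gamma>X: "\<gamma> t \<in> topspace ?X" if "t \<in> {0..1}" for t
    using continuous_map_image_subset_topspace[OF \<gamma>c] that by auto
  have \<gamma>R: "\<gamma> t \<in> topspace ?RX" if "t \<in> ?I" for t using \<gamma>X[of t] \<gamma>r that by (simp add: P.topspace_regular_part)
  have cI: "continuous_map (top_of_set ?I) ?RX \<gamma>"
  proof -
    have "continuous_map (subtopology (top_of_set {0..1}) ?I) ?X \<gamma>" by (rule continuous_map_from_subtopology[OF \<gamma>c])
    moreover have "{0..1} \<inter> ?I = ?I" by auto
    ultimately show ?thesis unfolding RX using \<gamma>X \<gamma>r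
      by (auto simp: subtopology_subtopology continuous_map_in_subtopology)
  qed
  define w where "w = plane_map A v"
  \<comment> \<open>The image of the geodesic has velocity \<open>w\<close> in the charts, so its
    torus point divided by that of \<open>t * w\<close> is locally constant in
    \<open>t\<close>.\<close>
  define q where "q t = torus_mult (torus_exp (- (of_real t * w))) (torus_proj (f (\<gamma> t)))" for t
  have scale: "plane_map A (of_real r * v) = of_real r * w" for r
    by (simp add: w_def plane_map_def complex_eq_iff algebra_simps)
  have loc: "\<exists>W. openin (top_of_set ?I) W \<and> t \<in> W \<and> (\<forall>s\<in>W. q s = q t)" if t: "t \<in> topspace (top_of_set ?I)" for t
  proof -
    have tI: "t \<in> ?I" using t by simp
    have ft: "f (\<gamma> t) \<in> topspace ?RY" using homeomorphic_imp_surjective_map[OF hom] \<gamma>R[OF tI] by blast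
    obtain U \<phi> where U: "(U, \<phi>) \<in> origami_atlas P" "\<gamma> t \<in> U" using P.atlas_covers[OF \<gamma>R[OF tI]] by blast
    obtain V \<psi> where V: "(V, \<psi>) \<in> origami_atlas Q" "f (\<gamma> t) \<in> V" using Q.atlas_covers[OF ft] by blast
    obtain b W1 where W1: "openin ?RX W1" "\<gamma> t \<in> W1" "\<forall>y\<in>W1. \<psi> (f y) = plane_map A (\<phi> y) + b"
      using affine_homeoD[OF f, of U \<phi> V \<psi> "\<gamma> t"] U V by (auto simp: origami_surface_def)
    obtain W2 where W2: "openin ?RY W2" "f (\<gamma> t) \<in> W2"
      "\<forall>y\<in>W2. torus_proj y = torus_mult (torus_exp (\<psi> y - \<psi> (f (\<gamma> t)))) (torus_proj (f (\<gamma> t)))"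
      using Q.torus_proj_chart[OF V] by blast
    obtain c \<epsilon> where c: "\<epsilon> > 0" "\<And>s. s \<in> ?I \<Longrightarrow> \<bar>s - t\<bar> < \<epsilon> \<Longrightarrow> \<phi> (\<gamma> s) = c + of_real s * v"
      using \<gamma>l[OF U(1) tI U(2)] by blast
    define W where "W = {s \<in> ?I. \<gamma> s \<in> W1} \<inter> {s \<in> ?I. f (\<gamma> s) \<in> W2} \<inter> (?I \<inter> ball t \<epsilon>)"
    have o1: "openin (top_of_set ?I) {s \<in> ?I. \<gamma> s \<in> W1}"
      using openin_continuous_map_preimage[OF cI W1(1)] by simp
    have o2: "openin (top_of_set ?I) {s \<in> ?I. f (\<gamma> s) \<in> W2}"
      using openin_continuous_map_preimage[OF continuous_map_compose[OF cI contf] W2(1)] by simp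
    have o3: "openin (top_of_set ?I) (?I \<inter> ball t \<epsilon>)" by (simp add: openin_open_Int)
    have oW: "openin (top_of_set ?I) W" unfolding W_def by (intro openin_Int o1 o2 o3)
    have tW: "t \<in> W" unfolding W_def using tI W1(2) W2(2) c(1) by simp
    have qW: "q s = q t" if s: "s \<in> W" for s
    proof -
      have s': "s \<in> ?I" "\<gamma> s \<in> W1" "f (\<gamma> s) \<in> W2" "\<bar>s - t\<bar> < \<epsilon>" using s by (auto simp: W_def dist_real_def)
      have "\<psi> (f (\<gamma> s)) - \<psi> (f (\<gamma> t)) = plane_map A (\<phi> (\<gamma> s)) - plane_map A (\<phi> (\<gamma> t))"
        using W1(3)[rule_format, OF s'(2)] W1(3)[rule_format, OF W1(2)] by simp
      also have "\<dots> = of_real s * w - of_real t * w"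
        using c(2)[OF s'(1,4)] c(2)[OF tI] c(1) by (simp add: plane_map_add scale)
      finally have "torus_proj (f (\<gamma> s)) = torus_mult (torus_exp (of_real s * w - of_real t * w)) (torus_proj (f (\<gamma> t)))"
        using W2(3)[rule_format, OF s'(3)] by (simp only:)
      then have "q s = torus_mult (torus_exp (- (of_real s * w) + (of_real s * w - of_real t * w))) (torus_proj (f (\<gamma> t)))"
        unfolding q_def torus_exp_add torus_mult_assoc by (simp only:)
      then show ?thesis by (simp add: q_def)
    qed
    show ?thesis
    proof (rule exI[of _ W], rule conjI[OF oW], rule conjI[OF tW], rule ballI)
      show "q s = q t" if "s \<in> W" for s by (rule qW[OF that])
    qed
  qed
  define K where "K = q (1/2)"
  have "connectedin euclidean ?I" by simp
  then have "connected_space (top_of_set ?I)" unfolding connectedin_def by blast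
  then have qK: "q t = K" if "t \<in> ?I" for t
    unfolding K_def using that by (intro locally_constant_imp_constant[OF _ loc]) auto
  have proj: "torus_proj (f (\<gamma> t)) = torus_mult (torus_exp (of_real t * w)) K" if "t \<in> ?I" for t
  proof -
    have "torus_mult (torus_exp (of_real t * w)) (q t) = torus_proj (f (\<gamma> t))"
      unfolding q_def torus_mult_assoc[symmetric] torus_exp_add[symmetric] by simp
    then show ?thesis using qK[OF that] by simp
  qed
  have "torus_mult (torus_exp (of_real a * w)) K = (1, 1)" if a: "a \<in> {0, 1}" for a :: real
  proof (rule ccontr)
    let ?h = "\<lambda>t :: real. torus_mult (torus_exp (of_real t * w)) K"
    assume ne: "?h a \<noteq> (1, 1)"
    have ch: "continuous_on UNIV ?h"
      unfolding torus_mult_def torus_exp_def cis_conv_exp by (intro continuous_intros) 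
    define e where "e = dist (?h a) (1, 1) / 2"
    have e: "e > 0" using ne by (simp add: e_def)
    obtain d where d: "d > 0" "\<And>t. dist t a < d \<Longrightarrow> dist (?h t) (?h a) < e"
      using ch e unfolding continuous_on_iff by (metis UNIV_I)
    define G where "G = {y \<in> topspace ?Y. torus_proj y \<in> ball (1, 1) e}"
    define C where "C = topspace ?Y - G"
    have "openin ?Y G" unfolding G_def by (rule openin_continuous_map_preimage[OF Q.continuous_torus_proj]) simp
    then have "closedin ?Y C" unfolding C_def by blast
    then have "compactin ?Y C" using Q.compact_glued_surface closedin_compact_space by blast
    moreover have CR: "C \<subseteq> topspace ?Y - singular_vertices Q"
      unfolding C_def G_def using Q.torus_proj_singular e by auto
    ultimately have "compactin ?RY C" unfolding RY by (simp add: compactin_subtopology)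
    then have "compactin ?RX (g ` C)" using image_compactin contg by blast
    then have gC: "compactin ?X (g ` C)" "g ` C \<subseteq> topspace ?X - singular_vertices P"
      unfolding RX compactin_subtopology by simp_all
    then have "closedin ?X (g ` C)" using compactin_imp_closedin[OF P.Hausdorff_glued_surface] by blast
    then have op: "openin ?X (topspace ?X - g ` C)" by blast
    have aI: "a \<in> {0..1}" "\<gamma> a \<notin> g ` C" using a \<gamma>0 gC(2) by auto
    have o: "openin (top_of_set {0..1}) {t \<in> {0..1}. \<gamma> t \<in> topspace ?X - g ` C}"
      using openin_continuous_map_preimage[OF \<gamma>c op] by simp
    have "a \<in> {t \<in> {0..1}. \<gamma> t \<in> topspace ?X - g ` C}" using aI \<gamma>X by simp
    then obtain \<delta> where \<delta>: "\<delta> > 0" "\<And>t. t \<in> {0..1} \<Longrightarrow> dist t a < \<delta> \<Longrightarrow> \<gamma> t \<notin> g ` C"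
      using bspec[OF conjunct2[OF o[unfolded openin_euclidean_subtopology_iff]], of a] by auto
    define m where "m = min (1/2) (min d \<delta> / 2)"
    define t where "t = (if a = 0 then m else 1 - m)"
    have t: "t \<in> ?I" "dist t a < d" "dist t a < \<delta>"
      using a d(1) \<delta>(1) by (auto simp: t_def m_def dist_real_def)
    have "f (\<gamma> t) \<notin> C" using \<delta>(2)[of t] t gf[OF \<gamma>R[OF t(1)]] by force
    moreover have "f (\<gamma> t) \<in> topspace ?Y"
      using homeomorphic_imp_surjective_map[OF hom] \<gamma>R[OF t(1)] by (auto simp: Q.topspace_regular_part)
    ultimately have "dist (1, 1) (?h t) < e" using proj[OF t(1)] by (simp add: C_def G_def)
    then show False using d(2)[OF t(2)] dist_triangle[of "?h a" "(1, 1)" "?h t"] e_def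
      by (simp add: dist_commute)
  qed
  \<comment> \<open>The initial point gives \<open>K = (1, 1)\<close>, and the end point then gives
    the claim for \<open>w\<close>.\<close>
  from this[of 0] this[of 1] show ?thesis by (simp add: w_def)
qed

context square_gluing
begin

lemma development_vector_integral:
  assumes "v \<in> development_vectors (origami_surface Q)"
  shows "Re v \<in> \<int> \<and> Im v \<in> \<int>"
proof -
  obtain \<gamma> where "saddle_connection (origami_surface Q) \<gamma> v" using assms by (auto simp: development_vectors_def)
  moreover obtain f where "affine_homeo (mat 1) (origami_surface Q) (origami_surface Q) f"
    using affinely_equivalent_refl by (auto simp: affinely_equivalent_def)
  ultimately have "torus_exp (plane_map (mat 1) v) = (1, 1)"
    using affine_image_of_saddle_connection square_gluing_axioms by blast
  then show ?thesis by (simp add: torus_exp_eq_one_iff)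
qed

lemma edge_saddle_connection:
  assumes i: "i < squares Q" and d: "d = 1 \<or> d = \<i>"
    and s: "glued_point Q i 0 \<in> singular_vertices Q" "glued_point Q i d \<in> singular_vertices Q"
  shows "d \<in> development_vectors (origami_surface Q)"
proof -
  let ?\<gamma> = "\<lambda>t::real. glued_point Q i (of_real t * d)"
  have sq: "of_real t * d \<in> unit_square" if "t \<in> {0..1}" for t :: real using that d by (auto simp: unit_square_iff)
  have reg: "?\<gamma> t \<notin> singular_vertices Q" if "t \<in> {0<..<1}" for t
    using singular_glued_point[OF i sq, of t] that d by (auto simp: complex_eq_iff)
  have cont: "continuous_map (top_of_set {0..1}) (glued_surface Q) ?\<gamma>"
  proof -
    have "continuous_map (top_of_set {0..1}) (top_of_set unit_square) (\<lambda>t. of_real t * d)"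
      using sq by (auto intro!: continuous_intros)
    from continuous_map_compose[OF this continuous_map_glued_point[OF i]] show ?thesis by (simp add: o_def)
  qed
  have loc: "\<exists>c. \<exists>\<epsilon>>0. \<forall>s\<in>{0<..<1}. \<bar>s - t\<bar> < \<epsilon> \<longrightarrow> ?\<gamma> s \<in> U \<and> \<phi> (?\<gamma> s) = c + of_real s * d"
    if U: "(U, \<phi>) \<in> origami_atlas Q" and t: "t \<in> {0<..<1}" "?\<gamma> t \<in> U" for U \<phi> t
  proof -
    have t': "t \<in> {0..1}" using t by simp
    obtain e where e: "e > 0" "\<And>w. w \<in> unit_square \<Longrightarrow> dist w (of_real t * d) < e \<Longrightarrow> glued_point Q i w \<in> U \<and>
        \<phi> (glued_point Q i w) = \<phi> (?\<gamma> t) + (w - of_real t * d)"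
      using atlas_local[OF U i sq[OF t'] t(2)] by blast
    show ?thesis
    proof (intro exI[of _ "\<phi> (?\<gamma> t) - of_real t * d"] exI[of _ e] conjI ballI impI)
      fix s :: real assume s: "s \<in> {0<..<1}" "\<bar>s - t\<bar> < e"
      have "dist (of_real s * d) (of_real t * d) = \<bar>s - t\<bar>"
        using d by (auto simp: dist_norm norm_mult simp flip: left_diff_distrib of_real_diff)
      then have "?\<gamma> s \<in> U \<and> \<phi> (?\<gamma> s) = \<phi> (?\<gamma> t) + (of_real s * d - of_real t * d)"
        using e(2)[of "of_real s * d"] sq[of s] s by simp
      then show "?\<gamma> s \<in> U" "\<phi> (?\<gamma> s) = \<phi> (?\<gamma> t) - of_real t * d + of_real s * d" by simp_all
    qed (rule e)
  qed
  have "saddle_connection (origami_surface Q) ?\<gamma> d"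
    unfolding saddle_connection_def origami_surface_def using cont s reg loc by auto
  then show ?thesis unfolding development_vectors_def by blast
qed

text \<open>An edge of a square between two singular vertices is a saddle connection. One horizontal
  and one vertical edge of this kind generate all Gaussian integers, and nothing else can occur
  since development vectors are integral.\<close>

lemma reduced_if_adjacent_singularities:
  assumes i: "i < squares Q" "commutator Q i \<noteq> i" "commutator Q (right Q i) \<noteq> right Q i"
    and j: "j < squares Q" "commutator Q j \<noteq> j" "commutator Q (up Q j) \<noteq> up Q j"
  shows "reduced_surface (origami_surface Q)"
proof -
  let ?D = "development_vectors (origami_surface Q)"
  have s: "glued_point Q k 0 \<in> singular_vertices Q" if "k < squares Q" "commutator Q k \<noteq> k" for k
    using that unfolding singular_vertices_eq by blast
  have "glued_point Q i 1 = glued_point Q (right Q i) 0"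
    using glued_point_right[of i 1] i by (simp add: unit_square_iff zero_complex.code)
  then have "1 \<in> ?D" using edge_saddle_connection[of i 1] s i by simp
  moreover have "glued_point Q j \<i> = glued_point Q (up Q j) 0"
    using glued_point_up[of j \<i>] j by (simp add: unit_square_iff zero_complex.code)
  then have "\<i> \<in> ?D" using edge_saddle_connection[of j \<i>] s j by simp
  ultimately have gen: "1 \<in> group_closure ?D" "\<i> \<in> group_closure ?D" by (auto intro: group_closure.base)
  have mult: "of_int m * s \<in> group_closure ?D" if "s \<in> group_closure ?D" for m and s :: complex
  proof (cases m rule: int_cases2)
    case (nonneg n)
    then show ?thesis using group_closure_scalar_mult_left[OF that, of n] by simp
  next
    case (nonpos n)
    then show ?thesis using group_closure_scalar_mult_left[OF that, of n] by simp
  qed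
  have "group_closure ?D = {z. Re z \<in> \<int> \<and> Im z \<in> \<int>}"
  proof
    show "group_closure ?D \<subseteq> {z. Re z \<in> \<int> \<and> Im z \<in> \<int>}"
    proof
      fix z assume "z \<in> group_closure ?D"
      then show "z \<in> {z. Re z \<in> \<int> \<and> Im z \<in> \<int>}"
        by induction (use development_vector_integral in auto)
    qed
    show "{z. Re z \<in> \<int> \<and> Im z \<in> \<int>} \<subseteq> group_closure ?D"
    proof
      fix z :: complex assume "z \<in> {z. Re z \<in> \<int> \<and> Im z \<in> \<int>}"
      then obtain a b where "Re z = of_int a" "Im z = of_int b" by (auto simp: Ints_def)
      then have "z = of_int a * 1 + of_int b * \<i>" by (simp add: complex_eq_iff)
      then show "z \<in> group_closure ?D" using group_closure_add[OF mult[OF gen(1)] mult[OF gen(2)]] by (simp only:)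
    qed
  qed
  then show ?thesis by (simp add: reduced_surface_def)
qed

text \<open>Because the origami is reduced, 1 and \<open>\<i>\<close> are integral combinations of
  development vectors. Their images under the matrix, which are its columns, are therefore
  integral.\<close>

lemma Veech_group_integral:
  assumes red: "reduced_surface (origami_surface Q)"
  shows "Veech_group (origami_surface Q) \<subseteq> real_matrix ` carrier SL2Z"
proof
  fix A assume A: "A \<in> Veech_group (origami_surface Q)"
  then obtain f where f: "affine_homeo A (origami_surface Q) (origami_surface Q) f" and det: "det A = 1"
    by (auto simp: Veech_group_def)
  have int: "torus_exp (plane_map A z) = (1, 1)" if "z \<in> group_closure (development_vectors (origami_surface Q))" for z
    using that
  proof induction
    case (base s)
    then show ?case
      using affine_image_of_saddle_connection[OF square_gluing_axioms square_gluing_axioms f]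
      by (auto simp: development_vectors_def)
  next
    case (diff s t)
    then show ?case by (auto simp: plane_map_diff torus_exp_eq_one_iff)
  qed
  have "torus_exp (plane_map A 1) = (1, 1)" "torus_exp (plane_map A \<i>) = (1, 1)"
    by (rule int; use red in \<open>simp add: reduced_surface_def\<close>)+
  then have "A $ 1 $ 1 \<in> \<int>" "A $ 2 $ 1 \<in> \<int>" "A $ 1 $ 2 \<in> \<int>" "A $ 2 $ 2 \<in> \<int>"
    by (auto simp: torus_exp_eq_one_iff plane_map_def)
  then obtain a b c d where abcd: "A $ 1 $ 1 = of_int a" "A $ 1 $ 2 = of_int b" "A $ 2 $ 1 = of_int c" "A $ 2 $ 2 = of_int d"
    by (auto simp: Ints_def)
  have "A = real_matrix (mat2 a b c d)" by (simp add: mat2_eq_iff real_matrix_def abcd)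
  moreover have "real_of_int (a * d - b * c) = 1" using det by (simp add: det_2 abcd)
  then have "a * d - b * c = 1" by linarith
  then have "mat2 a b c d \<in> carrier SL2Z" by (simp add: SL2Z_def det_2)
  ultimately show "A \<in> real_matrix ` carrier SL2Z" by blast
qed

end

section \<open>Generating \<open>SL(2)\<close> modulo \<open>n\<close>\<close>

lemma mat2_mult: "mat2 a b c d ** mat2 e f g h =
    mat2 (a * e + b * g) (a * f + b * h) (c * e + d * g) (c * f + d * (h :: 'a :: comm_ring_1))"
  by (simp add: mat2_eq_iff matrix_matrix_mult_def sum_2)

lemma mat2_collapse: "mat2 (A $ 1 $ 1) (A $ 1 $ 2) (A $ 2 $ 1) (A $ 2 $ 2) = A"
  by (simp add: mat2_eq_iff)

lemma mat2_one: "mat 1 = mat2 1 0 0 (1 :: 'a :: comm_ring_1)"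
  by (simp add: mat2_eq_iff mat_def)

abbreviation upper :: "int \<Rightarrow> int ^ 2 ^ 2" where "upper s \<equiv> mat2 1 s 0 1"
abbreviation lower :: "int \<Rightarrow> int ^ 2 ^ 2" where "lower s \<equiv> mat2 1 0 s 1"
text \<open>Equal to \<open>upper (- 1) ** lower s ** upper 1\<close>, a parabolic matrix that fixes
  the vector (1, -1).\<close>

abbreviation slanted :: "int \<Rightarrow> int ^ 2 ^ 2" where "slanted s \<equiv> mat2 (1 - s) (- s) s (1 + s)"

definition mat_cong :: "int \<Rightarrow> int ^ 2 ^ 2 \<Rightarrow> int ^ 2 ^ 2 \<Rightarrow> bool" where
  "mat_cong n A B \<longleftrightarrow> [A $ 1 $ 1 = B $ 1 $ 1] (mod n) \<and> [A $ 1 $ 2 = B $ 1 $ 2] (mod n) \<and>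
     [A $ 2 $ 1 = B $ 2 $ 1] (mod n) \<and> [A $ 2 $ 2 = B $ 2 $ 2] (mod n)"

lemma mat_cong_mult: "mat_cong n A B \<Longrightarrow> mat_cong n C D \<Longrightarrow> mat_cong n (A ** C) (B ** D)"
  by (simp add: mat_cong_def matrix_matrix_mult_def sum_2 cong_add cong_mult)

lemma mat_cong_trans: "mat_cong n A B \<Longrightarrow> mat_cong n B C \<Longrightarrow> mat_cong n A C"
  by (auto simp: mat_cong_def intro: cong_trans)

text \<open>Euclid's algorithm on the first column, where \<open>n = 0\<close> gives the generation of \<open>SL(2, \<int>)\<close>.
  Diagonal matrices are treated by Whitehead's formula.\<close>

lemma SL2_generation:
  fixes n :: int
  assumes up: "\<And>s. R (upper s)" and lo: "\<And>s. R (lower s)"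
    and mult: "\<And>A B. R A \<Longrightarrow> R B \<Longrightarrow> R (A ** B)"
    and cong: "\<And>A B. R A \<Longrightarrow> mat_cong n A B \<Longrightarrow> R B"
    and det: "[a * d - b * c = 1] (mod n)"
  shows "R (mat2 a b c d)"
  using det
proof (induction "nat (\<bar>a\<bar> + \<bar>c\<bar>)" arbitrary: a b c d rule: less_induct)
  case less
  have tri: "R (mat2 a b 0 d)" if ad: "[a * d = 1] (mod n)" for a b d
  proof -
    obtain k where k: "a * d = 1 + n * k" using ad by (metis cong_iff_lin cong_sym)
    \<comment> \<open>When \<open>a * d\<close> is 1 modulo \<open>n\<close>, the first three
      factors form the matrix with rows (0, a) and (-d, 0), the last three the quarter turn with
      rows (0, -1) and (1, 0). Their product is diagonal modulo \<open>n\<close>.\<close>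
    have e: "upper a ** lower (- d) ** upper a ** (upper (- 1) ** lower 1 ** upper (- 1)) =
        mat2 (2 * a - a * (a * d)) (a * d - 1) (1 - a * d) d"
      by (simp add: mat2_mult algebra_simps)
    have "R (upper (a * b) ** (upper a ** lower (- d) ** upper a ** (upper (- 1) ** lower 1 ** upper (- 1))))"
      by (intro mult up lo)
    then show ?thesis
    proof (rule cong)
      have "upper (a * b) ** (upper a ** lower (- d) ** upper a ** (upper (- 1) ** lower 1 ** upper (- 1))) =
          mat2 (2 * a - a * (a * d) + a * b * (1 - a * d)) (a * d - 1 + b * (a * d)) (1 - a * d) d"
        unfolding e by (simp add: mat2_mult algebra_simps)
      also have "\<dots> = mat2 (a + n * (- a * k - a * b * k)) (b + n * (k + b * k)) (n * (- k)) d"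
        unfolding k by (simp add: mat2_eq_iff algebra_simps)
      finally show "mat_cong n (upper (a * b) ** (upper a ** lower (- d) ** upper a ** (upper (- 1) ** lower 1 ** upper (- 1))))
          (mat2 a b 0 d)"
        by (simp add: mat_cong_def cong_iff_dvd_diff)
    qed
  qed
  show ?case
  proof (cases "c = 0 \<or> a = 0")
    case True
    then show ?thesis
    proof
      assume "c = 0"
      then show ?thesis using tri[of a d b] less.prems by simp
    next
      assume "a = 0"
      \<comment> \<open>Two row operations bring the lower left entry into the diagonal and reduce
        to the triangular case.\<close>
      then have "R (mat2 c (b + d) 0 (- b))" using less.prems by (intro tri) (simp add: mult.commute)
      then have "R (upper (- 1) ** (lower 1 ** mat2 c (b + d) 0 (- b)))" by (intro mult up lo)
      then show ?thesis using \<open>a = 0\<close> by (simp add: mat2_mult)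
    qed
  next
    case False
    define q where "q = sgn a * sgn c"
    have q: "q = 1 \<or> q = -1" using False by (auto simp: q_def sgn_if)
    show ?thesis
    proof (cases "\<bar>c\<bar> \<le> \<bar>a\<bar>")
      case True
      have "\<bar>a - q * c\<bar> < \<bar>a\<bar>" using True False by (auto simp: q_def sgn_if)
      moreover have "(a - q * c) * d - (b - q * d) * c = a * d - b * c" by (simp add: algebra_simps)
      ultimately have "R (mat2 (a - q * c) (b - q * d) c d)" using less.prems by (intro less.hyps) auto
      then have "R (upper q ** mat2 (a - q * c) (b - q * d) c d)" by (intro mult up)
      then show ?thesis by (simp add: mat2_mult)
    next
      case F: False
      have "\<bar>c - q * a\<bar> < \<bar>c\<bar>" using F False by (auto simp: q_def sgn_if)
      moreover have "a * (d - q * b) - b * (c - q * a) = a * d - b * c" by (simp add: algebra_simps)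
      ultimately have "R (mat2 a b (c - q * a) (d - q * b))" using less.prems by (intro less.hyps) auto
      then have "R (lower q ** mat2 a b (c - q * a) (d - q * b))" by (intro mult lo)
      then show ?thesis by (simp add: mat2_mult)
    qed
  qed
qed

text \<open>Splitting off \<open>gcd n a\<close> repeatedly collects in \<open>y\<close> the prime
  powers of \<open>n\<close> whose primes divide \<open>a\<close>. Prime factorisations are thereby
  avoided.\<close>

lemma prime_part_decomposition:
  fixes n a :: int
  assumes "n > 0"
  shows "\<exists>x y k. n = x * y \<and> 0 < x \<and> coprime x a \<and> y dvd a ^ k"
  using assms
proof (induction "nat n" arbitrary: n rule: less_induct)
  case less
  show ?case
  proof (cases "coprime n a")
    case True
    then show ?thesis using less.prems by (rule_tac exI[of _ n], rule_tac exI[of _ 1]) auto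
  next
    case False
    define g where "g = gcd n a"
    have "g > 0" "g \<noteq> 1" "g dvd n" "g dvd a" using less.prems False by (auto simp: g_def coprime_iff_gcd_eq_1)
    then have g: "g > 1" "g dvd n" "g dvd a" by auto
    then obtain m where m: "n = g * m" by blast
    then have "m > 0" "m < n" using g less.prems by (auto simp: zero_less_mult_iff)
    then obtain x y k where "m = x * y" "0 < x" "coprime x a" "y dvd a ^ k" using less.hyps[of m] by auto
    then have "n = x * (g * y) \<and> 0 < x \<and> coprime x a \<and> g * y dvd a ^ Suc k" using m g by (auto intro: mult_dvd_mono)
    then show ?thesis by blast
  qed
qed

lemma coprime_prime_part:
  fixes a b y :: int
  assumes "y dvd a ^ k" "coprime a b"
  shows "coprime y b"
  using assms coprime_divisors[OF assms(1) dvd_refl] by (simp add: coprime_power_left_iff)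

text \<open>Here \<open>e\<close> is the idempotent of the factor \<open>u\<close> in the ring of
  residues modulo \<open>u * v\<close>. Invertibility of \<open>b\<close> modulo \<open>u\<close>
  alone is enough to reach its multiples.\<close>

lemma idempotent_multiple:
  fixes u v b e :: int
  assumes "coprime b u" "coprime u v" "[e = 1] (mod u)" "[e = 0] (mod v)"
  shows "\<exists>s. [b * s = e] (mod u * v)"
proof -
  have "coprime (b * v) u" using assms(1,2) by (simp add: coprime_commute)
  then obtain s where s: "[b * v * s = 1] (mod u)" using cong_solve_coprime_int by blast
  have "[b * (v * s) = e] (mod u)" using cong_trans[OF s cong_sym[OF assms(3)]] by (simp add: mult.assoc)
  moreover have "[b * (v * s) = e] (mod v)"
    using cong_trans[OF _ cong_sym[OF assms(4)], of "b * (v * s)"] by (simp add: cong_0_iff)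
  ultimately show ?thesis using coprime_cong_mult[OF _ _ assms(2)] by blast
qed

locale coprime_unipotents =
  fixes G :: "(int ^ 2 ^ 2) set" and a b c :: int
  assumes mult: "\<And>A B. A \<in> G \<Longrightarrow> B \<in> G \<Longrightarrow> A ** B \<in> G"
    and upper: "\<And>s. upper (a * s) \<in> G" and lower: "\<And>s. lower (b * s) \<in> G" and slanted: "\<And>s. slanted (c * s) \<in> G"
    and coprime: "coprime a b" "coprime a c" "coprime b c"
begin

text \<open>Instead of prime powers, \<open>n\<close> is split into three coprime factors: the
  primes of \<open>y\<close> divide \<open>a\<close>, those of \<open>x3\<close> divide
  \<open>c\<close>, and \<open>x2\<close> is coprime to both. Modulo \<open>y\<close>,
  \<open>x2\<close> and \<open>x3\<close> the invertible pairs are \<open>b, c\<close>, then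
  \<open>a, c\<close>, then \<open>a, b\<close>. The idempotents \<open>e1\<close>,
  \<open>e2\<close>, \<open>e3\<close> add up to 1 and assemble the elementary matrices.\<close>

lemma cong_surjective:
  assumes n: "n > 0" and det: "[det M = 1] (mod n)"
  shows "\<exists>B\<in>G. mat_cong n B M"
proof -
  define H where "H M \<longleftrightarrow> (\<exists>B\<in>G. mat_cong n B M)" for M
  have Hmult: "H (A ** B)" if "H A" "H B" for A B
    using that mult mat_cong_mult unfolding H_def by blast
  have Hcong: "H B" if "H A" "mat_cong n A B" for A B
    using that mat_cong_trans unfolding H_def by blast
  have unipotent: "H (F (e * s))"
    if F: "\<And>t. F (r * t) \<in> G" "\<And>t t'. [t = t'] (mod n) \<Longrightarrow> mat_cong n (F t) (F t')"
      and u: "n = u * v" "coprime u v" "[e = 1] (mod u)" "[e = 0] (mod v)" "coprime r u"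
    for F :: "int \<Rightarrow> int ^ 2 ^ 2" and r u v e s
  proof -
    obtain t where "[r * t = e] (mod n)" using idempotent_multiple[OF u(5,2-4)] u(1) by blast
    then have "[r * (t * s) = e * s] (mod n)" using cong_scalar_right[of "r * t" e n s] by (simp only: mult.assoc)
    then show ?thesis using F unfolding H_def by blast
  qed
  have cu: "mat_cong n (mat2 1 t 0 1) (mat2 1 t' 0 1)" "mat_cong n (mat2 1 0 t 1) (mat2 1 0 t' 1)"
    "mat_cong n (mat2 (1 - t) (- t) t (1 + t)) (mat2 (1 - t') (- t') t' (1 + t'))" if "[t = t'] (mod n)" for t t'
    using that by (auto simp: mat_cong_def cong_diff cong_add cong_minus_minus_iff)
  \<comment> \<open>These matrices are elementary modulo \<open>u\<close> and trivial modulo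
    \<open>v\<close>, so nothing is spoilt in the other factor.\<close>
  have part: "H (mat2 1 (e * s) 0 1) \<and> H (mat2 1 0 (e * s) 1)"
    if u: "n = u * v" "coprime u v" "[e = 1] (mod u)" "[e = 0] (mod v)"
      and two: "coprime a u \<and> coprime b u \<or> coprime a u \<and> coprime c u \<or> coprime b u \<and> coprime c u" for u v e s
  proof -
    have A: "H (mat2 1 (e * t) 0 1)" if "coprime a u" for t
      using unipotent[of "\<lambda>t. mat2 1 t 0 1", OF upper cu(1) u that] .
    have B: "H (mat2 1 0 (e * t) 1)" if "coprime b u" for t
      using unipotent[of "\<lambda>t. mat2 1 0 t 1", OF lower cu(2) u that] .
    have C: "H (mat2 (1 - e * t) (- (e * t)) (e * t) (1 + e * t))" if "coprime c u" for t
      using unipotent[of "\<lambda>t. mat2 (1 - t) (- t) t (1 + t)", OF slanted cu(3) u that] .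
    have "u dvd e - 1" "v dvd e" using u(3,4) by (simp_all add: cong_iff_dvd_diff cong_0_iff)
    then have "n dvd (e - 1) * e" unfolding u(1) by (rule mult_dvd_mono)
    then have ee: "n dvd (e * e - e) * t" for t using dvd_mult2[of n "(e - 1) * e" t] by (simp add: algebra_simps)
    have dv: "[p = q] (mod n)" if "p - q = (e * e - e) * t" for p q t
      unfolding cong_iff_dvd_diff that by (rule ee)
    \<comment> \<open>\<open>slanted 1\<close> maps the first basis vector to the second, so
      conjugation by it turns lower into upper triangular matrices. With \<open>e\<close> in place
      of 1 the computation remains valid modulo \<open>n\<close>, as all errors are multiples of
      \<open>e * e - e\<close>.\<close>
    have "H (mat2 1 (e * s) 0 1)" if "coprime b u" "coprime c u"
    proof (rule Hcong)
      let ?k = "- s"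
      show "H (mat2 (1 + e) e (- e) (1 - e) ** (mat2 1 0 (e * ?k) 1 ** mat2 (1 - e) (- e) e (1 + e)))"
        using C[OF that(2), of 1] C[OF that(2), of "- 1"] B[OF that(1), of ?k] by (intro Hmult) simp_all
      show "mat_cong n (mat2 (1 + e) e (- e) (1 - e) ** (mat2 1 0 (e * ?k) 1 ** mat2 (1 - e) (- e) e (1 + e)))
          (mat2 1 (e * s) 0 1)"
        unfolding mat_cong_def mat2_mult mat2_nth
      proof (intro conjI)
        show "[(1 + e) * (1 * (1 - e) + 0 * e) + e * (e * ?k * (1 - e) + 1 * e) = 1] (mod n)"
          by (rule dv[where t = "- (e * ?k)"]) (simp add: algebra_simps)
        show "[(1 + e) * (1 * - e + 0 * (1 + e)) + e * (e * ?k * - e + 1 * (1 + e)) = e * s] (mod n)"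
          by (rule dv[where t = "- (e + 1) * ?k"]) (simp add: algebra_simps)
        show "[- e * (1 * (1 - e) + 0 * e) + (1 - e) * (e * ?k * (1 - e) + 1 * e) = 0] (mod n)"
          by (rule dv[where t = "(e - 1) * ?k"]) (simp add: algebra_simps)
        show "[- e * (1 * - e + 0 * (1 + e)) + (1 - e) * (e * ?k * - e + 1 * (1 + e)) = 1] (mod n)"
          by (rule dv[where t = "e * ?k"]) (simp add: algebra_simps)
      qed
    qed
    \<comment> \<open>The opposite conjugation, which makes lower from upper triangular
      matrices.\<close>
    moreover have "H (mat2 1 0 (e * s) 1)" if "coprime a u" "coprime c u"
    proof (rule Hcong)
      show "H (mat2 (1 - e) (- e) e (1 + e) ** (mat2 1 (e * - s) 0 1 ** mat2 (1 + e) e (- e) (1 - e)))"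
        using C[OF that(2), of 1] C[OF that(2), of "- 1"] A[OF that(1), of "- s"] by (intro Hmult) simp_all
      show "mat_cong n (mat2 (1 - e) (- e) e (1 + e) ** (mat2 1 (e * - s) 0 1 ** mat2 (1 + e) e (- e) (1 - e)))
          (mat2 1 0 (e * s) 1)"
        unfolding mat_cong_def mat2_mult mat2_nth
      proof (intro conjI)
        show "[(1 - e) * (1 * (1 + e) + e * - s * - e) + - e * (0 * (1 + e) + 1 * - e) = 1] (mod n)"
          by (rule dv[where t = "- (e * s)"]) (simp add: algebra_simps)
        show "[(1 - e) * (1 * e + e * - s * (1 - e)) + - e * (0 * e + 1 * (1 - e)) = 0] (mod n)"
          by (rule dv[where t = "(1 - e) * s"]) (simp add: algebra_simps)
        show "[e * (1 * (1 + e) + e * - s * - e) + (1 + e) * (0 * (1 + e) + 1 * - e) = e * s] (mod n)"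
          by (rule dv[where t = "(e + 1) * s"]) (simp add: algebra_simps)
        show "[e * (1 * e + e * - s * (1 - e)) + (1 + e) * (0 * e + 1 * (1 - e)) = 1] (mod n)"
          by (rule dv[where t = "e * s"]) (simp add: algebra_simps)
      qed
    qed
    ultimately show ?thesis using two A B by blast
  qed
  obtain x y k where xy: "n = x * y" "0 < x" "coprime x a" "y dvd a ^ k" using prime_part_decomposition[OF n] by blast
  obtain x2 x3 l where x23: "x = x2 * x3" "coprime x2 c" "x3 dvd c ^ l"
    using prime_part_decomposition[OF xy(2)] by blast
  have xa: "coprime x2 a" "coprime x3 a" using xy(3) x23(1) by simp_all
  have yb: "coprime y b" "coprime y c" using coprime_prime_part[OF xy(4)] coprime by auto
  have x3b: "coprime x3 b" using coprime_prime_part[OF x23(3), of b] coprime by (simp add: coprime_commute)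
  have cxy: "coprime y x2" "coprime y x3" "coprime x2 x3"
  proof -
    show "coprime y x2" "coprime y x3" using coprime_prime_part[OF xy(4)] xa by (auto simp: coprime_commute)
    show "coprime x2 x3" using coprime_prime_part[OF x23(3), of x2] x23(2) by (simp add: coprime_commute)
  qed
  have idem: "\<exists>e. [e = 1] (mod u) \<and> [e = 0] (mod v)" if uv: "coprime u v" for u v :: int
  proof -
    obtain s where "[v * s = 1] (mod u)" using cong_solve_coprime_int[of v u] uv coprime_commute by blast
    then show ?thesis by (intro exI[of _ "v * s"]) (simp add: cong_0_iff)
  qed
  have n3: "n = y * (x2 * x3)" "n = x2 * (y * x3)" "n = x3 * (y * x2)" using xy(1) x23(1) by simp_all
  have c3: "coprime y (x2 * x3)" "coprime x2 (y * x3)" "coprime x3 (y * x2)" using cxy by (auto simp: coprime_commute)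
  obtain e1 where e1: "[e1 = 1] (mod y)" "[e1 = 0] (mod x2 * x3)" using idem[OF c3(1)] by blast
  obtain e2 where e2: "[e2 = 1] (mod x2)" "[e2 = 0] (mod y * x3)" using idem[OF c3(2)] by blast
  obtain e3 where e3: "[e3 = 1] (mod x3)" "[e3 = 0] (mod y * x2)" using idem[OF c3(3)] by blast
  have P1: "H (mat2 1 (e1 * s) 0 1) \<and> H (mat2 1 0 (e1 * s) 1)" for s
    by (rule part[OF n3(1) c3(1) e1]) (use yb in \<open>simp add: coprime_commute\<close>)
  have P2: "H (mat2 1 (e2 * s) 0 1) \<and> H (mat2 1 0 (e2 * s) 1)" for s
    by (rule part[OF n3(2) c3(2) e2]) (use xa x23(2) in \<open>simp add: coprime_commute\<close>)
  have P3: "H (mat2 1 (e3 * s) 0 1) \<and> H (mat2 1 0 (e3 * s) 1)" for s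
    by (rule part[OF n3(3) c3(3) e3]) (use xa x3b in \<open>simp add: coprime_commute\<close>)
  have "[e1 + e2 + e3 = 1 + 0 + 0] (mod y)"
    by (intro cong_add e1(1) cong_dvd_modulus[OF e2(2)] cong_dvd_modulus[OF e3(2)]) simp_all
  moreover have "[e1 + e2 + e3 = 0 + 1 + 0] (mod x2)"
    by (intro cong_add e2(1) cong_dvd_modulus[OF e1(2)] cong_dvd_modulus[OF e3(2)]) simp_all
  moreover have "[e1 + e2 + e3 = 0 + 0 + 1] (mod x3)"
    by (intro cong_add e3(1) cong_dvd_modulus[OF e1(2)] cong_dvd_modulus[OF e2(2)]) simp_all
  ultimately have "[e1 + e2 + e3 = 1] (mod y * (x2 * x3))"
    using c3(1) cxy(3) by (intro coprime_cong_mult) simp_all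
  then have "[e1 + e2 + e3 = 1] (mod n)" using n3(1) by simp
  then have es: "[e1 * s + (e2 * s + e3 * s) = s] (mod n)" for s
    using cong_scalar_right[of "e1 + e2 + e3" 1 n s] by (simp add: algebra_simps)
  have HU: "H (mat2 1 s 0 1)" for s
  proof (rule Hcong)
    show "H (mat2 1 (e1 * s) 0 1 ** (mat2 1 (e2 * s) 0 1 ** mat2 1 (e3 * s) 0 1))"
      using P1 P2 P3 by (intro Hmult) blast+
    show "mat_cong n (mat2 1 (e1 * s) 0 1 ** (mat2 1 (e2 * s) 0 1 ** mat2 1 (e3 * s) 0 1)) (mat2 1 s 0 1)"
      using es[of s] by (simp add: mat_cong_def mat2_mult add_ac)
  qed
  have HL: "H (mat2 1 0 s 1)" for s
  proof (rule Hcong)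
    show "H (mat2 1 0 (e1 * s) 1 ** (mat2 1 0 (e2 * s) 1 ** mat2 1 0 (e3 * s) 1))"
      using P1 P2 P3 by (intro Hmult) blast+
    show "mat_cong n (mat2 1 0 (e1 * s) 1 ** (mat2 1 0 (e2 * s) 1 ** mat2 1 0 (e3 * s) 1)) (mat2 1 0 s 1)"
      using es[of s] by (simp add: mat_cong_def mat2_mult add_ac)
  qed
  have "H (mat2 (M $ 1 $ 1) (M $ 1 $ 2) (M $ 2 $ 1) (M $ 2 $ 2))"
    by (rule SL2_generation[of H n, OF HU HL Hmult Hcong det[unfolded det_2]])
  then have "H M" by (simp only: mat2_collapse)
  then show ?thesis by (simp only: H_def)
qed

end

section \<open>Totally non congruence Veech groups\<close>

lemma real_matrix_mult: "real_matrix (A ** B) = real_matrix A ** real_matrix B"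
  by (simp add: mat2_eq_iff real_matrix_def matrix_matrix_mult_def sum_2)

lemma real_matrix_mat2: "real_matrix (mat2 a b c d) = mat2 (real_of_int a) (real_of_int b) (real_of_int c) (real_of_int d)"
  by (simp add: mat2_eq_iff real_matrix_def)

lemma real_matrix_one: "real_matrix (mat 1) = mat 1"
  by (simp add: mat2_eq_iff real_matrix_def mat_def)

lemma det_real_matrix: "det (real_matrix A) = real_of_int (det A)"
  by (simp add: real_matrix_def det_2)

definition adj2 :: "int ^ 2 ^ 2 \<Rightarrow> int ^ 2 ^ 2" where
  "adj2 A = mat2 (A $ 2 $ 2) (- A $ 1 $ 2) (- A $ 2 $ 1) (A $ 1 $ 1)"

lemma adj2_mult: "det A = 1 \<Longrightarrow> adj2 A ** A = mat 1" "det A = 1 \<Longrightarrow> A ** adj2 A = mat 1"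
  and det_adj2: "det (adj2 A) = det A" and adj2_adj2: "adj2 (adj2 A) = A"
  by (simp_all add: adj2_def mat2_eq_iff matrix_matrix_mult_def sum_2 mat_def det_2 algebra_simps)

lemma group_SL2Z: "group SL2Z"
proof (rule groupI)
  fix A assume "A \<in> carrier SL2Z"
  then show "\<exists>B\<in>carrier SL2Z. B \<otimes>\<^bsub>SL2Z\<^esub> A = \<one>\<^bsub>SL2Z\<^esub>"
    by (intro bexI[of _ "adj2 A"]) (auto simp: SL2Z_def adj2_mult det_adj2)
qed (auto simp: SL2Z_def det_mul matrix_mul_assoc)

lemma m_inv_SL2Z: "A \<in> carrier SL2Z \<Longrightarrow> m_inv SL2Z A = adj2 A"
  by (rule group.inv_equality[OF group_SL2Z]) (auto simp: SL2Z_def adj2_mult det_adj2)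

section \<open>Integral affine maps between origamis and parabolic elements\<close>

definition int_affine :: "int ^ 2 ^ 2 \<Rightarrow> origami_data \<Rightarrow> origami_data \<Rightarrow> bool" where
  "int_affine A P Q \<longleftrightarrow> affinely_equivalent (real_matrix A) P Q"

lemma int_affine_trans:
  assumes "square_gluing P" "square_gluing Q" "int_affine A P Q" "int_affine B Q R"
  shows "int_affine (B ** A) P R"
  using assms affine_homeo_compose square_gluing.translation_atlas_origami
  unfolding int_affine_def affinely_equivalent_def real_matrix_mult by meson

lemma int_affine_adj2:
  assumes P: "square_gluing P" and Q: "square_gluing Q" and A: "int_affine A P Q" "det A = 1"
  shows "int_affine (adj2 A) Q P"
proof -
  obtain f where f: "affine_homeo (real_matrix A) (origami_surface P) (origami_surface Q) f"
    using A by (auto simp: int_affine_def affinely_equivalent_def)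
  have "real_matrix (adj2 A) ** real_matrix A = mat 1"
    by (simp only: adj2_mult[OF A(2)] real_matrix_one flip: real_matrix_mult)
  then show ?thesis
    using affine_homeo_inverse[OF f _ square_gluing.translation_atlas_origami[OF P]
        square_gluing.translation_atlas_origami[OF Q]]
    unfolding int_affine_def affinely_equivalent_def by blast
qed

definition shear_power :: "nat \<Rightarrow> origami_data \<Rightarrow> origami_data" where
  "shear_power m Q = \<lparr>squares = squares Q, right = right Q, up = up Q \<circ> inv (right Q) ^^ m\<rparr>"

context square_gluing
begin

lemma int_affine_one: "int_affine (mat 1) Q Q"
  unfolding int_affine_def real_matrix_one by (rule affinely_equivalent_refl)

lemma int_affine_sheared: "int_affine (mat2 1 1 0 1) Q (sheared Q)"
  using affinely_equivalent_sheared by (simp add: int_affine_def real_matrix_mat2)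

lemma int_affine_rotated: "int_affine (mat2 0 (- 1) 1 0) Q (rotated Q)"
  using affinely_equivalent_rotated by (simp add: int_affine_def real_matrix_mat2)

lemma sheared_shear_power: "sheared (shear_power m Q) = shear_power (Suc m) Q"
  by (simp add: sheared_def shear_power_def o_assoc[symmetric] funpow_Suc_right del: funpow.simps)

lemma shear_power_0: "shear_power 0 Q = Q"
  by (simp add: shear_power_def)

lemma shear_power: "square_gluing (shear_power m Q) \<and> int_affine (mat2 1 (int m) 0 1) Q (shear_power m Q)"
proof (induction m)
  case 0
  then show ?case using int_affine_one square_gluing_axioms by (simp add: shear_power_0 mat2_one)
next
  case (Suc m)
  then have g: "square_gluing (shear_power m Q)" and a: "int_affine (mat2 1 (int m) 0 1) Q (shear_power m Q)" by auto
  have "int_affine (mat2 1 1 0 1 ** mat2 1 (int m) 0 1) Q (shear_power (Suc m) Q)"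
    using int_affine_trans[OF square_gluing_axioms g a square_gluing.int_affine_sheared[OF g]]
    by (simp only: sheared_shear_power)
  then show ?case using square_gluing.sheared_gluing[OF g] by (simp add: sheared_shear_power mat2_mult add.commute)
qed

text \<open>Shearing \<open>m\<close> times alters the gluing only by the factor
  \<open>inv (right Q) ^^ m\<close> in \<open>up\<close>. If this is the identity, the shears have
  led back to \<open>Q\<close>.\<close>

lemma upper_if_right_order:
  assumes "right Q ^^ m = id"
  shows "int_affine (mat2 1 (int m) 0 1) Q Q"
proof -
  have "inv (right Q) ^^ m = id"
    using inv_fn[OF permutes_bij[OF right_permutes], of m] assms by (metis inv_id)
  then have "shear_power m Q = Q" by (simp add: shear_power_def)
  then show ?thesis using shear_power[of m] by simp
qed

text \<open>The quarter turn makes \<open>inv (up Q)\<close> the horizontal permutation, so the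
  criterion for upper triangular matrices applies. Conjugating back produces the exponent
  \<open>- int m\<close>, which is corrected by an inversion.\<close>

lemma lower_if_up_order:
  assumes "up Q ^^ m = id"
  shows "int_affine (mat2 1 0 (int m) 1) Q Q"
proof -
  have g: "square_gluing (rotated Q)" by (rule rotated_gluing)
  have "inv (up Q) ^^ m = id"
    using inv_fn[OF permutes_bij[OF up_permutes], of m] assms by (metis inv_id)
  then have u: "int_affine (mat2 1 (int m) 0 1) (rotated Q) (rotated Q)"
    by (intro square_gluing.upper_if_right_order[OF g]) simp
  have r': "int_affine (adj2 (mat2 0 (- 1) 1 0)) (rotated Q) Q"
    by (rule int_affine_adj2[OF square_gluing_axioms g int_affine_rotated]) (simp add: det_2)
  have "int_affine (adj2 (mat2 0 (- 1) 1 0) ** (mat2 1 (int m) 0 1 ** mat2 0 (- 1) 1 0)) Q Q"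
    by (rule int_affine_trans[OF square_gluing_axioms g int_affine_trans[OF square_gluing_axioms g int_affine_rotated u] r'])
  then have l: "int_affine (mat2 1 0 (- int m) 1) Q Q" by (simp add: adj2_def mat2_mult)
  have "int_affine (adj2 (mat2 1 0 (- int m) 1)) Q Q"
    by (rule int_affine_adj2[OF square_gluing_axioms square_gluing_axioms l]) (simp add: det_2)
  then show ?thesis by (simp add: adj2_def)
qed

text \<open>After one shear the vertical permutation is \<open>up Q \<circ> inv (right Q)\<close>.
  Conjugation by that shear turns the lower triangular matrix into the slanted one.\<close>

lemma slanted_if_diagonal_order:
  assumes "(up Q \<circ> inv (right Q)) ^^ m = id"
  shows "int_affine (mat2 (1 - int m) (- int m) (int m) (1 + int m)) Q Q"
proof -
  have g: "square_gluing (sheared Q)" by (rule sheared_gluing)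
  have l: "int_affine (mat2 1 0 (int m) 1) (sheared Q) (sheared Q)"
    by (rule square_gluing.lower_if_up_order[OF g]) (simp add: assms)
  have r': "int_affine (adj2 (mat2 1 1 0 1)) (sheared Q) Q"
    by (rule int_affine_adj2[OF square_gluing_axioms g int_affine_sheared]) (simp add: det_2)
  have "int_affine (adj2 (mat2 1 1 0 1) ** (mat2 1 0 (int m) 1 ** mat2 1 1 0 1)) Q Q"
    by (rule int_affine_trans[OF square_gluing_axioms g int_affine_trans[OF square_gluing_axioms g int_affine_sheared l] r'])
  then show ?thesis by (simp add: adj2_def mat2_mult add.commute)
qed

text \<open>The origami whose shear is \<open>Q\<close>; it realises the inverse of the shear as a
  map out of \<open>Q\<close>.\<close>

definition unsheared :: origami_data where
  "unsheared = \<lparr>squares = squares Q, right = right Q, up = up Q \<circ> right Q\<rparr>"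

lemma unsheared: "square_gluing unsheared" "sheared unsheared = Q"
proof -
  show "square_gluing unsheared"
    by unfold_locales (auto simp: unsheared_def intro!: permutes_compose right_permutes up_permutes)
  have "up Q \<circ> right Q \<circ> inv (right Q) = up Q" by (simp add: fun_eq_iff)
  then show "sheared unsheared = Q" by (simp add: sheared_def unsheared_def)
qed

end

text \<open>\<open>SL(2, \<int>)\<close> acts on the finitely many pairs of permutations of the squares.\<close>

lemma int_affine_image_exists:
  assumes "square_gluing Q" "det A = 1"
  shows "\<exists>P. square_gluing P \<and> squares P = squares Q \<and> int_affine A Q P"
proof -
  \<comment> \<open>All gluings are quantified, since each factor of a product acts on the origami
    reached by the previous ones.\<close>
  define R where "R A \<longleftrightarrow> (\<forall>Q. square_gluing Q \<longrightarrow> (\<exists>P. square_gluing P \<and> squares P = squares Q \<and> int_affine A Q P))" for A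
  have mult: "R (A ** B)" if R: "R A" "R B" for A B
    unfolding R_def
  proof (intro allI impI)
    fix Q assume Q: "square_gluing Q"
    obtain P where P: "square_gluing P" "squares P = squares Q" "int_affine B Q P" using R(2) Q unfolding R_def by blast
    obtain P' where P': "square_gluing P'" "squares P' = squares P" "int_affine A P P'" using R(1) P(1) unfolding R_def by blast
    then show "\<exists>P. square_gluing P \<and> squares P = squares Q \<and> int_affine (A ** B) Q P"
      using int_affine_trans[OF Q P(1,3) P'(3)] P(2) by metis
  qed
  have one: "R (mat 1)" unfolding R_def using square_gluing.int_affine_one by blast
  have up1: "R (mat2 1 1 0 1)"
    unfolding R_def using square_gluing.int_affine_sheared square_gluing.sheared_gluing sheared_simps(1) by blast
  have rot: "R (mat2 0 (- 1) 1 0)"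
    unfolding R_def using square_gluing.int_affine_rotated square_gluing.rotated_gluing rotated_simps(1) by blast
  have um1: "R (mat2 1 (- 1) 0 1)"
    unfolding R_def
  proof (intro allI impI)
    fix Q assume "square_gluing Q"
    then interpret square_gluing Q .
    have "int_affine (mat2 1 1 0 1) unsheared Q"
      using square_gluing.int_affine_sheared[OF unsheared(1)] unsheared(2) by simp
    then have "int_affine (adj2 (mat2 1 1 0 1)) Q unsheared"
      by (rule int_affine_adj2[OF unsheared(1) square_gluing_axioms]) (simp add: det_2)
    then show "\<exists>P. square_gluing P \<and> squares P = squares Q \<and> int_affine (mat2 1 (- 1) 0 1) Q P"
      using unsheared(1) by (intro exI[of _ unsheared]) (simp add: adj2_def unsheared_def)
  qed
  have up: "R (mat2 1 s 0 1)" for s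
  proof (induction s rule: int_induct[of _ 0])
    case base
    then show ?case using one by (simp add: mat2_one)
  next
    case (step1 s)
    then show ?case using mult[OF up1 step1(2)] by (simp add: mat2_mult add.commute)
  next
    case (step2 s)
    then show ?case using mult[OF um1 step2(2)] by (simp add: mat2_mult)
  qed
  \<comment> \<open>The third power of the quarter turn is its inverse, and the quarter turn
    conjugates \<open>upper (- s)\<close> to \<open>lower s\<close>.\<close>
  have lo: "R (mat2 1 0 s 1)" for s
    using mult[OF mult[OF mult[OF rot rot] rot] mult[OF up[of "- s"] rot]] by (simp add: mat2_mult)
  have "R (mat2 (A $ 1 $ 1) (A $ 1 $ 2) (A $ 2 $ 1) (A $ 2 $ 2))"
  proof (rule SL2_generation[of R 0])
    show "R B" if "R A" "mat_cong 0 A B" for A B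
      using that mat2_eq_iff[of A B] by (simp add: mat_cong_def)
    show "[A $ 1 $ 1 * A $ 2 $ 2 - A $ 1 $ 2 * A $ 2 $ 1 = 1] (mod 0)" using assms(2) by (simp add: det_2)
  qed (use up lo mult in auto)
  then show ?thesis using assms(1) by (simp add: R_def mat2_collapse)
qed

lemma finite_image_factor:
  assumes fin: "finite (p ` S)" and f: "\<And>x y. x \<in> S \<Longrightarrow> y \<in> S \<Longrightarrow> p x = p y \<Longrightarrow> f x = f y"
  shows "finite (f ` S)"
proof -
  define g where "g q = f (SOME x. x \<in> S \<and> p x = q)" for q
  have "f x = g (p x)" if x: "x \<in> S" for x
  proof -
    have "(SOME y. y \<in> S \<and> p y = p x) \<in> S \<and> p (SOME y. y \<in> S \<and> p y = p x) = p x"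
      by (rule someI[of _ x]) (simp add: x)
    then show ?thesis unfolding g_def using f[OF x] by metis
  qed
  then have "f ` S = g ` p ` S" unfolding image_image by (rule image_cong[OF refl])
  then show ?thesis using fin by simp
qed

lemma finite_gluings: "finite {P. square_gluing P \<and> squares P = N}"
proof -
  let ?S = "{p. p permutes {..<N}}"
  have "{P. square_gluing P \<and> squares P = N} \<subseteq> (\<lambda>(r, u). \<lparr>squares = N, right = r, up = u\<rparr>) ` (?S \<times> ?S)"
  proof
    fix P :: origami_data assume "P \<in> {P. square_gluing P \<and> squares P = N}"
    then have "right P \<in> ?S" "up P \<in> ?S" "P = \<lparr>squares = N, right = right P, up = up P\<rparr>"
      by (auto simp: square_gluing_def)
    then show "P \<in> (\<lambda>(r, u). \<lparr>squares = N, right = r, up = u\<rparr>) ` (?S \<times> ?S)" by force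
  qed
  moreover have "finite (?S \<times> ?S)" by (simp add: finite_permutations)
  ultimately show ?thesis using finite_subset by blast
qed

section \<open>The Veech group as a subgroup of finite index\<close>

context square_gluing
begin

abbreviation "Veech_int \<equiv> real_matrix -` Veech_group (origami_surface Q)"

lemma mem_Veech_int: "A \<in> Veech_int \<longleftrightarrow> det A = 1 \<and> int_affine A Q Q"
  by (simp add: Veech_group_def int_affine_def affinely_equivalent_def det_real_matrix)

lemma Veech_int_mult: "A \<in> Veech_int \<Longrightarrow> B \<in> Veech_int \<Longrightarrow> A ** B \<in> Veech_int"
  using int_affine_trans[OF square_gluing_axioms square_gluing_axioms, of B A Q]
  unfolding mem_Veech_int by (simp add: det_mul)

lemma Veech_int_adj2: "A \<in> Veech_int \<Longrightarrow> adj2 A \<in> Veech_int"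
  using int_affine_adj2[OF square_gluing_axioms square_gluing_axioms] unfolding mem_Veech_int by (simp add: det_adj2)

lemma subgroup_Veech_int: "subgroup Veech_int SL2Z"
proof (rule group.subgroupI[OF group_SL2Z])
  show "Veech_int \<subseteq> carrier SL2Z" using mem_Veech_int by (auto simp: SL2Z_def)
  show "Veech_int \<noteq> {}" using int_affine_one mem_Veech_int[of "mat 1"] by auto
  show "m_inv SL2Z A \<in> Veech_int" if "A \<in> Veech_int" for A
    using Veech_int_adj2[OF that] m_inv_SL2Z[of A] that mem_Veech_int by (simp add: SL2Z_def)
  show "A \<otimes>\<^bsub>SL2Z\<^esub> B \<in> Veech_int" if "A \<in> Veech_int" "B \<in> Veech_int" for A B
    using Veech_int_mult[OF that] by (simp add: SL2Z_def)
qed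

text \<open>Cosets are labelled by gluings: \<open>A\<close> receives an image of \<open>Q\<close>
  under the inverse of \<open>A\<close>. If \<open>A\<close> and \<open>B\<close> have the same
  label, going there with the inverse of \<open>B\<close> and back with \<open>A\<close> puts
  \<open>A ** adj2 B\<close> into the group, so the right cosets agree. Only finitely many gluings
  have the given number of squares.\<close>

lemma finite_index_Veech_int: "finite_index_subgroup Veech_int SL2Z"
proof -
  have "\<forall>A\<in>carrier SL2Z. \<exists>P. square_gluing P \<and> squares P = squares Q \<and> int_affine (adj2 A) Q P"
    using int_affine_image_exists[OF square_gluing_axioms] by (simp add: SL2Z_def det_adj2)
  then obtain p where p: "\<And>A. A \<in> carrier SL2Z \<Longrightarrow> square_gluing (p A) \<and> squares (p A) = squares Q \<and> int_affine (adj2 A) Q (p A)"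
    by metis
  have coset: "Veech_int #>\<^bsub>SL2Z\<^esub> A = Veech_int #>\<^bsub>SL2Z\<^esub> B"
    if AB: "A \<in> carrier SL2Z" "B \<in> carrier SL2Z" "p A = p B" for A B
  proof -
    have dA: "det A = 1" and dB: "det B = 1" using AB by (auto simp: SL2Z_def)
    have "int_affine (adj2 (adj2 A)) (p A) Q"
      by (rule int_affine_adj2) (use p[OF AB(1)] square_gluing_axioms dA in \<open>auto simp: det_adj2\<close>)
    then have "int_affine (A ** adj2 B) Q Q"
      using int_affine_trans[OF square_gluing_axioms, of "p B" "adj2 B" A Q] p[OF AB(2)] AB(3) by (simp add: adj2_adj2)
    then have m: "A ** adj2 B \<in> Veech_int" unfolding mem_Veech_int using dA dB by (simp add: det_mul det_adj2)
    have "A = (A ** adj2 B) ** B" by (simp add: adj2_mult[OF dB] flip: matrix_mul_assoc)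
    then have "A \<in> Veech_int #>\<^bsub>SL2Z\<^esub> B" unfolding r_coset_def using m by (force simp: SL2Z_def)
    then show ?thesis
      using group.repr_independence[OF group_SL2Z _ AB(2) subgroup_Veech_int] by simp
  qed
  have "p ` carrier SL2Z \<subseteq> {P. square_gluing P \<and> squares P = squares Q}" using p by auto
  then have "finite (p ` carrier SL2Z)" using finite_gluings finite_subset by blast
  then have "finite ((\<lambda>A. Veech_int #>\<^bsub>SL2Z\<^esub> A) ` carrier SL2Z)" by (rule finite_image_factor) (rule coset)
  moreover have "rcosets\<^bsub>SL2Z\<^esub> Veech_int = (\<lambda>A. Veech_int #>\<^bsub>SL2Z\<^esub> A) ` carrier SL2Z"
    unfolding RCOSETS_def by blast
  ultimately have "finite (rcosets\<^bsub>SL2Z\<^esub> Veech_int)" by simp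
  then show ?thesis using subgroup_Veech_int by (simp add: finite_index_subgroup_def)
qed

theorem totally_non_congruence_if_coprime_orders:
  assumes ord: "right Q ^^ a = id" "up Q ^^ b = id" "(up Q \<circ> inv (right Q)) ^^ c = id"
    and coprime: "coprime a b" "coprime a c" "coprime b c"
  shows "totally_non_congruence Veech_int"
proof -
  \<comment> \<open>Applied to the three one-parameter groups of parabolic matrices: one element of
    the Veech group provides all its integral powers.\<close>
  have pw: "F (m * s) \<in> Veech_int"
    if F: "F m \<in> Veech_int" "F 0 = mat 1" "\<And>s t. F (s + t) = F s ** F t" "\<And>s. adj2 (F s) = F (- s)"
    for F :: "int \<Rightarrow> int ^ 2 ^ 2" and m s
  proof (induction s rule: int_induct[of _ 0])
    case base
    have "mat 1 \<in> Veech_int" unfolding mem_Veech_int by (simp add: int_affine_one)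
    then show ?case using F(2) by simp
  next
    case (step1 s)
    then show ?case using Veech_int_mult[OF step1(2) F(1)] by (simp add: F(3) distrib_left)
  next
    case (step2 s)
    have "F (m * (s - 1)) = F (m * s) ** adj2 (F m)" by (simp add: F(4) F(3)[symmetric] right_diff_distrib)
    then show ?case using Veech_int_mult[OF step2(2) Veech_int_adj2[OF F(1)]] by simp
  qed
  interpret U: coprime_unipotents Veech_int "int a" "int b" "int c"
  proof
    show "A ** B \<in> Veech_int" if "A \<in> Veech_int" "B \<in> Veech_int" for A B by (rule Veech_int_mult[OF that])
    show "mat2 1 (int a * s) 0 1 \<in> Veech_int" for s
    proof (rule pw[of "\<lambda>s. mat2 1 s 0 1"])
      show "mat2 1 (int a) 0 1 \<in> Veech_int"
        unfolding mem_Veech_int using upper_if_right_order[OF ord(1)] by (simp add: det_2)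
    qed (simp_all add: mat2_one mat2_mult adj2_def add.commute)
    show "mat2 1 0 (int b * s) 1 \<in> Veech_int" for s
    proof (rule pw[of "\<lambda>s. mat2 1 0 s 1"])
      show "mat2 1 0 (int b) 1 \<in> Veech_int"
        unfolding mem_Veech_int using lower_if_up_order[OF ord(2)] by (simp add: det_2)
    qed (simp_all add: mat2_one mat2_mult adj2_def)
    show "mat2 (1 - int c * s) (- (int c * s)) (int c * s) (1 + int c * s) \<in> Veech_int" for s
    proof (rule pw[of "\<lambda>s. mat2 (1 - s) (- s) s (1 + s)"])
      show "mat2 (1 - int c) (- int c) (int c) (1 + int c) \<in> Veech_int"
        unfolding mem_Veech_int using slanted_if_diagonal_order[OF ord(3)] by (simp add: det_2 algebra_simps)
    qed (simp_all add: mat2_one mat2_mult adj2_def algebra_simps)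
  qed (use coprime in auto)
  have "reduce_mod n ` Veech_int = SL2_mod n" if n: "n \<ge> 1" for n
  proof
    show "reduce_mod n ` Veech_int \<subseteq> SL2_mod n"
    proof
      fix M assume "M \<in> reduce_mod n ` Veech_int"
      then obtain B where "B \<in> Veech_int" and M: "M = reduce_mod n B" by blast
      then have B: "det B = 1" "M = reduce_mod n B" unfolding mem_Veech_int by simp_all
      have "[det M = det B] (mod int n)"
        unfolding det_2 B(2) by (intro cong_diff cong_mult) (simp_all add: reduce_mod_def cong_def)
      then show "M \<in> SL2_mod n" using n B by (auto simp: SL2_mod_def reduce_mod_def cong_def)
    qed
    show "SL2_mod n \<subseteq> reduce_mod n ` Veech_int"
    proof
      fix M assume M: "M \<in> SL2_mod n"
      then have "[det M = 1] (mod int n)" by (simp add: SL2_mod_def cong_def)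
      then obtain B where B: "B \<in> Veech_int" "mat_cong (int n) B M" using U.cong_surjective[of "int n" M] n by auto
      have "M $ i $ j mod int n = M $ i $ j" for i j using M by (simp add: SL2_mod_def)
      then have "reduce_mod n B = M" using B(2) by (simp add: mat2_eq_iff reduce_mod_def mat_cong_def cong_def)
      then show "M \<in> reduce_mod n ` Veech_int" using B(1) by blast
    qed
  qed
  then show ?thesis using finite_index_Veech_int by (simp add: totally_non_congruence_def)
qed

end

section \<open>Commutators of one-cylinder origamis\<close>

definition cycles :: "(nat \<Rightarrow> nat) \<Rightarrow> nat set set" where
  "cycles c = {orbit c x | x. c x \<noteq> x}"

text \<open>The orders of the zeroes: a commutator cycle of length \<open>k\<close> is a cone point
  of angle \<open>2 * pi * k\<close>, that is a zero of order \<open>k - 1\<close>.\<close>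

definition excess :: "(nat \<Rightarrow> nat) \<Rightarrow> nat multiset" where
  "excess c = image_mset (\<lambda>S. card S - 1) (mset_set (cycles c))"

text \<open>A zero of order 0 is a regular point and is not recorded.\<close>

definition opt_mset :: "nat \<Rightarrow> nat multiset" where
  "opt_mset m = (if m = 0 then {#} else {#m#})"

lemma finite_cycles:
  assumes "permutation c"
  shows "finite (cycles c)"
proof -
  have "cycles c = orbit c ` {x. c x \<noteq> x}" by (auto simp: cycles_def)
  then show ?thesis using permutation_finite_support[OF assms] by simp
qed

text \<open>A transposition of \<open>x\<close> with a fixed point \<open>y\<close>, applied after
  \<open>c\<close>, inserts \<open>y\<close> into the cycle of \<open>x\<close>. The commutators of
  words are built from such insertions only.\<close>

locale transpose_new_point =
  fixes c :: "nat \<Rightarrow> nat" and x y :: nat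
  assumes perm: "permutation c" and y: "c y = y" and xy: "x \<noteq> y"
begin

abbreviation "c' \<equiv> Transposition.transpose x y \<circ> c"

lemma perm': "permutation c'"
  using permutation_compose[OF permutation_swap_id perm] by simp

lemma c_eq_y_iff: "c z = y \<longleftrightarrow> z = y"
  using permutation_bijective[OF perm] y by (metis bij_pointE)

lemma c'_other: "c z \<noteq> x \<Longrightarrow> z \<noteq> y \<Longrightarrow> c' z = c z"
  using c_eq_y_iff[of z] by (simp add: Transposition.transpose_def)

text \<open>The point that was sent to \<open>x\<close> is now sent to \<open>y\<close>, and
  \<open>y\<close> is sent to \<open>x\<close>; all other arrows are kept.\<close>

lemma orbit_new: "orbit c' x = insert y (orbit c x)"
proof
  have x': "x \<in> orbit c' x" by (rule permutation_self_in_orbit[OF perm'])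
  have sub: "orbit c x \<subseteq> orbit c' x"
  proof
    fix z assume "z \<in> orbit c x"
    then show "z \<in> orbit c' x"
    proof (induction rule: orbit.induct)
      case base
      show ?case
      proof (cases "c x = x")
        case False
        then show ?thesis using c'_other[of x] xy orbit.base[of c' x] by (simp add: comp_def)
      qed (use x' in \<open>simp add: comp_def\<close>)
    next
      case (step z)
      show ?case
      proof (cases "c z = x \<or> z = y")
        case True
        then show ?thesis using x' step y by (auto simp: comp_def)
      next
        case False
        then show ?thesis using c'_other[of z] orbit.step[OF step(2)] by simp
      qed
    qed
  qed
  obtain z where z: "c z = x" using permutation_bijective[OF perm] by (metis bij_pointE)
  have "z \<in> orbit c x"
    using permutation_self_in_orbit[OF perm, of z] permutation_orbit_step[OF perm, of z] z by simp
  moreover have "c' z = y" using z by simp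
  ultimately have "y \<in> orbit c' x" using sub orbit.step[of z c' x] by auto
  then show "insert y (orbit c x) \<subseteq> orbit c' x" using sub by blast
  show "orbit c' x \<subseteq> insert y (orbit c x)"
  proof
    fix z assume "z \<in> orbit c' x"
    then show "z \<in> insert y (orbit c x)"
    proof (induction rule: orbit.induct)
      case base
      show ?case
      proof (cases "c x = x")
        case False
        then show ?thesis using c'_other[of x] xy orbit.base[of c x] by simp
      qed simp
    next
      case (step z)
      have xc: "x \<in> orbit c x" by (rule permutation_self_in_orbit[OF perm])
      consider "z = y" | "c z = x" | "z \<noteq> y" "c z \<noteq> x" by blast
      then show ?case
      proof cases
        case 1
        then show ?thesis using y xc by simp
      next
        case 2
        then show ?thesis by simp
      next
        case 3
        then have "z \<in> orbit c x" using step by simp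
        then show ?thesis using c'_other[OF 3(2,1)] orbit.step[of z c x] by simp
      qed
    qed
  qed
qed

lemma orbit_old:
  assumes "z \<notin> orbit c x" "z \<noteq> y"
  shows "orbit c' z = orbit c z"
proof (rule orbit_cong)
  show "z \<in> orbit c z" by (rule permutation_self_in_orbit[OF perm])
  fix s assume s: "s \<in> orbit c z"
  have "c s \<noteq> x"
  proof
    assume "c s = x"
    then have "x \<in> orbit c z" using orbit.step[OF s] by simp
    then have "z \<in> orbit c x" using orbit_swap[OF permutation_self_in_orbit[OF perm]] by blast
    then show False using assms by simp
  qed
  moreover have "s \<noteq> y"
  proof
    assume "s = y"
    then have "y \<in> orbit c z" using s by simp
    then have "z \<in> orbit c y" using orbit_swap[OF permutation_self_in_orbit[OF perm]] by blast
    then show False using y assms(2) orbit_eq_singleton_iff[of c y] by simp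
  qed
  ultimately show "c' s = c s" by (rule c'_other)
qed

lemma cycles_new: "cycles c' = insert (insert y (orbit c x)) (cycles c - {orbit c x})"
proof
  have mv: "c' z \<noteq> z \<longleftrightarrow> c z \<noteq> z" if "z \<notin> orbit c x" "z \<noteq> y" for z
    using orbit_old[OF that] orbit_eq_singleton_iff[of c z] orbit_eq_singleton_iff[of c' z] by simp
  have eq: "orbit c z = orbit c x" if "z \<in> orbit c x" for z
    using that cyclic_on_orbit'[OF perm] by (simp add: orbit_cyclic_eq3)
  have eq': "orbit c' z = insert y (orbit c x)" if "z \<in> insert y (orbit c x)" for z
    using that cyclic_on_orbit'[OF perm', of x] unfolding orbit_new by (rule_tac orbit_cyclic_eq3)
  show "cycles c' \<subseteq> insert (insert y (orbit c x)) (cycles c - {orbit c x})"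
  proof
    fix S assume "S \<in> cycles c'"
    then obtain z where z: "S = orbit c' z" "c' z \<noteq> z" by (auto simp: cycles_def)
    show "S \<in> insert (insert y (orbit c x)) (cycles c - {orbit c x})"
    proof (cases "z \<in> insert y (orbit c x)")
      case True
      then show ?thesis using eq' z by simp
    next
      case False
      then have "S = orbit c z" "c z \<noteq> z" using z orbit_old[of z] mv[of z] by auto
      moreover have "orbit c z \<noteq> orbit c x" using False permutation_self_in_orbit[OF perm, of z] by auto
      ultimately show ?thesis by (auto simp: cycles_def)
    qed
  qed
  show "insert (insert y (orbit c x)) (cycles c - {orbit c x}) \<subseteq> cycles c'"
  proof
    fix S assume "S \<in> insert (insert y (orbit c x)) (cycles c - {orbit c x})"
    then consider "S = insert y (orbit c x)" | z where "S = orbit c z" "c z \<noteq> z" "orbit c z \<noteq> orbit c x"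
      by (auto simp: cycles_def)
    then show "S \<in> cycles c'"
    proof cases
      case 1
      have "c' y \<noteq> y" using y xy by simp
      moreover have "orbit c' y = S" using 1 eq'[of y] by simp
      ultimately show ?thesis by (auto simp: cycles_def)
    next
      case 2
      then have "z \<notin> orbit c x" "z \<noteq> y" using eq y by auto
      then show ?thesis using 2 orbit_old[of z] mv[of z] by (auto simp: cycles_def)
    qed
  qed
qed

lemma card_orbit_new: "card (orbit c' x) = card (orbit c x) + 1"
proof -
  have "y \<notin> orbit c x"
  proof
    assume "y \<in> orbit c x"
    then have "x \<in> orbit c y" using orbit_swap[OF permutation_self_in_orbit[OF perm]] by blast
    then show False using y xy orbit_eq_singleton_iff[of c y] by simp
  qed
  moreover have "finite (orbit c x)" using finite_orbit permutation_self_in_orbit[OF perm] by metis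
  ultimately show ?thesis by (simp add: orbit_new)
qed

text \<open>The cycle of \<open>x\<close> gains one point, so its new entry is its old length. The
  old entry is added on the left rather than subtracted on the right, and \<open>opt_mset\<close>
  covers the case that \<open>x\<close> was a fixed point.\<close>

lemma excess_new:
  "excess c' + opt_mset (card (orbit c x) - 1) = excess c + {#card (orbit c x)#}"
proof -
  let ?S = "orbit c x" and ?T = "insert y (orbit c x)"
  have cT: "card ?T - 1 = card ?S" using card_orbit_new by (simp add: orbit_new)
  have fin: "finite (cycles c)" by (rule finite_cycles[OF perm])
  have "?T \<notin> cycles c"
  proof
    assume "?T \<in> cycles c"
    then obtain z where z: "?T = orbit c z" "c z \<noteq> z" by (auto simp: cycles_def)
    then have "y \<in> orbit c z" by auto
    then have "z \<in> orbit c y" using orbit_swap[OF permutation_self_in_orbit[OF perm]] by blast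
    then show False using y z(2) orbit_eq_singleton_iff[of c y] by simp
  qed
  then have e: "excess c' = add_mset (card ?S) (image_mset (\<lambda>S. card S - 1) (mset_set (cycles c - {?S})))"
    unfolding excess_def cycles_new using fin cT by simp
  show ?thesis
  proof (cases "c x = x")
    case True
    then have S: "?S = {x}" by (simp add: orbit_eq_singleton_iff)
    have "?S \<notin> cycles c"
    proof
      assume "?S \<in> cycles c"
      then obtain z where "{x} = orbit c z" "c z \<noteq> z" unfolding S by (auto simp: cycles_def)
      then show False using permutation_self_in_orbit[OF perm, of z] True by auto
    qed
    then have "cycles c - {?S} = cycles c" by blast
    then show ?thesis using S unfolding e by (simp add: excess_def opt_mset_def)
  next
    case False
    then have "?S \<in> cycles c" by (auto simp: cycles_def)
    moreover have "card ?S - 1 \<noteq> 0"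
    proof -
      have "{x, c x} \<subseteq> ?S" using permutation_self_in_orbit[OF perm] orbit.base[of c x] by auto
      moreover have "finite ?S" using finite_orbit permutation_self_in_orbit[OF perm] by metis
      ultimately have "card {x, c x} \<le> card ?S" by (rule card_mono[rotated])
      then show ?thesis using False by simp
    qed
    ultimately show ?thesis using fin unfolding e by (simp add: excess_def opt_mset_def mset_set.remove)
  qed
qed

end

section \<open>Words of blocks, their commutators and zeroes\<close>

datatype block = Gap | Three | Five

fun block_size :: "block \<Rightarrow> nat" where
  "block_size Gap = 1" | "block_size Three = 3" | "block_size Five = 5"

text \<open>The cyclic order \<open>s, s + 4, s + 1, s + 2, s + 3\<close> in \<open>Five\<close>
  splits the commutator of the single block into two disjoint transpositions, giving two simple
  zeroes instead of one zero of even order. In \<open>x \<mapsto> block_perm b s (x - 1)\<close>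
  both kinds of block then have exactly two fixed points among \<open>s + 1\<close>, ...,
  \<open>s + block_size b\<close>.\<close>

fun block_perm :: "block \<Rightarrow> nat \<Rightarrow> nat \<Rightarrow> nat" where
  "block_perm Gap s x = x"
| "block_perm Three s x = (if x = s then s + 1 else if x = s + 1 then s + 2 else if x = s + 2 then s else x)"
| "block_perm Five s x = (if x = s then s + 4 else if x = s + 4 then s + 1 else if x = s + 1 then s + 2
     else if x = s + 2 then s + 3 else if x = s + 3 then s else x)"

text \<open>The blocks of a word are placed consecutively, the head of the list being the last block.\<close>

fun word_length :: "block list \<Rightarrow> nat" where
  "word_length [] = 0" | "word_length (b # w) = word_length w + block_size b"

fun word_perm :: "block list \<Rightarrow> nat \<Rightarrow> nat" where
  "word_perm [] = id" | "word_perm (b # w) = word_perm w \<circ> block_perm b (word_length w)"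

text \<open>Each 3-cycle or 5-cycle adds 2 to the total order of the zeroes and takes two points
  from the long cycle of the diagonal permutation.\<close>

fun core_size :: "block list \<Rightarrow> nat" where
  "core_size [] = 0" | "core_size (b # w) = core_size w + (if b = Gap then 0 else 1)"

text \<open>The commutator of \<open>word_perm w\<close> with the translation by \<open>1\<close>. Appending a block multiplies it
  by a permutation which shares only the point \<open>word_length w\<close> with the previous support, so that a
  block prolongs the last cycle.\<close>

fun word_commutator :: "block list \<Rightarrow> nat \<Rightarrow> nat" where
  "word_commutator [] = id"
| "word_commutator (Gap # w) = word_commutator w"
| "word_commutator (Three # w) = Transposition.transpose (word_length w) (word_length w + 3) \<circ>
     (Transposition.transpose (word_length w) (word_length w + 1) \<circ> word_commutator w)"
| "word_commutator (Five # w) = Transposition.transpose (word_length w) (word_length w + 4) \<circ>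
     (Transposition.transpose (word_length w + 2) (word_length w + 5) \<circ> word_commutator w)"

text \<open>The multiset of the orders of the finished zeroes, and the order of the zero at the right end.\<close>

fun word_zeroes :: "block list \<Rightarrow> nat multiset \<times> nat" where
  "word_zeroes [] = ({#}, 0)"
| "word_zeroes (Gap # w) = (case word_zeroes w of (M, t) \<Rightarrow> (M + opt_mset t, 0))"
| "word_zeroes (Three # w) = (case word_zeroes w of (M, t) \<Rightarrow> (M, t + 2))"
| "word_zeroes (Five # w) = (case word_zeroes w of (M, t) \<Rightarrow> (add_mset (t + 1) M, 1))"

lemma block_perm_less: "x < s \<Longrightarrow> block_perm b s x = x"
  by (cases b) auto

lemma block_perm_ge: "s \<le> x \<Longrightarrow> s \<le> block_perm b s x"
  by (cases b) auto

lemma block_perm_outside: "s + block_size b \<le> x \<Longrightarrow> block_perm b s x = x"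
  by (cases b) auto

lemma word_perm_ge: "word_length w \<le> x \<Longrightarrow> word_perm w x = x"
  by (induction w) (auto simp: block_perm_outside)

lemma word_perm_Cons_less: "x < word_length w \<Longrightarrow> word_perm (b # w) x = word_perm w x"
  by (simp add: block_perm_less)

lemma word_perm_Cons_ge: "word_length w \<le> x \<Longrightarrow> word_perm (b # w) x = block_perm b (word_length w) x"
  by (simp add: block_perm_ge word_perm_ge)

lemma block_perm_lt: "s \<le> x \<Longrightarrow> x < s + block_size b \<Longrightarrow> block_perm b s x < s + block_size b"
  by (cases b) auto

lemma word_perm_less: "x < word_length w \<Longrightarrow> word_perm w x < word_length w"
proof (induction w arbitrary: x)
  case (Cons b w)
  show ?case
  proof (cases "x < word_length w")
    case True
    then show ?thesis using Cons.IH[OF True] word_perm_Cons_less[OF True, of b] by simp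
  next
    case False
    then show ?thesis using word_perm_Cons_ge[of w x b] block_perm_lt[of "word_length w" x b] Cons.prems by simp
  qed
qed simp

lemma block_perm_order: "block_perm b s ^^ 15 = id"
proof (cases b)
  case Gap
  then have "block_perm b s = id" by (auto simp: fun_eq_iff)
  then show ?thesis by simp
next
  case Three
  have "block_perm b s ^^ 3 = id" by (auto simp: fun_eq_iff Three eval_nat_numeral)
  then have "(block_perm b s ^^ 3) ^^ 5 = id" by simp
  then show ?thesis by (simp add: funpow_mult)
next
  case Five
  have "(block_perm b s ^^ 5) x = id x" for x
  proof -
    have f: "block_perm b s s = s + 4" "block_perm b s (s + 4) = s + 1" "block_perm b s (s + 1) = s + 2"
      "block_perm b s (s + 2) = s + 3" "block_perm b s (s + 3) = s" by (simp_all add: Five)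
    have "(block_perm b s ^^ 5) x =
        block_perm b s (block_perm b s (block_perm b s (block_perm b s (block_perm b s x))))"
      by (simp add: numeral_eq_Suc)
    moreover consider "x = s" | "x = s + 1" | "x = s + 2" | "x = s + 3" | "x = s + 4" | "x < s \<or> s + 4 < x" by linarith
    then have "block_perm b s (block_perm b s (block_perm b s (block_perm b s (block_perm b s x)))) = x"
    proof cases
      case 6
      then have "block_perm b s x = x" by (auto simp: Five)
      then show ?thesis by (simp only:)
    qed (simp_all only: f)
    ultimately show ?thesis by simp
  qed
  then have "block_perm b s ^^ 5 = id" by (rule ext)
  then have "(block_perm b s ^^ 5) ^^ 3 = id" by simp
  then show ?thesis by (simp add: funpow_mult)
qed

lemma word_perm_order: "word_perm w ^^ 15 = id"
proof (induction w)
  case (Cons b w)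
  let ?L = "word_length w"
  have lo: "(word_perm (b # w) ^^ n) x = (word_perm w ^^ n) x \<and> (word_perm w ^^ n) x < ?L" if "x < ?L" for n x
    by (induction n) (use that word_perm_Cons_less word_perm_less in auto)
  have hi: "(word_perm (b # w) ^^ n) x = (block_perm b ?L ^^ n) x \<and> ?L \<le> (block_perm b ?L ^^ n) x" if "?L \<le> x" for n x
    by (induction n) (use that word_perm_Cons_ge block_perm_ge in \<open>auto simp del: word_perm.simps\<close>)
  show ?case
  proof
    fix x
    show "(word_perm (b # w) ^^ 15) x = id x"
      using lo[of x 15] hi[of x 15] Cons.IH block_perm_order[of b ?L] by (cases "x < ?L") auto
  qed
next
  case Nil
  have "word_perm [] = id" by (simp add: fun_eq_iff)
  then show ?case by (simp only: id_funpow)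
qed

lemma permutes_if_funpow_id:
  assumes "f ^^ Suc m = id" "\<And>x. x \<notin> S \<Longrightarrow> f x = x"
  shows "f permutes S"
proof -
  have "f ((f ^^ m) x) = x" "(f ^^ m) (f x) = x" for x
    using assms(1) funpow_Suc_right[of m f] by (simp_all add: fun_eq_iff del: funpow.simps) (simp add: fun_eq_iff)
  then show ?thesis unfolding permutes_def using assms(2) by metis
qed

lemma word_perm_permutes: "word_perm w permutes {..<word_length w}"
  using word_perm_order[of w] by (intro permutes_if_funpow_id[where m = 14]) (auto simp: word_perm_ge eval_nat_numeral)

lemma word_commutator_gt: "word_length w < x \<Longrightarrow> word_commutator w x = x"
  by (induction w rule: word_commutator.induct) (auto simp: Transposition.transpose_def)

lemma permutation_word_commutator: "permutation (word_commutator w)"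
  by (induction w rule: word_commutator.induct)
    (auto intro!: permutation_compose permutation_swap_id simp del: o_apply)

lemma word_commutator_le:
  assumes "x \<le> word_length w"
  shows "word_commutator w x \<le> word_length w"
proof (rule ccontr)
  assume n: "\<not> word_commutator w x \<le> word_length w"
  then have "word_commutator w (word_commutator w x) = word_commutator w x" by (intro word_commutator_gt) simp
  then have "word_commutator w x = x" using permutation_bijective[OF permutation_word_commutator] by (metis bij_pointE)
  then show False using n assms by simp
qed

text \<open>Describes the commutator with a long cyclic shift without mentioning its length:
  \<open>c (Suc (p x)) = p (Suc x)\<close> inside the word. The value at 0 stems from the
  wrap-around, where the square before 0 is fixed by the word.\<close>

lemma word_commutator_eq:
  "word_commutator w (Suc (word_perm w x)) = word_perm w (Suc x) \<and> word_commutator w 0 = word_perm w 0"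
proof (induction w arbitrary: x)
  case (Cons b w)
  let ?L = "word_length w"
  have IH: "word_commutator w (Suc (word_perm w x)) = word_perm w (Suc x)" "word_commutator w 0 = word_perm w 0" for x
    using Cons.IH by auto
  \<comment> \<open>The new block interferes with earlier points only where \<open>Suc x\<close> is
    its first square.\<close>
  have low: "word_commutator w (Suc (word_perm (b # w) x)) = (if Suc x = ?L then ?L else word_perm (b # w) (Suc x))"
    if "x < ?L" for x
    using IH(1)[of x] word_perm_Cons_less[of x w b] word_perm_Cons_less[of "Suc x" w b] word_perm_ge[of w "Suc x"] that
    by (auto simp del: word_perm.simps)
  have lt: "word_perm (b # w) x < ?L" if "x < ?L" for x
    using word_perm_less[OF that] word_perm_Cons_less[OF that, of b] by simp
  have hi: "word_commutator w (Suc (word_perm (b # w) x)) = Suc (block_perm b ?L x)" if "?L \<le> x" for x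
    using word_perm_Cons_ge[OF that, of b] block_perm_ge[OF that, of b] word_commutator_gt[of w "Suc (block_perm b ?L x)"]
    by (simp del: word_perm.simps)
  have z: "word_commutator w 0 = (if ?L = 0 then 0 else word_perm (b # w) 0)"
    using IH(2) word_perm_ge[of w 0] word_perm_Cons_less[of 0 w b] by (auto simp del: word_perm.simps)
  have wL: "word_perm (b # w) x = block_perm b ?L x" if "?L \<le> x" for x by (rule word_perm_Cons_ge[OF that])
  show ?case
  proof (cases "x < ?L")
    case True
    note lx = low[OF True] and l0 = lt[of 0] and lS = lt[of "Suc x"] and LL = wL[of ?L]
    show ?thesis using lx l0 lS LL z True
      by (cases b; cases "Suc x = ?L") (auto simp: Transposition.transpose_def simp del: word_perm.simps)
  next
    case False
    then have ge: "?L \<le> x" "?L \<le> Suc x" by auto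
    have l0: "word_commutator (b # w) 0 = word_perm (b # w) 0"
      using lt[of 0] z wL[of ?L] by (cases b; cases "?L = 0") (auto simp: Transposition.transpose_def simp del: word_perm.simps)
    note hx = hi[OF ge(1)] and wx = wL[OF ge(2)]
    have "word_commutator (b # w) (Suc (word_perm (b # w) x)) = block_perm b ?L (Suc x)"
    proof (cases b)
      case Gap
      then show ?thesis using hx by (simp del: word_perm.simps)
    next
      case Three
      consider "x = ?L" | "x = ?L + 1" | "x = ?L + 2" | "?L + 3 \<le> x" using ge(1) by linarith
      then show ?thesis using hx Three
        by cases (simp_all add: Transposition.transpose_def del: word_perm.simps)
    next
      case Five
      consider "x = ?L" | "x = ?L + 1" | "x = ?L + 2" | "x = ?L + 3" | "x = ?L + 4" | "?L + 5 \<le> x"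
        using ge(1) by linarith
      then show ?thesis using hx Five
        by cases (simp_all add: Transposition.transpose_def del: word_perm.simps)
    qed
    then show ?thesis using l0 wx by simp
  qed
qed (simp add: id_def)

text \<open>The second component plus one is the length of the cycle through the end point
  \<open>word_length w\<close>, possibly a fixed point. \<open>Gap\<close> moves the end point to a
  fresh fixed point and thereby closes the cycle, \<open>Three\<close> inserts two points into it,
  and \<open>Five\<close> inserts one and puts the new end point into a new transposition.\<close>

lemma word_zeroes_excess:
  "excess (word_commutator w) = fst (word_zeroes w) + opt_mset (snd (word_zeroes w)) \<and>
   card (orbit (word_commutator w) (word_length w)) = Suc (snd (word_zeroes w))"
proof (induction w rule: word_commutator.induct)
  case 1
  have "orbit id (0::nat) = {0}" by (simp add: orbit_eq_singleton_iff)
  then show ?case by (simp add: excess_def cycles_def opt_mset_def id_def)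
next
  case (2 w)
  have "orbit (word_commutator w) (word_length w + 1) = {word_length w + 1}"
    by (simp add: orbit_eq_singleton_iff word_commutator_gt)
  then show ?case using 2 by (simp add: opt_mset_def split: prod.split)
next
  case (3 w)
  let ?L = "word_length w" and ?c = "word_commutator w"
  obtain M t where Mt: "word_zeroes w = (M, t)" by fastforce
  have IH: "excess ?c = M + opt_mset t" "card (orbit ?c ?L) = Suc t" using 3 Mt by simp_all
  interpret A: transpose_new_point ?c ?L "?L + 1"
    by unfold_locales (auto simp: permutation_word_commutator word_commutator_gt)
  interpret B: transpose_new_point A.c' ?L "?L + 3"
  proof
    show "permutation A.c'" by (rule A.perm')
    show "A.c' (?L + 3) = ?L + 3" by (simp add: Transposition.transpose_def word_commutator_gt)
  qed simp
  have "excess A.c' = M + {#Suc t#}" using A.excess_new IH by simp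
  moreover have cA: "card (orbit A.c' ?L) = Suc (Suc t)" using A.card_orbit_new IH by simp
  ultimately have "excess B.c' = M + {#Suc (Suc t)#}" using B.excess_new by (simp add: opt_mset_def)
  moreover have "card (orbit B.c' (?L + 3)) = Suc (Suc (Suc t))"
  proof -
    have "?L + 3 \<in> orbit B.c' ?L" unfolding B.orbit_new by simp
    then have "orbit B.c' (?L + 3) = orbit B.c' ?L" by (rule orbit_cyclic_eq3[OF cyclic_on_orbit'[OF B.perm']])
    then show ?thesis using B.card_orbit_new cA by simp
  qed
  ultimately show ?case by (simp add: Mt opt_mset_def comp_def)
next
  case (4 w)
  let ?L = "word_length w" and ?c = "word_commutator w"
  obtain M t where Mt: "word_zeroes w = (M, t)" by fastforce
  have IH: "excess ?c = M + opt_mset t" "card (orbit ?c ?L) = Suc t" using 4 Mt by simp_all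
  interpret A: transpose_new_point ?c "?L + 2" "?L + 5"
    by unfold_locales (auto simp: permutation_word_commutator word_commutator_gt)
  interpret B: transpose_new_point A.c' ?L "?L + 4"
  proof
    show "permutation A.c'" by (rule A.perm')
    show "A.c' (?L + 4) = ?L + 4" by (simp add: Transposition.transpose_def word_commutator_gt)
  qed simp
  have o2: "orbit ?c (?L + 2) = {?L + 2}" by (simp add: orbit_eq_singleton_iff word_commutator_gt)
  have eA: "excess A.c' = M + opt_mset t + {#1#}" using A.excess_new IH o2 by (simp add: opt_mset_def)
  \<comment> \<open>The new transposition of \<open>?L + 2\<close> and \<open>?L + 5\<close> leaves
    the old last cycle alone, which still has length \<open>Suc t\<close> when \<open>?L + 4\<close>
    is inserted.\<close>
  have oL: "orbit A.c' ?L = orbit ?c ?L" by (rule A.orbit_old) (unfold o2, simp_all)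
  have "excess B.c' + opt_mset t = M + opt_mset t + {#1#} + {#Suc t#}" using B.excess_new IH eA oL by simp
  then have eB: "excess B.c' = add_mset (Suc t) M + {#1#}" by simp
  have o5: "orbit A.c' (?L + 5) = {?L + 5, ?L + 2}"
  proof -
    have "?L + 5 \<in> orbit A.c' (?L + 2)" unfolding A.orbit_new by simp
    then have "orbit A.c' (?L + 5) = orbit A.c' (?L + 2)" by (rule orbit_cyclic_eq3[OF cyclic_on_orbit'[OF A.perm']])
    then show ?thesis unfolding A.orbit_new o2 by simp
  qed
  have "orbit B.c' (?L + 5) = orbit A.c' (?L + 5)"
  proof (rule B.orbit_old)
    have "?L \<notin> orbit A.c' (?L + 5)" unfolding o5 by simp
    then show "?L + 5 \<notin> orbit A.c' ?L"
      using orbit_swap[OF permutation_self_in_orbit[OF A.perm'], of "?L + 5" ?L] by blast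
  qed simp
  then have "card (orbit B.c' (?L + 5)) = 2" using o5 by simp
  then show ?case using eB by (simp add: Mt opt_mset_def comp_def)
qed

lemma word_zeroes_threes: "word_zeroes (replicate k Three @ w) = (fst (word_zeroes w), snd (word_zeroes w) + 2 * k)"
  by (induction k) (auto simp: case_prod_unfold)

lemma word_zeroes_sum: "sum_mset (fst (word_zeroes w)) + snd (word_zeroes w) = 2 * core_size w"
  by (induction w rule: word_commutator.induct) (auto simp: case_prod_unfold opt_mset_def)

text \<open>Even orders are produced singly by 3-cycles. Odd orders can be taken in pairs because
  the total is even, and each pair uses one 5-cycle.\<close>

lemma word_exists:
  assumes "\<And>x. x \<in># A \<Longrightarrow> x \<ge> 1" "even (sum_mset A)"
  shows "\<exists>w. fst (word_zeroes w) + opt_mset (snd (word_zeroes w)) = A"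
  using assms
proof (induction "size A" arbitrary: A rule: less_induct)
  case less
  have par: "even (sum_mset B)" if "\<And>x. x \<in># B \<Longrightarrow> even x" for B :: "nat multiset"
    using that by (induction B) auto
  show ?case
  proof (cases "A = {#}")
    case True
    then show ?thesis by (intro exI[of _ "[]"]) (simp add: opt_mset_def)
  next
    case False
    show ?thesis
    proof (cases "\<exists>x. x \<in># A \<and> even x")
      case True
      then obtain x where x: "x \<in># A" "even x" by blast
      then obtain B where A: "A = add_mset x B" by (metis multi_member_split)
      obtain w where w: "fst (word_zeroes w) + opt_mset (snd (word_zeroes w)) = B"
        using less.hyps[of B] less.prems x A by auto
      have "x \<ge> 1" using less.prems(1)[OF x(1)] .
      then obtain k where k: "x = 2 * k" "k \<noteq> 0" using x(2) by (auto elim!: evenE)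
      \<comment> \<open>The gap closes the last cycle of \<open>w\<close>; the \<open>k\<close>
        threes then give a zero of order \<open>2 * k\<close>. Lists grow at the head.\<close>
      show ?thesis
        by (rule exI[of _ "replicate k Three @ Gap # w"])
          (use w k A in \<open>simp add: word_zeroes_threes case_prod_unfold opt_mset_def\<close>)
    next
      case no_even: False
      obtain x where x: "x \<in># A" using False by blast
      then obtain B where A: "A = add_mset x B" by (metis multi_member_split)
      have ox: "odd x" using no_even x by blast
      have "\<exists>y. y \<in># B \<and> odd y"
      proof (rule ccontr)
        assume "\<not> ?thesis"
        then have "even (sum_mset B)" using par by blast
        then show False using less.prems(2) A ox by simp
      qed
      then obtain y where y: "y \<in># B" "odd y" by blast
      then obtain D where B: "B = add_mset y D" by (metis multi_member_split)
      obtain w where w: "fst (word_zeroes w) + opt_mset (snd (word_zeroes w)) = D"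
        using less.hyps[of D] less.prems ox y A B by auto
      obtain k l where k: "x = 2 * k + 1" "y = 2 * l + 1" using ox y(2) by (auto elim!: oddE)
      \<comment> \<open>Read from the right: after the gap, \<open>k\<close> threes give order
        \<open>2 * k\<close>, the five finishes this zero at \<open>2 * k + 1\<close> and starts one
        of order 1, which \<open>l\<close> threes extend to \<open>2 * l + 1\<close>.\<close>
      show ?thesis
        by (rule exI[of _ "replicate l Three @ Five # replicate k Three @ Gap # w"])
          (use w k A B in \<open>simp add: word_zeroes_threes case_prod_unfold opt_mset_def add_mset_commute\<close>)
    qed
  qed
qed

text \<open>Here \<open>h\<close> stands for \<open>up \<circ> inv right\<close> on the squares of
  the word. From the right end of the word it walks down to 0, and each 3-cycle or 5-cycle leaves
  out two points, which are fixed by \<open>h\<close>. The hypothesis concerns positive positions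
  only, so the behaviour of \<open>h\<close> at the wrap-around is left open.\<close>

lemma word_path:
  assumes "\<And>x. 0 < x \<Longrightarrow> x \<le> word_length w \<Longrightarrow> h x = word_perm w (x - 1)"
  shows "2 * core_size w \<le> word_length w \<and> (h ^^ (word_length w - 2 * core_size w)) (word_length w) = 0 \<and>
    (\<forall>x\<le>word_length w. h x = x \<or> (\<exists>m. (h ^^ m) (word_length w) = x))"
  using assms
proof (induction w)
  case Nil
  then show ?case by (auto intro: exI[of _ 0])
next
  case (Cons b w)
  let ?L = "word_length w" and ?C = "core_size w"
  have hw: "h x = word_perm w (x - 1)" if "0 < x" "x \<le> ?L" for x
    using Cons.prems[of x] that word_perm_Cons_less[of "x - 1" w b] by (simp del: word_perm.simps)
  note IH = Cons.IH[OF hw]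
  have IHs: "2 * ?C \<le> ?L" "(h ^^ (?L - 2 * ?C)) ?L = 0"
    "\<And>x. x \<le> ?L \<Longrightarrow> h x = x \<or> (\<exists>m. (h ^^ m) ?L = x)" using IH by auto
  have hb: "h x = block_perm b ?L (x - 1)" if "?L < x" "x \<le> ?L + block_size b" for x
    using Cons.prems[of x] that word_perm_Cons_ge[of w "x - 1" b] by (simp del: word_perm.simps)
  \<comment> \<open>The path enters the new block at its right end and reaches the right end of the
    old word after \<open>j\<close> steps: 1 for a gap or a 3-cycle, 3 for a 5-cycle.\<close>
  have step: ?case
    if j: "(h ^^ j) (?L + block_size b) = ?L" "?L + block_size b - 2 * core_size (b # w) = (?L - 2 * ?C) + j"
      "2 * core_size (b # w) \<le> ?L + block_size b"
      "\<And>x. ?L < x \<Longrightarrow> x \<le> ?L + block_size b \<Longrightarrow> h x = x \<or> (\<exists>m. (h ^^ m) (?L + block_size b) = x)" for j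
  proof -
    have add: "(h ^^ (m + j)) (?L + block_size b) = (h ^^ m) ?L" for m using j(1) by (simp add: funpow_add)
    have "h x = x \<or> (\<exists>m. (h ^^ m) (?L + block_size b) = x)" if x: "x \<le> ?L + block_size b" for x
    proof (cases "x \<le> ?L")
      case True
      then show ?thesis using IHs(3) add by metis
    qed (use j(4) x in auto)
    then show ?thesis using j(2,3) add[of "?L - 2 * ?C"] IHs(2) by simp
  qed
  show ?case
  proof (cases b)
    case Gap
    have h1: "h (?L + 1) = ?L" using hb[of "?L + 1"] Gap by simp
    show ?thesis
      by (rule step[of 1]) (use h1 IHs(1) Gap in \<open>auto intro: exI[of _ 0] simp: le_Suc_eq\<close>)
  next
    case Three
    have h: "h (?L + 3) = ?L" "h (?L + 1) = ?L + 1" "h (?L + 2) = ?L + 2"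
      using hb[of "?L + 3"] hb[of "?L + 1"] hb[of "?L + 2"] Three by simp_all
    show ?thesis
    proof (rule step[of 1])
      fix x assume "?L < x" "x \<le> ?L + block_size b"
      then consider "x = ?L + 1" | "x = ?L + 2" | "x = ?L + 3" using Three by fastforce
      then show "h x = x \<or> (\<exists>m. (h ^^ m) (?L + block_size b) = x)"
        using h Three by cases (auto intro: exI[of _ 0])
    qed (use h IHs(1) Three in auto)
  next
    case Five
    have h: "h (?L + 5) = ?L + 1" "h (?L + 1) = ?L + 4" "h (?L + 4) = ?L" "h (?L + 2) = ?L + 2" "h (?L + 3) = ?L + 3"
      using hb[of "?L + 5"] hb[of "?L + 1"] hb[of "?L + 4"] hb[of "?L + 2"] hb[of "?L + 3"] Five by simp_all
    show ?thesis
    proof (rule step[of 3])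
      fix x assume "?L < x" "x \<le> ?L + block_size b"
      then consider "x = ?L + 1" | "x = ?L + 2" | "x = ?L + 3" | "x = ?L + 4" | "x = ?L + 5" using Five by fastforce
      then show "h x = x \<or> (\<exists>m. (h ^^ m) (?L + block_size b) = x)"
      proof cases
        case 1
        then have "(h ^^ 1) (?L + block_size b) = x" using h Five by simp
        then show ?thesis by blast
      next
        case 4
        then have "(h ^^ 2) (?L + block_size b) = x" using h Five by (simp add: eval_nat_numeral)
        then show ?thesis by blast
      next
        case 5
        then have "(h ^^ 0) (?L + block_size b) = x" using Five by simp
        then show ?thesis by blast
      qed (use h in auto)
    qed (use h IHs(1) Five in \<open>auto simp: eval_nat_numeral\<close>)
  qed
qed

text \<open>Moved points are singular vertices, so this provides the horizontal and the vertical
  edge needed for reducedness. Both can be found in the last block that is not a gap.\<close>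

lemma adjacent_moved_points:
  assumes "core_size w > 0"
  shows "\<exists>i j. i < word_length w \<and> j < word_length w \<and> word_commutator w i \<noteq> i \<and> word_commutator w (Suc i) \<noteq> Suc i \<and>
    word_commutator w j \<noteq> j \<and> word_commutator w (word_perm w j) \<noteq> word_perm w j"
  using assms
proof (induction w)
  case (Cons b w)
  let ?L = "word_length w"
  have le: "word_commutator w ?L \<le> ?L" by (rule word_commutator_le) simp
  have gt: "word_commutator w x = x" if "?L < x" for x by (rule word_commutator_gt[OF that])
  have wL: "word_perm (b # w) ?L = block_perm b ?L ?L" by (rule word_perm_Cons_ge) simp
  show ?case
  proof (cases b)
    case Gap
    then obtain i j where ij: "i < ?L" "j < ?L" "word_commutator w i \<noteq> i" "word_commutator w (Suc i) \<noteq> Suc i"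
      "word_commutator w j \<noteq> j" "word_commutator w (word_perm w j) \<noteq> word_perm w j" using Cons by auto
    then show ?thesis using Gap by (rule_tac exI[of _ i], rule_tac exI[of _ j]) (auto simp: fun_eq_iff)
  next
    case Three
    have "word_commutator (b # w) ?L \<noteq> ?L" using le Three by (auto simp: Transposition.transpose_def)
    moreover have "word_commutator (b # w) (Suc ?L) \<noteq> Suc ?L" using gt[of "Suc ?L"] Three by (simp add: Transposition.transpose_def)
    moreover have "word_perm (b # w) ?L = Suc ?L" using wL Three by simp
    ultimately show ?thesis using Three by (rule_tac exI[of _ ?L], rule_tac exI[of _ ?L]) simp
  next
    case Five
    have "word_commutator (b # w) ?L \<noteq> ?L" using le Five by (auto simp: Transposition.transpose_def)
    moreover have "word_commutator (b # w) (?L + 4) \<noteq> ?L + 4"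
      using gt[of "?L + 4"] Five by (simp add: Transposition.transpose_def)
    moreover have "word_commutator (b # w) (Suc (?L + 4)) \<noteq> Suc (?L + 4)"
    proof -
      have "word_commutator w (?L + 5) = ?L + 5" by (rule gt) simp
      then have "word_commutator (b # w) (?L + 5) \<noteq> ?L + 5" using Five by (simp add: Transposition.transpose_def)
      then show ?thesis by (simp only: eval_nat_numeral add_Suc_right) simp
    qed
    moreover have "word_perm (b # w) ?L = ?L + 4" using wL Five by simp
    moreover have "?L + 4 < word_length (b # w)" "?L < word_length (b # w)" using Five by simp_all
    ultimately show ?thesis by (rule_tac exI[of _ "?L + 4"], rule_tac exI[of _ ?L]) (simp only: not_False_eq_True)
  qed
qed simp

section \<open>The one-cylinder origami of a word\<close>

definition word_origami :: "nat \<Rightarrow> block list \<Rightarrow> origami_data" where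
  "word_origami N w = \<lparr>squares = N, right = (\<lambda>i. if i < N then (i + 1) mod N else i), up = word_perm w\<rparr>"

text \<open>The strict inequality leaves the last square fixed by \<open>up\<close>, which keeps the
  wrap-around of the cylinder apart from the word.\<close>

locale word_gluing =
  fixes N :: nat and w :: "block list"
  assumes len: "word_length w < N"
begin

abbreviation "O\<^sub>w \<equiv> word_origami N w"

lemma squares [simp]: "squares O\<^sub>w = N"
  and up [simp]: "up O\<^sub>w = word_perm w"
  and right: "right O\<^sub>w i = (if i < N then (i + 1) mod N else i)"
  by (simp_all add: word_origami_def)

lemma right_Suc: "Suc i < N \<Longrightarrow> right O\<^sub>w i = Suc i"
  by (simp add: right)

lemma right_funpow: "i < N \<Longrightarrow> (right O\<^sub>w ^^ m) i = (i + m) mod N"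
  by (induction m) (auto simp: right mod_Suc_eq)

lemma right_outside: "\<not> i < N \<Longrightarrow> (right O\<^sub>w ^^ m) i = i"
  by (induction m) (auto simp: right)

lemma right_order: "right O\<^sub>w ^^ N = id"
proof
  fix i show "(right O\<^sub>w ^^ N) i = id i"
    by (cases "i < N") (simp_all add: right_funpow right_outside)
qed

sublocale square_gluing "O\<^sub>w"
proof
  have "right O\<^sub>w ^^ Suc (N - 1) = id" using right_order len by simp
  then show "right O\<^sub>w permutes {..<squares O\<^sub>w}" by (rule permutes_if_funpow_id) (simp add: right)
  show "up O\<^sub>w permutes {..<squares O\<^sub>w}"
    using permutes_subset[OF word_perm_permutes, of w "{..<N}"] len by auto
qed

lemma transitive: "transitive_gluing O\<^sub>w"
proof -
  have "(0, i) \<in> {(j, k). j < squares O\<^sub>w \<and> (k = right O\<^sub>w j \<or> k = up O\<^sub>w j)}\<^sup>*" if "i < N" for i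
    using that
  proof (induction i)
    case (Suc i)
    have "(i, Suc i) \<in> {(j, k). j < squares O\<^sub>w \<and> (k = right O\<^sub>w j \<or> k = up O\<^sub>w j)}"
      using Suc.prems right_Suc[of i] by simp
    then show ?case using Suc.IH Suc.prems by (meson Suc_lessD rtrancl.rtrancl_into_rtrancl)
  qed simp
  then show ?thesis using len by (auto simp: transitive_gluing_def)
qed

text \<open>Since the word fixes \<open>N - 1\<close>, the wrap-around is felt only at
  \<open>x = N - 1\<close>, where \<open>y = 0\<close>. There the separate value of
  \<open>word_commutator w\<close> at 0 applies.\<close>

lemma commutator: "commutator O\<^sub>w = word_commutator w"
proof
  fix y
  define x where "x = inv (word_perm w) (inv (right O\<^sub>w) y)"
  have y: "y = right O\<^sub>w (word_perm w x)"
    using permutes_inverses(1)[OF right_permutes] permutes_inverses(1)[OF up_permutes]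
    by (simp add: x_def)
  have c: "commutator O\<^sub>w y = word_perm w (right O\<^sub>w x)"
    by (simp add: commutator_def x_def)
  have less: "word_perm w x < N \<longleftrightarrow> x < N" "word_perm w x < N - 1 \<longleftrightarrow> x < N - 1"
    using permutes_in_image[OF up_permutes, of x]
      permutes_in_image[OF permutes_subset[OF word_perm_permutes, of w "{..<N - 1}"], of x] len by auto
  consider "Suc x < N" | "Suc x = N" | "\<not> x < N" by linarith
  then show "commutator O\<^sub>w y = word_commutator w y"
  proof cases
    case 1
    then have "Suc (word_perm w x) < N" using less(2) by linarith
    then show ?thesis using y c 1 word_commutator_eq[of w x] by (simp add: right_Suc)
  next
    case 2
    then have "word_perm w x = x" using len by (intro word_perm_ge) simp
    then have "y = 0" "right O\<^sub>w x = 0" using y 2 by (simp_all add: right)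
    then show ?thesis using c word_commutator_eq[of w x] by simp
  next
    case 3
    then have "word_perm w x = x" using len by (intro word_perm_ge) simp
    then show ?thesis using 3 y c len by (simp add: right word_commutator_gt)
  qed
qed

text \<open>Apart from fixed points there is one cycle: from \<open>?L\<close> down to 0 in
  \<open>?L - 2 * core_size w\<close> steps, from 0 to \<open>N - 1\<close> in one step, and from
  there down to \<open>?L\<close> in \<open>N - 1 - ?L\<close> steps. Its length is
  \<open>N - 2 * core_size w\<close>.\<close>

lemma diagonal_order: "(up O\<^sub>w \<circ> inv (right O\<^sub>w)) ^^ (N - 2 * core_size w) = id"
proof -
  define h where "h = up O\<^sub>w \<circ> inv (right O\<^sub>w)"
  let ?L = "word_length w" and ?m = "N - 2 * core_size w"
  have hS: "h x = word_perm w (x - 1)" if "0 < x" "x < N" for x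
  proof -
    have "right O\<^sub>w (x - 1) = x" using that by (simp add: right)
    then have "inv (right O\<^sub>w) x = x - 1" by (simp add: permutes_inv_eq[OF right_permutes])
    then show ?thesis by (simp add: h_def)
  qed
  have h0: "h 0 = N - 1"
  proof -
    have "right O\<^sub>w (N - 1) = 0" using len by (simp add: right)
    then have "inv (right O\<^sub>w) 0 = N - 1" by (simp add: permutes_inv_eq[OF right_permutes])
    moreover have "word_perm w (N - 1) = N - 1" by (rule word_perm_ge) (use len in simp)
    ultimately show ?thesis by (simp add: h_def)
  qed
  have out: "h x = x" if "\<not> x < N" for x
  proof -
    have "inv (right O\<^sub>w) x = x" using that by (simp add: permutes_inv_eq[OF right_permutes] right)
    moreover have "word_perm w x = x" by (rule word_perm_ge) (use that len in simp)
    ultimately show ?thesis by (simp add: h_def)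
  qed
  have "h x = word_perm w (x - 1)" if "0 < x" "x \<le> ?L" for x using hS that len by simp
  note path = word_path[OF this]
  have C: "2 * core_size w \<le> ?L" and p: "(h ^^ (?L - 2 * core_size w)) ?L = 0"
    and cov: "\<And>x. x \<le> ?L \<Longrightarrow> h x = x \<or> (\<exists>m. (h ^^ m) ?L = x)" using path by auto
  have down: "(h ^^ j) (N - 1) = N - 1 - j" if "?L + j < N" for j
    using that
  proof (induction j)
    case (Suc j)
    have "h (N - 1 - j) = word_perm w (N - 1 - j - 1)" by (rule hS) (use Suc.prems in auto)
    also have "\<dots> = N - 1 - j - 1" by (rule word_perm_ge) (use Suc.prems in simp)
    finally show ?case using Suc by simp
  qed simp
  have top: "(h ^^ Suc (?L - 2 * core_size w)) ?L = N - 1" using p h0 by simp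
  have above: "\<exists>m. (h ^^ m) ?L = x" if "?L \<le> x" "x < N" for x
  proof -
    have "(h ^^ (N - 1 - x)) (N - 1) = x" using down[of "N - 1 - x"] that by simp
    then have "(h ^^ (N - 1 - x + Suc (?L - 2 * core_size w))) ?L = x"
      unfolding funpow_add comp_def top .
    then show ?thesis by blast
  qed
  have loop: "(h ^^ ?m) ?L = ?L"
  proof -
    have "(h ^^ (N - 1 - ?L)) (N - 1) = ?L" using down[of "N - 1 - ?L"] len by simp
    then have "(h ^^ (N - 1 - ?L + Suc (?L - 2 * core_size w))) ?L = ?L"
      unfolding funpow_add comp_def top .
    moreover have "N - 1 - ?L + Suc (?L - 2 * core_size w) = ?m" using C len by simp
    ultimately show ?thesis by (simp only:)
  qed
  have "(h ^^ ?m) x = x" for x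
  proof -
    have "h x = x \<or> (\<exists>m. (h ^^ m) ?L = x)" using cov[of x] above[of x] out[of x] by fastforce
    then show ?thesis
    proof
      assume "h x = x"
      then have "(h ^^ k) x = x" for k by (induction k) simp_all
      then show ?thesis .
    next
      assume "\<exists>m. (h ^^ m) ?L = x"
      then obtain m where "(h ^^ m) ?L = x" by blast
      moreover have "(h ^^ ?m) ((h ^^ m) ?L) = (h ^^ m) ((h ^^ ?m) ?L)"
        by (simp only: funpow_add[THEN fun_cong, unfolded comp_def, symmetric] add.commute)
      ultimately show ?thesis using loop by simp
    qed
  qed
  then show ?thesis by (simp add: h_def fun_eq_iff)
qed

lemma cycles_eq: "cycles (word_commutator w) =
    {orbit (commutator O\<^sub>w) i | i. i < squares O\<^sub>w \<and> commutator O\<^sub>w i \<noteq> i}"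
proof -
  have "i < N" if "word_commutator w i \<noteq> i" for i
    using word_commutator_gt[of w i] that len by (cases "word_length w < i") auto
  then show ?thesis unfolding commutator cycles_def by auto
qed

end

section \<open>Enumeration of the zeroes and choice of the number of squares\<close>

lemma ex_bij_betw_if_image_mset_eq:
  assumes "finite S" "finite T" "image_mset f (mset_set S) = image_mset g (mset_set T)"
  shows "\<exists>h. bij_betw h S T \<and> (\<forall>x\<in>S. g (h x) = f x)"
  using assms
proof (induction S arbitrary: T)
  case empty
  then have "T = {}" by (metis image_mset_is_empty_iff mset_set.empty mset_set_empty_iff)
  then show ?case by (auto simp: bij_betw_def)
next
  case (insert x S)
  have "f x \<in># image_mset g (mset_set T)" using insert.hyps insert.prems(2)[symmetric] by simp
  then obtain y where y: "y \<in> T" "g y = f x" using insert.prems(1) by auto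
  have "image_mset f (mset_set S) = image_mset g (mset_set (T - {y}))"
    using insert.prems(2) insert.hyps mset_set.remove[OF insert.prems(1) y(1)] y(2) by simp
  then obtain h where h: "bij_betw h S (T - {y})" "\<forall>x\<in>S. g (h x) = f x"
    using insert.IH[of "T - {y}"] insert.prems(1) by auto
  have "bij_betw (h(x := y)) (insert x S) (insert y (T - {y}))"
  proof -
    have "bij_betw (h(x := y)) S (T - {y})"
      using h(1) insert.hyps(2) by (subst bij_betw_cong[where g = h]) auto
    then show ?thesis
      using notIn_Un_bij_betw[of x S "h(x := y)" "T - {y}"] insert.hyps(2) by simp
  qed
  moreover have "insert y (T - {y}) = T" using y(1) by blast
  ultimately show ?case using h(2) insert.hyps(2) y(2) by (intro exI[of _ "h(x := y)"]) (auto simp: fun_upd_def)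
qed

text \<open>The number \<open>N\<close> is 1 modulo \<open>C\<close>, hence coprime to
  \<open>C\<close> and to \<open>N - C\<close>. The shift \<open>t\<close> takes care of the primes
  3 and 5; multiples of 15 leave the residues unchanged, \<open>q\<close> supplies infinitely many
  values and \<open>L + 1\<close> makes \<open>N\<close> exceed \<open>L\<close>.\<close>

lemma coprime_family:
  fixes C L :: nat
  assumes "C > 0"
  shows "\<exists>t. \<forall>q. coprime (1 + C * (t + 15 * (q + L + 1))) 15 \<and>
    coprime (1 + C * (t + 15 * (q + L + 1))) (1 + C * (t + 15 * (q + L + 1)) - C) \<and>
    coprime 15 (1 + C * (t + 15 * (q + L + 1)) - C)"
proof -
  \<comment> \<open>Modulo 3 and 5, \<open>N\<close> is \<open>1 + C * t\<close> and
    \<open>N - C\<close> is \<open>1 + C * (t - 1)\<close>. The choice \<open>t = 1\<close> gives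
    \<open>1 + C\<close> and 1, which fails only if \<open>C\<close> is -1; then
    \<open>t = 0\<close> gives 1 and 2. The four numbers are the solutions of the two congruences
    for \<open>t\<close>.\<close>
  define t :: nat where "t = (if C mod 3 = 2 then if C mod 5 = 4 then 0 else 6 else if C mod 5 = 4 then 10 else 1)"
  have cop15: "coprime m 15" if "m mod 3 \<noteq> 0" "m mod 5 \<noteq> 0" for m :: nat
  proof -
    have "coprime m 3" "coprime m 5"
      using that prime_imp_coprime[of 3 m] prime_imp_coprime[of 5 m]
      by (auto simp: coprime_commute mod_eq_0_iff_dvd)
    then have "coprime m (3 * 5)" by (simp only: coprime_mult_right_iff)
    then show ?thesis by simp
  qed
  show ?thesis
  proof (intro exI[of _ t] allI)
    fix q
    let ?N = "1 + C * (t + 15 * (q + L + 1))"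
    define K where "K = C * (q + L)"
    have N: "?N = 1 + C * t + 15 * (K + C)" by (simp add: K_def algebra_simps)
    \<comment> \<open>One copy of \<open>15 * C\<close> is kept apart to avoid subtraction: 14 is -1
      modulo 3 and modulo 5.\<close>
    have NC: "?N - C = 1 + C * t + 14 * C + 15 * K" unfolding N by simp
    have red: "(1 + C * t + m * C + p * X) mod p = (1 + (C mod p) * (t mod p) + (m mod p) * (C mod p)) mod p" for m p X
    proof -
      have "(1 + C * t + m * C + p * X) mod p = (1 + C * t + m * C) mod p" by (rule mod_mult_self2)
      also have "\<dots> = (1 + C * t mod p + m * C mod p) mod p" by (metis mod_add_left_eq mod_add_right_eq)
      also have "\<dots> = (1 + (C mod p) * (t mod p) mod p + (m mod p) * (C mod p) mod p) mod p"
        by (simp only: mod_mult_eq)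
      finally show ?thesis by (metis mod_add_left_eq mod_add_right_eq)
    qed
    have t3: "t mod 3 = (if C mod 3 = 2 then 0 else 1)" and t5: "t mod 5 = (if C mod 5 = 4 then 0 else 1)"
      by (simp_all add: t_def)
    have "C mod 3 = 0 \<or> C mod 3 = 1 \<or> C mod 3 = 2" by presburger
    then have "(1 + C * t + 15 * (K + C)) mod 3 \<noteq> 0" "(1 + C * t + 14 * C + 15 * K) mod 3 \<noteq> 0"
      using red[of 0 3 "5 * (K + C)"] red[of 14 3 "5 * K"] t3 by auto
    moreover have "C mod 5 = 0 \<or> C mod 5 = 1 \<or> C mod 5 = 2 \<or> C mod 5 = 3 \<or> C mod 5 = 4" by presburger
    then have "(1 + C * t + 15 * (K + C)) mod 5 \<noteq> 0" "(1 + C * t + 14 * C + 15 * K) mod 5 \<noteq> 0"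
      using red[of 0 5 "3 * (K + C)"] red[of 14 5 "3 * K"] t5 by auto
    ultimately have "coprime (1 + C * t + 15 * (K + C)) 15" "coprime (1 + C * t + 14 * C + 15 * K) 15"
      using cop15 by blast+
    then have "coprime ?N 15" "coprime (?N - C) 15" unfolding NC unfolding N .
    moreover have "coprime ?N (?N - C)"
    proof -
      have "coprime ?N C"
      proof (rule coprimeI)
        fix d assume d: "d dvd ?N" "d dvd C"
        then have "d dvd C * (t + 15 * (q + L + 1))" by simp
        then show "is_unit d" using d(1) by (simp only: dvd_add_left_iff)
      qed
      moreover have "gcd ?N (?N - C) = gcd ?N C" 
      proof -
        have "C \<le> ?N" unfolding N by simp
        then show ?thesis using gcd_diff2_nat[of C ?N] by (simp only: gcd.commute)
      qed
      ultimately show ?thesis by (simp only: coprime_iff_gcd_eq_1)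
    qed
    ultimately show "coprime ?N 15 \<and> coprime ?N (?N - C) \<and> coprime 15 (?N - C)"
      by (simp add: coprime_commute)
  qed
qed

theorem theorem2:
  fixes n g :: nat and \<alpha> :: "nat \<Rightarrow> nat"
  assumes "n \<ge> 1" and "g \<ge> 2"
    and "\<And>i. i \<in> {1..n} \<Longrightarrow> \<alpha> i \<ge> 1"
    and "(\<Sum>i=1..n. \<alpha> i) = 2 * g - 2"
  shows "\<exists>F :: origami_data set. infinite F \<and>
    pairwise (\<lambda>P Q. \<not> translation_equivalent (origami_surface P) (origami_surface Q)) F \<and>
    (\<forall>Q\<in>F. origami Q \<and>
       origami_surface Q \<in> stratum g n \<alpha> \<and>
       reduced_surface (origami_surface Q) \<and>
       Veech_group (origami_surface Q) \<subseteq> real_matrix ` carrier SL2Z \<and>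
       totally_non_congruence (real_matrix -` Veech_group (origami_surface Q)))"
proof -
  define A where "A = image_mset \<alpha> (mset_set {1..n})"
  have sumA: "sum_mset A = 2 * g - 2" using assms(4) by (simp add: A_def sum_unfold_sum_mset)
  obtain w where w: "fst (word_zeroes w) + opt_mset (snd (word_zeroes w)) = A"
  proof -
    have "x \<ge> 1" if "x \<in># A" for x using that assms(3) by (auto simp: A_def)
    moreover have "even (sum_mset A)" unfolding sumA by simp
    ultimately show thesis using word_exists[of A] that by blast
  qed
  have opt: "sum_mset (opt_mset m) = m" for m by (simp add: opt_mset_def)
  \<comment> \<open>Both sides are the total order of the zeroes; positivity of the genus minus one
    thus supplies at least one 3-cycle or 5-cycle.\<close>
  have core: "2 * core_size w = 2 * g - 2"
    using word_zeroes_sum[of w] sumA unfolding w[symmetric] by (simp add: opt)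
  then have core_pos: "core_size w > 0" using assms(2) by simp
  let ?c = "word_commutator w" and ?L = "word_length w" and ?C = "2 * core_size w"
  have "image_mset (\<lambda>S. card S - 1) (mset_set (cycles ?c)) = A"
    using word_zeroes_excess[of w] w by (simp add: excess_def)
  then obtain Z where Z: "bij_betw Z {1..n} (cycles ?c)" "\<forall>i\<in>{1..n}. card (Z i) - 1 = \<alpha> i"
    using ex_bij_betw_if_image_mset_eq[of "{1..n}" "cycles ?c" \<alpha> "\<lambda>S. card S - 1"]
      finite_cycles[OF permutation_word_commutator] by (auto simp: A_def)
  \<comment> \<open>The truncated subtraction in \<open>excess\<close> is undone by
    \<open>\<alpha> i \<ge> 1\<close>, which makes each cycle nonempty.\<close>
  have cardZ: "card (Z i) = \<alpha> i + 1" if "i \<in> {1..n}" for i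
    using Z(2) assms(3)[OF that] that by fastforce
  obtain t where cop: "\<And>q. coprime (1 + ?C * (t + 15 * (q + ?L + 1))) 15 \<and>
    coprime (1 + ?C * (t + 15 * (q + ?L + 1))) (1 + ?C * (t + 15 * (q + ?L + 1)) - ?C) \<and>
    coprime 15 (1 + ?C * (t + 15 * (q + ?L + 1)) - ?C)"
    using coprime_family[of ?C ?L] core_pos by auto
  define N where "N q = 1 + ?C * (t + 15 * (q + ?L + 1))" for q
  have gluing: "word_gluing (N q) w" for q
  proof
    have "?L \<le> 1 * (t + 15 * (q + ?L + 1))" by simp
    also have "\<dots> \<le> ?C * (t + 15 * (q + ?L + 1))" using core_pos by (intro mult_right_mono) auto
    finally show "?L < N q" by (simp add: N_def)
  qed
  define F where "F = range (\<lambda>q. word_origami (N q) w)"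
  have sq: "squares (word_origami m w) = m" for m by (simp add: word_origami_def)
  have "inj (\<lambda>q. word_origami (N q) w)"
  proof (rule injI)
    fix p q assume "word_origami (N p) w = word_origami (N q) w"
    then have "N p = N q" using sq by metis
    then show "p = q" using core_pos by (simp add: N_def)
  qed
  then have "infinite F" unfolding F_def by (rule range_inj_infinite)
  moreover have "pairwise (\<lambda>P Q. \<not> translation_equivalent (origami_surface P) (origami_surface Q)) F"
  proof (rule pairwiseI)
    fix P Q assume "P \<in> F" "Q \<in> F" and PQ: "P \<noteq> Q"
    then obtain p q where pq: "P = word_origami (N p) w" "Q = word_origami (N q) w" by (auto simp: F_def)
    interpret p: word_gluing "N p" w by (rule gluing)
    interpret q: word_gluing "N q" w by (rule gluing)
    show "\<not> translation_equivalent (origami_surface P) (origami_surface Q)"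
    proof
      assume "translation_equivalent (origami_surface P) (origami_surface Q)"
      then have "squares P = squares Q"
        unfolding pq
        by (rule translation_equivalent_imp_squares_eq[OF p.square_gluing_axioms p.transitive
              q.square_gluing_axioms q.transitive])
      then show False using PQ by (simp add: pq)
    qed
  qed
  moreover have "origami Q \<and> origami_surface Q \<in> stratum g n \<alpha> \<and> reduced_surface (origami_surface Q) \<and>
     Veech_group (origami_surface Q) \<subseteq> real_matrix ` carrier SL2Z \<and>
     totally_non_congruence (real_matrix -` Veech_group (origami_surface Q))" if "Q \<in> F" for Q
  proof -
    obtain q where Q: "Q = word_origami (N q) w" using \<open>Q \<in> F\<close> by (auto simp: F_def)
    interpret word_gluing "N q" w by (rule gluing)
    have 1: "origami Q" unfolding Q by (rule origami_if_transitive[OF transitive])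
    have 2: "origami_surface Q \<in> stratum g n \<alpha>" unfolding Q
    proof (rule origami_in_stratum[OF transitive])
      show "bij_betw Z {1..n} {orbit (commutator O\<^sub>w) i | i. i < squares O\<^sub>w \<and> commutator O\<^sub>w i \<noteq> i}"
        using Z(1) by (simp only: cycles_eq)
    qed (use assms cardZ in auto)
    obtain i j where ij: "i < ?L" "j < ?L" "?c i \<noteq> i" "?c (Suc i) \<noteq> Suc i"
      "?c j \<noteq> j" "?c (word_perm w j) \<noteq> word_perm w j" using adjacent_moved_points[OF core_pos] by blast
    have 3: "reduced_surface (origami_surface Q)" unfolding Q
      by (rule reduced_if_adjacent_singularities[of i j])
        (use ij len right_Suc[of i] in \<open>simp_all add: commutator\<close>)
    have 4: "Veech_group (origami_surface Q) \<subseteq> real_matrix ` carrier SL2Z"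
      using Veech_group_integral 3 unfolding Q by blast
    have 5: "totally_non_congruence (real_matrix -` Veech_group (origami_surface Q))" unfolding Q
    proof (rule totally_non_congruence_if_coprime_orders[OF right_order _ diagonal_order])
      show "up O\<^sub>w ^^ 15 = id" by (simp add: word_perm_order)
    qed (use cop[of q] in \<open>simp_all only: N_def\<close>)
    show ?thesis using 1 2 3 4 5 by blast
  qed
  ultimately show ?thesis by blast
qed

end
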